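(* Let $k$ be a field of characteristic not $2$ and let $A=J(\mathrm{Mat}_3(k),1)$ (a split Albert algebra over $k$). For $u_1,u_2,v_1,v_2\in k^*$ let $t=t(u_1,u_2,v_1,v_2)\in\mathrm{Aut}(A)$, and let $gt\in\mathrm{Aut}(A)$ be the resulting involution of type (I). Then the number of isomorphism classes of $k$-involutions of $\mathrm{Aut}(A)$ of the form $\theta\circ\mathcal I_t=\mathcal I_{gt}$ is as follows: \begin{enumerate} \item[(1)] if $k=K$ is algebraically closed, there is one isomorphism class; \item[(2)] if $k=\mathbb F_p$ with $p>2$, there is one isomorphism class; \item[(3)] if $k=\mathbb R$, there are $3$ isomorphism classes; \item[(4)] if $k=\mathbb Q_p$, there are $2$ isomorphism classes; \item[(5)] if $k=\mathbb Q$, there are infinitely many isomorphism classes. \end{enumerate}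
   Context: First Tits construction $A=J(\mathrm{Mat}_3(k),1)$: the underlying $k$-vector space is $\mathrm{Mat}_3(k)\oplus\mathrm{Mat}_3(k)\oplus\mathrm{Mat}_3(k)$, with elements $a=(a_0,a_1,a_2)$. Put $1=(\mathrm{id},0,0)$, $\mathrm{Tr}(a)=\mathrm{tr}(a_0)$, and $a^{\#}=(a_0^{\#}-a_1a_2,\ a_2^{\#}-a_0a_1,\ a_1^{\#}-a_2a_0)$, where for a $3\times3$ matrix $m$, $m^{\#}$ is its adjugate. Set $a\#b=(a+b)^{\#}-a^{\#}-b^{\#}$ and $\mathrm{Sr}(a,b)=\mathrm{Tr}(a\#b)$. The product is $ab=\tfrac12(a\#b+\mathrm{Tr}(a)b+\mathrm{Tr}(b)a-\mathrm{Sr}(a,b)1)$. This is the split Albert algebra over $k$; $\mathrm{Aut}(A)$ is its (linear) automorphism group, a split group of type $F_4$. The element $t(u_1,u_2,v_1,v_2)\in\mathrm{Aut}(A)$ is the map $(a_0,a_1,a_2)\mapsto(ua_0u^{-1},ua_1v^{-1},va_2u^{-1})$ with $u=\mathrm{diag}(u_1,u_1^{-1}u_2,u_2^{-1})$ and $v=\mathrm{diag}(v_1,v_1^{-1}v_2,v_2^{-1})$. These elements form (the $k$-points of) a $k$-split maximal torus $\mathcal T$ of rank $4$. The element $g\in\mathrm{Aut}(A)$ is $g(a_0,a_1,a_2)=(a_0^T,a_2^T,a_1^T)$, where $T$ is the transpose. For $s\in\mathrm{Aut}(A)$, $\mathcal I_s(x)=sxs^{-1}$, and $\theta=\mathcal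 I_g$; $\theta$ sends every element of $\mathcal T$ to its inverse. An element of order $2$ in $\mathrm{Aut}(A)$ is of type (I) if its fixed subalgebra is a $15$-dimensional subalgebra isomorphic to $H_3(D,\gamma)$, for $D$ a quaternion subalgebra of the split octonion algebra over $k$ and $\gamma\in(k^* )^3$; here $H_3(D,\gamma)$ is the set of $3\times3$ matrices $x$ over $D$ with diagonal entries in $k$ and $\gamma^{-1}\bar x^T\gamma=x$ ($\gamma$ viewed as a diagonal matrix), with product $\frac12(x\cdot y+y\cdot x)$. Two $k$-involutions $\varphi,\varphi'$ of $\mathrm{Aut}(A)$ are isomorphic if $\varphi'=\mathcal I_h\circ\varphi\circ\mathcal I_h^{-1}$ for some $h$ in the group of $k$-linear automorphisms of $A$. *)

theory Defs
  imports
    "HOL-Analysis.Analysis"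
    "HOL-Algebra.Bij"
    "HOL-Computational_Algebra.Computational_Algebra"
    "Berlekamp_Zassenhaus.Finite_Field"
begin

definition mscale :: "'k::field \<Rightarrow> 'k^'n^'m \<Rightarrow> 'k^'n^'m" where
  "mscale c m = (\<chi> i j. c * m $ i $ j)"

text \<open>The \<open>(i, j)\<close> entry of the adjugate is the \<open>(j, i)\<close> cofactor, that is, the determinant of
  \<open>m\<close> with row \<open>j\<close> replaced by the \<open>i\<close>-th standard basis vector.\<close>

definition adjugate :: "'k::field^'n^'n \<Rightarrow> 'k^'n^'n" where
  "adjugate m = (\<chi> i j. det (\<chi> r. if r = j then axis i 1 else m $ r))"

definition diag3 :: "'k::field \<Rightarrow> 'k \<Rightarrow> 'k \<Rightarrow> 'k^3^3" where
  "diag3 x y z = (\<chi> i j. if i = j then (if i = 1 then x else if i = 2 then y else z) else 0)"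

type_synonym 'k albert = "('k^3^3) \<times> ('k^3^3) \<times> ('k^3^3)"

definition albert_scale :: "'k::field \<Rightarrow> 'k albert \<Rightarrow> 'k albert" where
  "albert_scale c = (\<lambda>(a0, a1, a2). (mscale c a0, mscale c a1, mscale c a2))"

definition albert_one :: "'k::field albert" where
  "albert_one = (mat 1, 0, 0)"

definition albert_trace :: "'k::field albert \<Rightarrow> 'k" where
  "albert_trace = (\<lambda>(a0, a1, a2). trace a0)"

definition albert_sharp :: "'k::field albert \<Rightarrow> 'k albert" where
  "albert_sharp = (\<lambda>(a0, a1, a2).
     (adjugate a0 - a1 ** a2, adjugate a2 - a0 ** a1, adjugate a1 - a2 ** a0))"

definition albert_cross :: "'k::field albert \<Rightarrow> 'k albert \<Rightarrow> 'k albert" where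
  "albert_cross a b = albert_sharp (a + b) - albert_sharp a - albert_sharp b"

definition albert_Sr :: "'k::field albert \<Rightarrow> 'k albert \<Rightarrow> 'k" where
  "albert_Sr a b = albert_trace (albert_cross a b)"

definition albert_mult :: "'k::field albert \<Rightarrow> 'k albert \<Rightarrow> 'k albert" where
  "albert_mult a b = albert_scale (1 / 2)
     (albert_cross a b + albert_scale (albert_trace a) b + albert_scale (albert_trace b) a
       - albert_scale (albert_Sr a b) albert_one)"

definition albert_Aut :: "('k::field albert \<Rightarrow> 'k albert) monoid" where
  "albert_Aut =
     \<lparr>carrier = {f. Vector_Spaces.linear albert_scale albert_scale f \<and> bij f \<and>
                    (\<forall>a b. f (albert_mult a b) = albert_mult (f a) (f b))},
      mult = (\<circ>), one = id\<rparr>"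

text \<open>Automorphisms of the group \<open>Aut(A)\<close> are the elements of \<^const>\<open>AutoGroup\<close>, which are
  extensional: they are \<open>undefined\<close> outside the carrier.\<close>

type_synonym 'k aut_map = "('k albert \<Rightarrow> 'k albert) \<Rightarrow> ('k albert \<Rightarrow> 'k albert)"

definition inner_aut :: "('k::field albert \<Rightarrow> 'k albert) \<Rightarrow> 'k aut_map" where
  "inner_aut s = (\<lambda>x\<in>carrier albert_Aut.
     s \<otimes>\<^bsub>albert_Aut\<^esub> x \<otimes>\<^bsub>albert_Aut\<^esub> inv\<^bsub>albert_Aut\<^esub> s)"

definition k_involution :: "'k::field aut_map \<Rightarrow> bool" where
  "k_involution \<phi> \<longleftrightarrow>
     \<phi> \<in> carrier (AutoGroup albert_Aut) \<and>
     \<phi> \<noteq> \<one>\<^bsub>AutoGroup albert_Aut\<^esub> \<and>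
     \<phi> \<otimes>\<^bsub>AutoGroup albert_Aut\<^esub> \<phi> = \<one>\<^bsub>AutoGroup albert_Aut\<^esub>"

definition isomorphic_involutions :: "'k::field aut_map \<Rightarrow> 'k aut_map \<Rightarrow> bool" where
  "isomorphic_involutions \<phi> \<phi>' \<longleftrightarrow>
     (\<exists>h\<in>carrier albert_Aut.
        \<phi>' = inner_aut h \<otimes>\<^bsub>AutoGroup albert_Aut\<^esub> \<phi>
               \<otimes>\<^bsub>AutoGroup albert_Aut\<^esub> inv\<^bsub>AutoGroup albert_Aut\<^esub> (inner_aut h))"

definition torus_elt :: "'k::field \<Rightarrow> 'k \<Rightarrow> 'k \<Rightarrow> 'k \<Rightarrow> 'k albert \<Rightarrow> 'k albert" where
  "torus_elt u1 u2 v1 v2 =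
     (let u = diag3 u1 (inverse u1 * u2) (inverse u2);
          v = diag3 v1 (inverse v1 * v2) (inverse v2)
      in (\<lambda>(a0, a1, a2).
            (u ** a0 ** matrix_inv u, u ** a1 ** matrix_inv v, v ** a2 ** matrix_inv u)))"

definition g_elt :: "'k::field albert \<Rightarrow> 'k albert" where
  "g_elt = (\<lambda>(a0, a1, a2). (transpose a0, transpose a2, transpose a1))"

text \<open>The split octonions are the Cayley--Dickson double of the \<open>2 \<times> 2\<close> matrices with parameter \<open>1\<close>.
  The canonical involution of the \<open>2 \<times> 2\<close> matrices is the adjugate and their norm is the
  determinant.\<close>

type_synonym 'k oct = "('k^2^2) \<times> ('k^2^2)"

definition oct_scale :: "'k::field \<Rightarrow> 'k oct \<Rightarrow> 'k oct" where
  "oct_scale c = (\<lambda>(x, y). (mscale c x, mscale c y))"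

definition oct_one :: "'k::field oct" where
  "oct_one = (mat 1, 0)"

definition oct_mult :: "'k::field oct \<Rightarrow> 'k oct \<Rightarrow> 'k oct" where
  "oct_mult = (\<lambda>(a, b) (c, d). (a ** c + adjugate d ** b, d ** a + b ** adjugate c))"

definition oct_conj :: "'k::field oct \<Rightarrow> 'k oct" where
  "oct_conj = (\<lambda>(a, b). (adjugate a, - b))"

definition oct_norm :: "'k::field oct \<Rightarrow> 'k" where
  "oct_norm = (\<lambda>(a, b). det a - det b)"

definition oct_polar :: "'k::field oct \<Rightarrow> 'k oct \<Rightarrow> 'k" where
  "oct_polar x y = oct_norm (x + y) - oct_norm x - oct_norm y"

text \<open>A quaternion subalgebra is a \<open>4\<close>-dimensional composition subalgebra: a unital subalgebra on
  which the norm is nondegenerate.\<close>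

definition quaternion_subalgebra :: "'k::field oct set \<Rightarrow> bool" where
  "quaternion_subalgebra D \<longleftrightarrow>
     module.subspace oct_scale D \<and>
     vector_space.dim oct_scale D = 4 \<and>
     oct_one \<in> D \<and>
     (\<forall>x\<in>D. \<forall>y\<in>D. oct_mult x y \<in> D) \<and>
     (\<forall>x\<in>D. (\<forall>y\<in>D. oct_polar x y = 0) \<longrightarrow> x = 0)"

text \<open>The condition \<open>\<gamma>\<^sup>-\<^sup>1 x\<^sup>* \<gamma> = x\<close>, with \<open>\<gamma>\<close> diagonal and \<open>x\<^sup>*\<close> the conjugate transpose, is
  written out entrywise.\<close>

definition H3 :: "'k::field oct set \<Rightarrow> 'k^3 \<Rightarrow> ('k oct^3^3) set" where
  "H3 D \<gamma> = {x. (\<forall>i j. x $ i $ j \<in> D) \<and>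
                 (\<forall>i. x $ i $ i \<in> range (\<lambda>c. oct_scale c oct_one)) \<and>
                 (\<forall>i j. oct_scale (inverse (\<gamma> $ i) * \<gamma> $ j) (oct_conj (x $ j $ i)) = x $ i $ j)}"

definition omat_scale :: "'k::field \<Rightarrow> 'k oct^3^3 \<Rightarrow> 'k oct^3^3" where
  "omat_scale c x = (\<chi> i j. oct_scale c (x $ i $ j))"

definition omat_mult :: "'k::field oct^3^3 \<Rightarrow> 'k oct^3^3 \<Rightarrow> 'k oct^3^3" where
  "omat_mult x y = (\<chi> i j. \<Sum>l\<in>UNIV. oct_mult (x $ i $ l) (y $ l $ j))"

definition H3_mult :: "'k::field oct^3^3 \<Rightarrow> 'k oct^3^3 \<Rightarrow> 'k oct^3^3" where
  "H3_mult x y = omat_scale (1 / 2) (omat_mult x y + omat_mult y x)"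

definition fixed_subalgebra :: "('k::field albert \<Rightarrow> 'k albert) \<Rightarrow> 'k albert set" where
  "fixed_subalgebra s = {a. s a = a}"

definition isomorphic_to_H3 :: "'k::field albert set \<Rightarrow> 'k oct set \<Rightarrow> 'k^3 \<Rightarrow> bool" where
  "isomorphic_to_H3 B D \<gamma> \<longleftrightarrow>
     (\<exists>f. bij_betw f B (H3 D \<gamma>) \<and>
          (\<forall>a\<in>B. \<forall>b\<in>B. f (a + b) = f a + f b) \<and>
          (\<forall>c. \<forall>a\<in>B. f (albert_scale c a) = omat_scale c (f a)) \<and>
          (\<forall>a\<in>B. \<forall>b\<in>B. f (albert_mult a b) = H3_mult (f a) (f b)))"

definition type_I :: "('k::field albert \<Rightarrow> 'k albert) \<Rightarrow> bool" where
  "type_I s \<longleftrightarrow>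
     s \<in> carrier albert_Aut \<and> s \<noteq> id \<and> s \<circ> s = id \<and>
     vector_space.dim albert_scale (fixed_subalgebra s) = 15 \<and>
     (\<exists>D \<gamma>. quaternion_subalgebra D \<and> (\<forall>i. \<gamma> $ i \<noteq> 0) \<and>
            isomorphic_to_H3 (fixed_subalgebra s) D \<gamma>)"

text \<open>Over a field of characteristic other than \<open>2\<close> every \<open>g \<circ> t\<close> is of type (I) and every
  \<open>\<I>\<^bsub>g \<circ> t\<^esub>\<close> is an involution, so these two conditions do not cut down the set.\<close>

definition gt_involutions :: "'k::field itself \<Rightarrow> 'k aut_map set" where
  "gt_involutions _ =
     {\<phi>. k_involution \<phi> \<and>
         (\<exists>u1 u2 v1 v2. u1 \<noteq> 0 \<and> u2 \<noteq> 0 \<and> v1 \<noteq> 0 \<and> v2 \<noteq> 0 \<and>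
            type_I (g_elt \<circ> torus_elt u1 u2 v1 v2) \<and>
            \<phi> = inner_aut (g_elt \<circ> torus_elt u1 u2 v1 v2))}"

definition gt_involution_classes :: "'k::field itself \<Rightarrow> 'k aut_map set set" where
  "gt_involution_classes K =
     gt_involutions K //
       {(\<phi>, \<phi>'). \<phi> \<in> gt_involutions K \<and> \<phi>' \<in> gt_involutions K \<and> isomorphic_involutions \<phi> \<phi>'}"

definition padic_abs :: "nat \<Rightarrow> rat \<Rightarrow> real" where
  "padic_abs p q =
     (if q = 0 then 0
      else real p powi (int (multiplicity (int p) (snd (quotient_of q)))
                         - int (multiplicity (int p) (fst (quotient_of q)))))"

text \<open>A field is (isomorphic to) the field of \<open>p\<close>-adic numbers iff it is a completion of the rationals
  for the \<open>p\<close>-adic absolute value: it carries an absolute value that extends the \<open>p\<close>-adic one, for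
  which it is complete and the rationals are dense.\<close>

definition is_padic_field :: "nat \<Rightarrow> 'k::field_char_0 itself \<Rightarrow> bool" where
  "is_padic_field p _ \<longleftrightarrow>
     (\<exists>N :: 'k \<Rightarrow> real.
        (\<forall>x. 0 \<le> N x) \<and> (\<forall>x. N x = 0 \<longleftrightarrow> x = 0) \<and>
        (\<forall>x y. N (x * y) = N x * N y) \<and>
        (\<forall>x y. N (x + y) \<le> N x + N y) \<and>
        (\<forall>q. N (of_rat q) = padic_abs p q) \<and>
        (\<forall>x. \<forall>e>0. \<exists>q. N (x - of_rat q) < e) \<and>
        (\<forall>X :: nat \<Rightarrow> 'k. (\<forall>e>0. \<exists>M. \<forall>m\<ge>M. \<forall>n\<ge>M. N (X m - X n) < e) \<longrightarrow>
           (\<exists>L. (\<lambda>n. N (X n - L)) \<longlonglongrightarrow> 0)))"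

end

theory Submission
  imports Defs "HOL-Number_Theory.Number_Theory"
begin

text \<open>
  In characteristic other than \<open>2\<close> the group \<open>Aut(A)\<close> has trivial centre (\<open>Aut_centre_trivial\<close>), so two involutions \<open>\<I>\<^bsub>s\<^esub>\<close> and \<open>\<I>\<^bsub>t\<^esub>\<close> are
  isomorphic if and only if \<open>s\<close> and \<open>t\<close> are conjugate in \<open>Aut(A)\<close>. Everything is thus about conjugacy
  of the elements \<open>g t\<close>.

  Such an element maps \<open>(a\<^sub>0, a\<^sub>1, a\<^sub>2)\<close> to \<open>(u\<^sup>-\<^sup>1 a\<^sub>0\<^sup>T u, u\<^sup>-\<^sup>1 a\<^sub>2\<^sup>T v, v\<^sup>-\<^sup>1 a\<^sub>1\<^sup>T u)\<close> and depends on two ternary quadratic forms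
  of determinant \<open>1\<close>, namely \<open>u = \<langle>a, b, (a b)\<^sup>-\<^sup>1\<rangle>\<close> and \<open>v = \<langle>c, d, (c d)\<^sup>-\<^sup>1\<rangle>\<close>. The form \<open>v\<close> is the norm form on the pure
  quaternions of an algebra \<open>D\<close>, and the fixed subalgebra is \<open>H\<^sub>3(D, u)\<close>
  (\<open>isomorphic_to_H3_quat_inv\<close>).

  Upper bounds come from two kinds of conjugations. Pairs of matrices with equal determinants replace
  \<open>u\<close> and \<open>v\<close> by isometric forms. The \<open>SL\<^sub>2\<close> of a further long root shows that \<open>b\<close> may be multiplied by
  any nonzero value of \<open>\<langle>1, c\<rangle>\<close> (\<open>quat_inv_norm_cross\<close>). In particular all \<open>g t\<close> for which \<open>D\<close> splits are
  conjugate (\<open>quat_inv_split\<close>); over algebraically closed and over finite fields nothing else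
  occurs.

  Lower bounds come from recovering \<open>D\<close>: it is the centralizer of the action of the fixed subalgebra on
  the \<open>-1\<close>-eigenspace of \<open>g t\<close>. The squares of its noncentral elements that lie in \<open>k\<close> are the numbers \<open>-v(x)\<close>
  (\<open>has_sqrt_minus_c\<close>, \<open>has_sqrt_imp_represented\<close>).

  Over the reals the split algebra gives one class. The Hamilton quaternions give two, according to
  whether \<open>u\<close> is definite; they differ by the existence of an element of square zero in the fixed
  subalgebra. Over the rationals the forms \<open>v = \<langle>p, 1, 1/p\<rangle>\<close> for primes \<open>p \<equiv> 3\<close> modulo \<open>4\<close> give infinitely many algebras,
  which quadratic reciprocity tells apart.

  Over the \<open>p\<close>-adic numbers the norm group of every quadratic extension has index two. This implies
  that there is one division algebra \<open>D\<close> and that every number is a value of \<open>\<langle>1, c\<rangle>\<close> for a suitable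
  diagonalization of \<open>v\<close>, so that \<open>u\<close> can be trivialized (\<open>two_classes_if_norm_index_two\<close>). The index is
  computed from Hensel's lemma, with residues modulo \<open>p\<close> for odd \<open>p\<close> and modulo \<open>8\<close> for \<open>p = 2\<close>.
\<close>

text \<open>The symbol \<open>$\<close> is kept for components of vectors; sharing it with coefficients of power series
  makes the parsing of matrix entries ambiguous. Quantified elements of \<open>A\<close> are not split into
  their three components.\<close>

no_notation fps_nth (infixl \<open>$\<close> 75)

declare split_paired_All [simp del] split_paired_Ex [simp del]

section \<open>Three by three matrices in coordinates\<close>

text \<open>The calculations in \<open>A\<close> come down to identities between entries of \<open>3 \<times> 3\<close> matrices. Writing
  a matrix as a term with nine explicit entries lets the simplifier evaluate every operation.\<close>

definition mat33 :: "'a::zero \<Rightarrow> 'a \<Rightarrow> 'a \<Rightarrow> 'a \<Rightarrow> 'a \<Rightarrow> 'a \<Rightarrow> 'a \<Rightarrow> 'a \<Rightarrow> 'a \<Rightarrow> 'a^3^3" where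
  "mat33 a b c d e f g h i = vector [vector [a, b, c], vector [d, e, f], vector [g, h, i]]"

lemma three_neq [simp]: "(1::3) \<noteq> 2" "(2::3) \<noteq> 1" "(1::3) \<noteq> 3" "(3::3) \<noteq> 1" "(2::3) \<noteq> 3" "(3::3) \<noteq> 2"
  by simp_all

lemma mat33_nth [simp]:
  "mat33 a b c d e f g h i $ 1 $ 1 = a" "mat33 a b c d e f g h i $ 1 $ 2 = b" "mat33 a b c d e f g h i $ 1 $ 3 = c"
  "mat33 a b c d e f g h i $ 2 $ 1 = d" "mat33 a b c d e f g h i $ 2 $ 2 = e" "mat33 a b c d e f g h i $ 2 $ 3 = f"
  "mat33 a b c d e f g h i $ 3 $ 1 = g" "mat33 a b c d e f g h i $ 3 $ 2 = h" "mat33 a b c d e f g h i $ 3 $ 3 = i"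
  by (simp_all only: mat33_def vector_3)

lemma mat33_eq_conv:
  "m = mat33 a b c d e f g h i \<longleftrightarrow>
    m$1$1 = a \<and> m$1$2 = b \<and> m$1$3 = c \<and> m$2$1 = d \<and> m$2$2 = e \<and> m$2$3 = f \<and> m$3$1 = g \<and> m$3$2 = h \<and> m$3$3 = i"
  unfolding vec_eq_iff[of m] vec_eq_iff[of "m $ _"] forall_3 mat33_nth by blast

lemma mat33_cases [case_names mat33, cases type]:
  fixes m :: "'a::zero^3^3"
  obtains a b c d e f g h i where "m = mat33 a b c d e f g h i"
proof
  show "m = mat33 (m$1$1) (m$1$2) (m$1$3) (m$2$1) (m$2$2) (m$2$3) (m$3$1) (m$3$2) (m$3$3)"
    by (simp only: mat33_eq_conv simp_thms)
qed

lemma mat33_eq_iff [simp]: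
  "mat33 a b c d e f g h i = mat33 a' b' c' d' e' f' g' h' i' \<longleftrightarrow>
    a = a' \<and> b = b' \<and> c = c' \<and> d = d' \<and> e = e' \<and> f = f' \<and> g = g' \<and> h = h' \<and> i = i'"
  by (simp only: mat33_eq_conv mat33_nth)

lemma mat33_add [simp]:
  "mat33 a b c d e f g h i + mat33 a' b' c' d' e' f' g' h' i' =
    mat33 (a+a') (b+b') (c+c') (d+d') (e+e') (f+f') (g+g') (h+h') (i+i')"
  by (simp add: mat33_eq_conv mat33_nth)

lemma mat33_diff [simp]:
  "mat33 a b c d e f g h i - mat33 a' b' c' d' e' f' g' h' i' =
    mat33 (a-a') (b-b') (c-c') (d-d') (e-e') (f-f') (g-g') (h-h') (i-i')"
  by (simp add: mat33_eq_conv mat33_nth)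

lemma mat33_uminus [simp]:
  "- mat33 a b c d e f g h i = mat33 (-a) (-b) (-c) (-d) (-e) (-f) (-g) (-h) (-i)"
  by (simp add: mat33_eq_conv mat33_nth)

lemma zero_mat33: "0 = mat33 0 0 0 0 0 0 0 0 0"
  by (simp add: mat33_eq_conv)

lemma one_mat33: "mat 1 = mat33 1 0 0 0 1 0 0 0 1"
  by (simp add: mat33_eq_conv mat_def)

lemma diag3_mat33: "diag3 x y z = mat33 x 0 0 0 y 0 0 0 z"
  by (simp add: mat33_eq_conv diag3_def)

lemma mat33_mscale [simp]:
  "mscale s (mat33 a b c d e f g h i) = mat33 (s*a) (s*b) (s*c) (s*d) (s*e) (s*f) (s*g) (s*h) (s*i)"
  by (simp add: mat33_eq_conv mat33_nth mscale_def)

lemma mat33_mult [simp]: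
  "mat33 a b c d e f g h i ** mat33 a' b' c' d' e' f' g' h' i' =
    mat33 (a*a'+b*d'+c*g') (a*b'+b*e'+c*h') (a*c'+b*f'+c*i')
      (d*a'+e*d'+f*g') (d*b'+e*e'+f*h') (d*c'+e*f'+f*i')
      (g*a'+h*d'+i*g') (g*b'+h*e'+i*h') (g*c'+h*f'+i*i')"
  by (simp add: mat33_eq_conv mat33_nth matrix_matrix_mult_def sum_3)

lemma mat33_transpose [simp]:
  "transpose (mat33 a b c d e f g h i) = mat33 a d g b e h c f i"
  by (simp add: mat33_eq_conv mat33_nth transpose_def)

lemma mat33_trace [simp]: "trace (mat33 a b c d e f g h i) = a + e + i"
  by (simp add: trace_def sum_3 mat33_nth)

lemma mat33_det [simp]:
  "det (mat33 a b c d e f g h i) = a*e*i + b*f*g + c*d*h - a*f*h - b*d*i - c*e*g"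
  by (simp add: det_3 mat33_nth)

lemma mat33_adjugate [simp]:
  "adjugate (mat33 a b c d e f g h i) =
    mat33 (e*i-f*h) (c*h-b*i) (b*f-c*e) (f*g-d*i) (a*i-c*g) (c*d-a*f) (d*h-e*g) (b*g-a*h) (a*e-b*d)"
  by (simp add: mat33_eq_conv mat33_nth adjugate_def det_3 axis_def)

lemma albert_cases [case_names albert, cases type]:
  fixes x :: "'k::field albert"
  obtains a b c d e f g h i a' b' c' d' e' f' g' h' i' a'' b'' c'' d'' e'' f'' g'' h'' i''
  where "x = (mat33 a b c d e f g h i, mat33 a' b' c' d' e' f' g' h' i', mat33 a'' b'' c'' d'' e'' f'' g'' h'' i'')"
proof -
  obtain x0 x1 x2 where x: "x = (x0, x1, x2)" by (cases x)
  show ?thesis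
    by (rule mat33_cases[of x0], rule mat33_cases[of x1], rule mat33_cases[of x2], rule that) (simp only: x)
qed

lemmas albert_op_defs = albert_scale_def albert_one_def albert_trace_def albert_sharp_def albert_cross_def
  albert_Sr_def albert_mult_def

interpretation albert: vector_space "albert_scale :: 'k::field \<Rightarrow> 'k albert \<Rightarrow> 'k albert"
proof
  fix a b :: 'k and x y :: "'k albert"
  show "albert_scale a (x + y) = albert_scale a x + albert_scale a y"
    by (cases x; cases y) (simp add: albert_scale_def algebra_simps)
  show "albert_scale (a + b) x = albert_scale a x + albert_scale b x"
    by (cases x) (simp add: albert_scale_def algebra_simps)
  show "albert_scale a (albert_scale b x) = albert_scale (a * b) x"
    by (cases x) (simp add: albert_scale_def algebra_simps)
  show "albert_scale 1 x = x"
    by (cases x) (simp add: albert_scale_def algebra_simps)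
qed

text \<open>Adjugates reverse products, so \<open>(a\<^sub>1, a\<^sub>2) \<mapsto> (p a\<^sub>1 q\<^sup>-\<^sup>1, q a\<^sub>2 p\<^sup>-\<^sup>1)\<close> is compatible with
  the adjugates in \<open>a\<^sup>#\<close> exactly when the determinants of \<open>p\<close> and \<open>q\<close> agree.\<close>

lemma adjugate_mult: "adjugate (A ** B) = adjugate B ** adjugate (A :: 'k::field^3^3)"
  by (cases A rule: mat33_cases; cases B rule: mat33_cases) (simp add: algebra_simps)

lemma adjugate_mult_self: "adjugate A ** A = mscale (det A) (mat 1 :: 'k::field^3^3)"
  by (cases A) (simp add: algebra_simps one_mat33)

lemma adjugate_transpose: "adjugate (transpose A) = transpose (adjugate (A :: 'k::field^3^3))"
  by (cases A) (simp add: algebra_simps)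

lemma mscale_mult_left: "mscale c (A :: 'k::field^'n^'m) ** B = mscale c (A ** (B :: 'k^'l^'n))"
  by (simp add: mscale_def matrix_matrix_mult_def vec_eq_iff sum_distrib_left mult.assoc)

lemma mscale_mult_right: "(A :: 'k::field^'n^'m) ** mscale c B = mscale c (A ** (B :: 'k^'l^'n))"
  by (simp add: mscale_def matrix_matrix_mult_def vec_eq_iff sum_distrib_left mult.left_commute)

section \<open>Automorphisms of the Albert algebra\<close>

lemma mem_albert_Aut:
  "f \<in> carrier albert_Aut \<longleftrightarrow> (\<forall>x y. f (x + y) = f x + f y) \<and> (\<forall>c x. f (albert_scale c x) = albert_scale c (f x))
     \<and> bij f \<and> (\<forall>a b. f (albert_mult a b) = albert_mult (f a) (f b))"
proof -
  have "Vector_Spaces.linear albert_scale albert_scale f \<longleftrightarrow>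
     (\<forall>x y. f (x + y) = f x + f y) \<and> (\<forall>c x. f (albert_scale c x) = albert_scale c (f x))"
    by (simp add: Vector_Spaces.linear_iff albert.vector_space_axioms)
  then show ?thesis by (auto simp: albert_Aut_def)
qed


text \<open>The product is built from \<open>#\<close>, the trace and the unit, so a linear bijection that respects
  these three is an automorphism. These conditions are much easier to test than the product.\<close>

definition preserves_cubic :: "('k::field albert \<Rightarrow> 'k albert) \<Rightarrow> bool" where
  "preserves_cubic f \<longleftrightarrow> (\<forall>x y. f (x + y) = f x + f y) \<and> (\<forall>c x. f (albert_scale c x) = albert_scale c (f x))
    \<and> (\<forall>x. albert_trace (f x) = albert_trace x) \<and> (\<forall>x. albert_sharp (f x) = f (albert_sharp x))
    \<and> f albert_one = albert_one"

lemma albert_AutI: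
  assumes "preserves_cubic f" "f \<circ> g = id" "g \<circ> f = id"
  shows "f \<in> carrier albert_Aut"
proof -
  have add: "f (x + y) = f x + f y" and scale: "f (albert_scale c x) = albert_scale c (f x)"
    and tr: "albert_trace (f x) = albert_trace x" and sh: "albert_sharp (f x) = f (albert_sharp x)"
    and one: "f albert_one = albert_one" for x y c
    using assms(1) unfolding preserves_cubic_def by blast+
  have diff: "f (x - y) = f x - f y" for x y
    by (metis add add_diff_cancel diff_add_cancel)
  have cross: "albert_cross (f x) (f y) = f (albert_cross x y)" for x y
    by (simp only: albert_cross_def flip: add) (simp only: sh diff)
  have "f (albert_mult a b) = albert_mult (f a) (f b)" for a b
    by (simp only: albert_mult_def albert_Sr_def cross tr scale add diff one)
  moreover have "bij f" using assms(2,3) by (rule o_bij[rotated])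
  ultimately show ?thesis by (simp add: mem_albert_Aut add scale)
qed

definition conj_aut :: "'k::field^3^3 \<Rightarrow> 'k^3^3 \<Rightarrow> 'k albert \<Rightarrow> 'k albert" where
  "conj_aut p q = (\<lambda>(a0, a1, a2). (p ** a0 ** matrix_inv p, p ** a1 ** matrix_inv q, q ** a2 ** matrix_inv p))"

lemma matrix_inv_eqI:
  fixes A :: "'k::field^'n^'n"
  assumes "A ** B = mat 1" shows "matrix_inv A = B"
proof -
  have "B ** A = mat 1" using assms by (simp add: matrix_left_right_inverse)
  then have inv: "A ** matrix_inv A = mat 1 \<and> matrix_inv A ** A = mat 1"
    unfolding matrix_inv_def using assms
    by (intro someI[where P = "\<lambda>B. A ** B = mat 1 \<and> B ** A = mat 1" and x = B] conjI)
  have "matrix_inv A = matrix_inv A ** (A ** B)" by (simp only: assms matrix_mul_rid)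
  also have "\<dots> = B" using inv by (simp only: matrix_mul_assoc matrix_mul_lid)
  finally show ?thesis .
qed

lemma matrix_inv_right_left:
  fixes A :: "'k::field^'n^'n"
  assumes "det A \<noteq> 0"
  shows "A ** matrix_inv A = mat 1" "matrix_inv A ** A = mat 1"
proof -
  obtain B where B: "A ** B = mat 1" "B ** A = mat 1"
    using assms unfolding invertible_det_nz[symmetric] invertible_def by blast
  then have "matrix_inv A = B" by (intro matrix_inv_eqI)
  then show "A ** matrix_inv A = mat 1" "matrix_inv A ** A = mat 1" using B by simp_all
qed

lemma matrix_mult_cancel:
  fixes A :: "'k::field^'n^'n"
  assumes "det A \<noteq> 0"
  shows "B ** A ** matrix_inv A = B" "B ** matrix_inv A ** A = B"
  by (simp_all add: matrix_inv_right_left[OF assms] flip: matrix_mul_assoc)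

lemma adjugate_eq_inv:
  fixes A :: "'k::field^3^3"
  assumes "det A \<noteq> 0" shows "adjugate A = mscale (det A) (matrix_inv A)"
proof -
  have "adjugate A = adjugate A ** A ** matrix_inv A" using assms by (simp add: matrix_mult_cancel)
  then show ?thesis by (simp add: adjugate_mult_self mscale_mult_left)
qed

lemma det_matrix_inv:
  fixes A :: "'k::field^'n^'n"
  assumes "det A \<noteq> 0" shows "det (matrix_inv A) = inverse (det A)"
  using arg_cong[OF matrix_inv_right_left(1)[OF assms], of det] assms
  by (simp add: det_mul field_simps)

lemma matrix_inv_matrix_inv:
  fixes A :: "'k::field^'n^'n"
  assumes "det A \<noteq> 0" shows "matrix_inv (matrix_inv A) = A"
  by (rule matrix_inv_eqI) (simp add: matrix_inv_right_left assms)

lemma mscale_mscale: "mscale a (mscale b m) = mscale (a * b) m"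
  by (simp add: mscale_def vec_eq_iff mult.assoc)

lemma mscale_1 [simp]: "mscale 1 m = m"
  by (simp add: mscale_def vec_eq_iff)

lemma trace_mult_commute: "trace (A ** B) = trace (B ** (A :: 'k::field^'n^'n))"
  by (simp add: trace_def matrix_matrix_mult_def) (subst sum.swap, simp add: mult.commute)

lemma matrix_mult_distribs:
  fixes A :: "'k::field^'n^'n"
  shows "A ** (B + C) = A ** B + A ** C" "(B + C) ** A = B ** A + C ** A"
   "A ** (B - C) = A ** B - A ** C" "(B - C) ** A = B ** A - C ** A"
  by (simp_all add: matrix_matrix_mult_def vec_eq_iff algebra_simps sum.distrib sum_subtractf)

lemma conj_aut_Aut:
  assumes "det p = det q" "det p \<noteq> 0"
  shows "conj_aut p q \<in> carrier albert_Aut"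
proof (rule albert_AutI[where g = "conj_aut (matrix_inv p) (matrix_inv q)"])
  have q: "det q \<noteq> 0" using assms by simp
  note c = matrix_mult_cancel[OF assms(2)] matrix_mult_cancel[OF q] matrix_inv_right_left[OF assms(2)]
     matrix_inv_right_left[OF q]
  have adj: "adjugate (p ** a ** matrix_inv p) = p ** adjugate a ** matrix_inv p"
     "adjugate (p ** a ** matrix_inv q) = q ** adjugate a ** matrix_inv p"
     "adjugate (q ** a ** matrix_inv p) = p ** adjugate a ** matrix_inv q" for a
    using assms q
    by (simp_all add: adjugate_mult adjugate_eq_inv det_matrix_inv matrix_inv_matrix_inv mscale_mult_left
        mscale_mult_right mscale_mscale matrix_mul_assoc)
  have tr: "trace (p ** a ** matrix_inv p) = trace a" for a
    by (simp add: trace_mult_commute[of _ "matrix_inv p"] matrix_mul_assoc c)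
  show "preserves_cubic (conj_aut p q)"
    unfolding preserves_cubic_def conj_aut_def
    by (auto simp: matrix_mult_distribs albert_scale_def mscale_mult_left mscale_mult_right
      albert_trace_def tr albert_sharp_def adj albert_one_def c matrix_mul_assoc)
  show "conj_aut p q \<circ> conj_aut (matrix_inv p) (matrix_inv q) = id"
    "conj_aut (matrix_inv p) (matrix_inv q) \<circ> conj_aut p q = id"
    using assms q by (auto simp: conj_aut_def fun_eq_iff matrix_inv_matrix_inv c matrix_mul_assoc)
qed

lemma g_elt_Aut: "g_elt \<in> carrier (albert_Aut :: ('k::field albert \<Rightarrow> 'k albert) monoid)"
proof (rule albert_AutI[where g = g_elt])
  show "preserves_cubic (g_elt :: 'k::field albert \<Rightarrow> 'k albert)"
    unfolding preserves_cubic_def g_elt_def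
  proof (intro conjI allI)
    fix x y :: "'k albert" and c :: 'k
    show "(case x + y of (a0, a1, a2) \<Rightarrow> (transpose a0, transpose a2, transpose a1)) =
       (case x of (a0, a1, a2) \<Rightarrow> (transpose a0, transpose a2, transpose a1)) +
       (case y of (a0, a1, a2) \<Rightarrow> (transpose a0, transpose a2, transpose a1))"
      by (cases x rule: albert_cases; cases y rule: albert_cases) simp
  qed (auto simp: albert_scale_def albert_trace_def albert_sharp_def albert_one_def transpose_def adjugate_transpose[unfolded transpose_def]
    mscale_def trace_def matrix_matrix_mult_def vec_eq_iff mult.commute mat_def)
  show "g_elt \<circ> g_elt = (id :: 'k::field albert \<Rightarrow> 'k albert)" "g_elt \<circ> g_elt = (id :: 'k::field albert \<Rightarrow> 'k albert)"
    by (auto simp: g_elt_def)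
qed

text \<open>With \<open>X = u\<close> and \<open>Y = v\<close> this is \<open>g t\<close>. Letting \<open>X\<close> and \<open>Y\<close> be arbitrary symmetric
  matrices shows that it depends on the two quadratic forms with these Gram matrices.\<close>

definition sym_inv :: "'k::field^3^3 \<Rightarrow> 'k^3^3 \<Rightarrow> 'k albert \<Rightarrow> 'k albert" where
  "sym_inv X Y = (\<lambda>(a0, a1, a2).
     (matrix_inv X ** transpose a0 ** X, matrix_inv X ** transpose a2 ** Y, matrix_inv Y ** transpose a1 ** X))"

text \<open>The subgroup \<open>SL\<^sub>2\<close> of the long root \<open>2 \<epsilon>\<^sub>1 + \<delta>\<^sub>1\<close>, where \<open>\<epsilon>\<^sub>i\<close> and \<open>\<delta>\<^sub>i\<close> are the characters that read
  off the diagonal entries of \<open>u\<close> and \<open>v\<close>. It acts by \<open>[[p, q], [r, s]]\<close>, up to signs, on the six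
  pairs of weight vectors of \<open>A\<close> whose weights differ by that root, and fixes the remaining
  coordinates. The maps \<open>conj_aut p q\<close> and \<open>g\<close> preserve the summand of the \<open>a\<^sub>0\<close>, while these maps do not; they are the
  source of a relation that mixes \<open>u\<close> and \<open>v\<close>.\<close>

definition long_root_aut :: "'k::field \<Rightarrow> 'k \<Rightarrow> 'k \<Rightarrow> 'k \<Rightarrow> 'k albert \<Rightarrow> 'k albert" where
  "long_root_aut p q r s = (\<lambda>(a, b, c).
    (mat33 (a$1$1) (p * a$1$2 + q * b$3$1) (p * a$1$3 - q * b$2$1)
           (s * a$2$1 - r * c$1$3) (a$2$2) (a$2$3)
           (s * a$3$1 + r * c$1$2) (a$3$2) (a$3$3),
     mat33 (b$1$1) (p * b$1$2 + q * c$3$1) (p * b$1$3 - q * c$2$1)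
           (s * b$2$1 - r * a$1$3) (b$2$2) (b$2$3)
           (s * b$3$1 + r * a$1$2) (b$3$2) (b$3$3),
     mat33 (c$1$1) (p * c$1$2 + q * a$3$1) (p * c$1$3 - q * a$2$1)
           (s * c$2$1 - r * b$1$3) (c$2$2) (c$2$3)
           (s * c$3$1 + r * b$1$2) (c$3$2) (c$3$3)))"

lemma long_root_aut_comp:
  assumes "p * s - q * r = 1"
  shows "long_root_aut p q r s \<circ> long_root_aut s (-q) (-r) p = id"
proof
  fix x
  have e: "p * s = q * r + 1" "s * p = r * q + 1" using assms by (simp_all add: algebra_simps)
  show "(long_root_aut p q r s \<circ> long_root_aut s (-q) (-r) p) x = id x"
    by (cases x rule: albert_cases)
     (simp add: long_root_aut_def algebra_simps e; simp add: mult.assoc[symmetric] e algebra_simps)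
qed


lemma long_root_aut_Aut:
  assumes "p * s - q * r = 1"
  shows "long_root_aut p q r s \<in> carrier albert_Aut"
proof (rule albert_AutI[where g = "long_root_aut s (-q) (-r) p"])
  have e: "p * s = q * r + 1" using assms by (simp_all add: algebra_simps)
  have e': "p * (s * x) = q * (r * x) + x" for x using arg_cong[OF e, of "\<lambda>t. t * x"] by (simp add: algebra_simps)
  show "preserves_cubic (long_root_aut p q r s)"
    unfolding preserves_cubic_def
  proof (intro conjI allI)
    fix x
    show "albert_sharp (long_root_aut p q r s x) = long_root_aut p q r s (albert_sharp x)"
      by (cases x rule: albert_cases)
       (simp add: long_root_aut_def albert_sharp_def algebra_simps e e')
  next
    fix x y
    show "long_root_aut p q r s (x + y) = long_root_aut p q r s x + long_root_aut p q r s y"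
      by (cases x rule: albert_cases; cases y rule: albert_cases)
       (simp add: long_root_aut_def algebra_simps)
  next
    fix x c
    show "long_root_aut p q r s (albert_scale c x) = albert_scale c (long_root_aut p q r s x)"
      by (cases x rule: albert_cases)
       (simp add: long_root_aut_def albert_scale_def algebra_simps)
  next
    fix x
    show "albert_trace (long_root_aut p q r s x) = albert_trace x"
      by (cases x rule: albert_cases)
       (simp add: long_root_aut_def albert_trace_def)
  next
    show "long_root_aut p q r s albert_one = albert_one"
      by (simp add: long_root_aut_def albert_one_def one_mat33 zero_mat33)
  qed
  show "long_root_aut p q r s \<circ> long_root_aut s (-q) (-r) p = id"
    using assms by (rule long_root_aut_comp)
  show "long_root_aut s (-q) (-r) p \<circ> long_root_aut p q r s = id"
    using long_root_aut_comp[of s p "-q" "-r"] assms by (simp add: mult.commute)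
qed

section \<open>Conjugacy of the elements g t\<close>

definition albert_conj :: "('k::field albert \<Rightarrow> 'k albert) \<Rightarrow> ('k albert \<Rightarrow> 'k albert) \<Rightarrow> bool" where
  "albert_conj s s' \<longleftrightarrow> (\<exists>h\<in>carrier albert_Aut. s \<circ> h = h \<circ> s')"

lemma id_Aut: "id \<in> carrier albert_Aut"
  by (simp add: mem_albert_Aut)

lemma comp_Aut: "f \<in> carrier albert_Aut \<Longrightarrow> g \<in> carrier albert_Aut \<Longrightarrow> f \<circ> g \<in> carrier albert_Aut"
  by (simp add: mem_albert_Aut bij_comp)

lemma inv_Aut: 
  assumes "f \<in> carrier albert_Aut" shows "inv_into UNIV f \<in> carrier albert_Aut"
proof -
  have "bij f" using assms by (simp add: mem_albert_Aut)
  then have f: "f (inv_into UNIV f x) = x" and i: "inv_into UNIV f (f x) = x" for x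
    by (simp_all add: bij_is_surj surj_f_inv_f bij_is_inj)
  show ?thesis
    unfolding mem_albert_Aut
  proof (intro conjI allI)
    show "bij (inv_into UNIV f)" using \<open>bij f\<close> by (rule bij_imp_bij_inv)
    show "inv_into UNIV f (x + y) = inv_into UNIV f x + inv_into UNIV f y" for x y
      using assms unfolding mem_albert_Aut by (metis f i)
    show "inv_into UNIV f (albert_scale x y) = albert_scale x (inv_into UNIV f y)" for x y
      using assms unfolding mem_albert_Aut by (metis f i)
    show "inv_into UNIV f (albert_mult x y) = albert_mult (inv_into UNIV f x) (inv_into UNIV f y)" for x y
      using assms unfolding mem_albert_Aut by (metis f i)
  qed
qed

lemma Aut_inv_comp: 
  assumes "f \<in> carrier albert_Aut" shows "inv_into UNIV f \<circ> f = id" "f \<circ> inv_into UNIV f = id"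
  using assms by (auto simp: mem_albert_Aut bij_def surj_iff)

lemma albert_conj_refl: "albert_conj s s"
  unfolding albert_conj_def using id_Aut by (intro bexI[of _ id]) auto

lemma albert_conj_trans [trans]:
  assumes "albert_conj s t" "albert_conj t u" shows "albert_conj s u"
proof -
  obtain h k where "h \<in> carrier albert_Aut" "k \<in> carrier albert_Aut" and hk: "s \<circ> h = h \<circ> t" "t \<circ> k = k \<circ> u"
    using assms unfolding albert_conj_def by blast
  then show ?thesis
    unfolding albert_conj_def by (intro bexI[of _ "h \<circ> k"] comp_Aut) (simp_all add: fun_eq_iff)
qed

lemma albert_conj_sym:
  assumes "albert_conj s t" shows "albert_conj t s"
proof -
  obtain h where h: "h \<in> carrier albert_Aut" and hk: "s \<circ> h = h \<circ> t"
    using assms unfolding albert_conj_def by blast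
  have "t \<circ> inv_into UNIV h = inv_into UNIV h \<circ> s"
    using hk Aut_inv_comp[OF h] by (simp add: fun_eq_iff) metis
  then show ?thesis unfolding albert_conj_def using inv_Aut[OF h] by blast
qed

text \<open>Conjugation by \<open>conj_aut p q\<close> changes the basis of the two quadratic forms.\<close>

lemma conj_sym_inv:
  assumes "det p = det q" "det p \<noteq> 0" "det X \<noteq> 0" "det Y \<noteq> 0"
  shows "albert_conj (sym_inv X Y) (sym_inv (transpose p ** X ** p) (transpose q ** Y ** q))"
proof -
  have q: "det q \<noteq> 0" using assms by simp
  let ?X = "transpose p ** X ** p" and ?Y = "transpose q ** Y ** q"
  have t: "det (transpose p) \<noteq> 0" "det (transpose q) \<noteq> 0" using assms q by (simp_all add: det_transpose)
  note c = matrix_mult_cancel[OF assms(2)] matrix_mult_cancel[OF q] matrix_mult_cancel[OF assms(3)]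
      matrix_mult_cancel[OF assms(4)] matrix_inv_right_left[OF assms(2)] matrix_inv_right_left[OF q]
      matrix_mult_cancel[OF t(1)] matrix_mult_cancel[OF t(2)] matrix_inv_right_left[OF t(1)] matrix_inv_right_left[OF t(2)]
  have iX: "matrix_inv ?X = matrix_inv p ** matrix_inv X ** matrix_inv (transpose p)"
    by (rule matrix_inv_eqI) (simp add: matrix_mul_assoc c)
  have iY: "matrix_inv ?Y = matrix_inv q ** matrix_inv Y ** matrix_inv (transpose q)"
    by (rule matrix_inv_eqI) (simp add: matrix_mul_assoc c)
  have ti: "transpose (matrix_inv p) = matrix_inv (transpose p)" "transpose (matrix_inv q) = matrix_inv (transpose q)"
    by (rule matrix_inv_eqI[symmetric]; simp add: matrix_transpose_mul[symmetric] c)+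
  have "sym_inv X Y \<circ> conj_aut p q = conj_aut p q \<circ> sym_inv ?X ?Y"
    by (auto simp: fun_eq_iff sym_inv_def conj_aut_def iX iY matrix_transpose_mul ti matrix_mul_assoc c)
  then show ?thesis
    unfolding albert_conj_def using conj_aut_Aut[OF assms(1,2)] by blast
qed


lemma matrix_inv_diag3:
  assumes "x \<noteq> 0" "y \<noteq> 0" "z \<noteq> 0"
  shows "matrix_inv (diag3 x y z) = diag3 (inverse x) (inverse y) (inverse z)"
  by (rule matrix_inv_eqI) (simp add: diag3_mat33 one_mat33 assms)

lemma det_diag3: "det (diag3 x y z) = x * y * z"
  by (simp add: diag3_mat33)

definition diag_inv :: "'k::field \<Rightarrow> 'k \<Rightarrow> 'k \<Rightarrow> 'k \<Rightarrow> 'k \<Rightarrow> 'k \<Rightarrow> 'k albert \<Rightarrow> 'k albert" where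
  "diag_inv x1 x2 x3 y1 y2 y3 = sym_inv (diag3 x1 x2 x3) (diag3 y1 y2 y3)"

lemma diag_inv_mat33:
  assumes "x1 \<noteq> 0" "x2 \<noteq> 0" "x3 \<noteq> 0" "y1 \<noteq> 0" "y2 \<noteq> 0" "y3 \<noteq> 0"
  shows "diag_inv x1 x2 x3 y1 y2 y3 (mat33 a b c d e f g h i, mat33 a' b' c' d' e' f' g' h' i', mat33 a'' b'' c'' d'' e'' f'' g'' h'' i'') =
   (mat33 a (x2/x1*d) (x3/x1*g) (x1/x2*b) e (x3/x2*h) (x1/x3*c) (x2/x3*f) i,
    mat33 (y1/x1*a'') (y2/x1*d'') (y3/x1*g'') (y1/x2*b'') (y2/x2*e'') (y3/x2*h'') (y1/x3*c'') (y2/x3*f'') (y3/x3*i''),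
    mat33 (x1/y1*a') (x2/y1*d') (x3/y1*g') (x1/y2*b') (x2/y2*e') (x3/y2*h') (x1/y3*c') (x2/y3*f') (x3/y3*i'))"
  using assms
  by (simp add: diag_inv_def sym_inv_def matrix_inv_diag3) (simp add: diag3_mat33 field_simps)

text \<open>Multiplying both forms by the same scalar does not change the involution; this repairs
  determinants after a move that multiplies both of them.\<close>

lemma diag_inv_scale:
  assumes "x1 \<noteq> 0" "x2 \<noteq> 0" "x3 \<noteq> 0" "y1 \<noteq> 0" "y2 \<noteq> 0" "y3 \<noteq> 0" "n \<noteq> 0"
  shows "diag_inv (n * x1) (n * x2) (n * x3) (n * y1) (n * y2) (n * y3) = diag_inv x1 x2 x3 y1 y2 y3"
proof
  fix x
  show "diag_inv (n * x1) (n * x2) (n * x3) (n * y1) (n * y2) (n * y3) x = diag_inv x1 x2 x3 y1 y2 y3 x"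
    using assms by (cases x rule: albert_cases) (simp add: diag_inv_mat33)
qed

text \<open>For \<open>m = x\<^sub>1 y\<^sub>1 / (x\<^sub>2 x\<^sub>3)\<close> the matrix \<open>[[p, q], [- m q, p]]\<close> is multiplication with \<open>p + q \<surd>(-m)\<close>, a
  similitude of the form \<open>\<langle>1, m\<rangle>\<close> with factor \<open>p\<^sup>2 + m q\<^sup>2 = 1 / n\<close>. Multiplying its second row by \<open>n\<close> gives an
  element of \<open>SL\<^sub>2\<close>.\<close>

lemma diag_inv_long_root:
  assumes nz: "x1 \<noteq> 0" "x2 \<noteq> 0" "x3 \<noteq> 0" "y1 \<noteq> 0" "y2 \<noteq> 0" "y3 \<noteq> 0"
   and d: "x1 * (x2 * x3) = y1 * (y2 * y3)"
   and n: "n * (p\<^sup>2 + x1 * y1 / (x2 * x3) * q\<^sup>2) = 1"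
  shows "albert_conj (diag_inv x1 x2 x3 y1 y2 y3) (diag_inv (n * x1) x2 x3 (n * y1) y2 y3)"
proof -
  have [simp]: "n \<noteq> 0" using n by auto
  have x1: "x1 = y1 * (y2 * y3) / (x2 * x3)" using nz d by (simp add: field_simps)
  \<comment> \<open>forced by the commutation with the two involutions; the determinant is then \<open>1\<close>\<close>
  define r where "r = - n * (x1 * y1 / (x2 * x3)) * q"
  have "p * (n * p) - q * r = 1"
    using n by (simp add: r_def algebra_simps power2_eq_square)
  then have "long_root_aut p q r (n * p) \<in> carrier albert_Aut"
    by (rule long_root_aut_Aut)
  moreover have "diag_inv (n * x1) x2 x3 (n * y1) y2 y3 \<circ> long_root_aut p q r (n * p) = long_root_aut p q r (n * p) \<circ> diag_inv x1 x2 x3 y1 y2 y3"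
  proof
    fix x
    show "(diag_inv (n * x1) x2 x3 (n * y1) y2 y3 \<circ> long_root_aut p q r (n * p)) x = (long_root_aut p q r (n * p) \<circ> diag_inv x1 x2 x3 y1 y2 y3) x"
    using nz by (cases x rule: albert_cases) (simp add: diag_inv_mat33 long_root_aut_def r_def; simp add: x1 field_simps)
  qed
  ultimately have "albert_conj (diag_inv (n * x1) x2 x3 (n * y1) y2 y3) (diag_inv x1 x2 x3 y1 y2 y3)"
    unfolding albert_conj_def by blast
  then show ?thesis by (rule albert_conj_sym)
qed


lemma diag_inv_conj:
  assumes nz: "x1 \<noteq> 0" "x2 \<noteq> 0" "x3 \<noteq> 0" "y1 \<noteq> 0" "y2 \<noteq> 0" "y3 \<noteq> 0"
   and "det p = det q" "det p \<noteq> 0"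
   and "transpose p ** diag3 x1 x2 x3 ** p = diag3 x1' x2' x3'" "transpose q ** diag3 y1 y2 y3 ** q = diag3 y1' y2' y3'"
  shows "albert_conj (diag_inv x1 x2 x3 y1 y2 y3) (diag_inv x1' x2' x3' y1' y2' y3')"
  using conj_sym_inv[of p q "diag3 x1 x2 x3" "diag3 y1 y2 y3"] assms
  by (simp add: diag_inv_def det_diag3)

text \<open>A diagonal ternary form \<open>\<langle>a, b, (a b)\<^sup>-\<^sup>1\<rangle>\<close> of determinant \<open>1\<close> is, up to squares, the norm form
  on the pure quaternions of the algebra with symbol \<open>(-a, -b)\<close>. So \<open>quat_inv a b c d\<close> is the
  involution given by two quaternion symbols, and every \<open>g t\<close> has this form.\<close>

definition quat_inv :: "'k::field \<Rightarrow> 'k \<Rightarrow> 'k \<Rightarrow> 'k \<Rightarrow> 'k albert \<Rightarrow> 'k albert" where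
  "quat_inv a b c d = diag_inv a b (inverse (a * b)) c d (inverse (c * d))"

lemma g_torus_eq_quat_inv:
  assumes "u1 \<noteq> 0" "u2 \<noteq> 0" "v1 \<noteq> 0" "v2 \<noteq> 0"
  shows "g_elt \<circ> torus_elt u1 u2 v1 v2 = quat_inv u1 (u2 / u1) v1 (v2 / v1)"
proof
  fix x
  show "(g_elt \<circ> torus_elt u1 u2 v1 v2) x = quat_inv u1 (u2 / u1) v1 (v2 / v1) x"
    using assms
    by (cases x rule: albert_cases)
     (simp add: g_elt_def torus_elt_def Let_def quat_inv_def diag_inv_mat33 matrix_inv_diag3; simp add: diag3_mat33 field_simps)
qed

lemma quat_inv_eq_g_torus:
  assumes "a \<noteq> 0" "b \<noteq> 0" "c \<noteq> 0" "d \<noteq> 0"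
  shows "quat_inv a b c d = g_elt \<circ> torus_elt a (a * b) c (c * d)"
  using g_torus_eq_quat_inv[of a "a * b" c "c * d"] assms by simp

text \<open>The isometry of binary forms \<open>\<langle>y, z\<rangle> \<cong> \<langle>n y, n z\<rangle>\<close> for a value \<open>n\<close> of \<open>\<langle>1, y z\<rangle>\<close>, here with
  \<open>z = (x y)\<^sup>-\<^sup>1\<close>, so that \<open>y z\<close> and \<open>x\<close> differ by a square. One column is divided by \<open>n\<close> to get
  determinant \<open>1\<close>.\<close>

lemma ternary_isometry:
  fixes x y s t :: "'k::field"
  assumes n: "s\<^sup>2 + x * t\<^sup>2 \<noteq> 0" and "x \<noteq> 0" "y \<noteq> 0"
  shows "\<exists>p. det p = 1 \<and> transpose p ** diag3 x y (inverse (x * y)) ** p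
    = diag3 x (y * (s\<^sup>2 + x * t\<^sup>2)) (inverse (x * (y * (s\<^sup>2 + x * t\<^sup>2))))"
proof -
  define n where "n = s\<^sup>2 + x * t\<^sup>2"
  have [simp]: "n \<noteq> 0" using assms by (simp add: n_def)
  let ?p = "mat33 1 0 0 0 s (- t / (y * n)) 0 (x * y * t) (s / n)"
  have "det ?p = 1" using assms(2,3) by (simp add: field_simps) (simp add: n_def power2_eq_square algebra_simps)
  moreover have "transpose ?p ** diag3 x y (inverse (x * y)) ** ?p = diag3 x (y * n) (inverse (x * (y * n)))"
    using assms(2,3) by (simp add: diag3_mat33 field_simps) (simp add: n_def power2_eq_square algebra_simps)
  ultimately show ?thesis unfolding n_def by blast
qed

context
  fixes a b c d :: "'k::field"
  assumes nz: "a \<noteq> 0" "b \<noteq> 0" "c \<noteq> 0" "d \<noteq> 0"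
begin

lemma quat_inv_squares:
  assumes "p \<noteq> 0" "q \<noteq> 0" "r \<noteq> 0" "s \<noteq> 0"
  shows "albert_conj (quat_inv a b c d) (quat_inv (a * p\<^sup>2) (b * q\<^sup>2) (c * r\<^sup>2) (d * s\<^sup>2))"
  unfolding quat_inv_def using assms nz
  by (intro diag_inv_conj[where p = "diag3 p q (inverse (p * q))" and q = "diag3 r s (inverse (r * s))"])
    (simp_all add: det_diag3, simp_all add: diag3_mat33 power2_eq_square field_simps)

lemma quat_inv_swap_left: "albert_conj (quat_inv a b c d) (quat_inv b a c d)"
  unfolding quat_inv_def using nz
  by (intro diag_inv_conj[where p = "mat33 0 1 0 (-1) 0 0 0 0 1" and q = "mat 1"])
    (simp_all, simp_all add: one_mat33 diag3_mat33 mult.commute)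

lemma quat_inv_rot_left: "albert_conj (quat_inv a b c d) (quat_inv a (inverse (a * b)) c d)"
  unfolding quat_inv_def using nz
  by (intro diag_inv_conj[where p = "mat33 1 0 0 0 0 1 0 (-1) 0" and q = "mat 1"])
    (simp_all, simp_all add: one_mat33 diag3_mat33 mult.commute)

lemma quat_inv_swap_right: "albert_conj (quat_inv a b c d) (quat_inv a b d c)"
  unfolding quat_inv_def using nz
  by (intro diag_inv_conj[where q = "mat33 0 1 0 (-1) 0 0 0 0 1" and p = "mat 1"])
    (simp_all, simp_all add: one_mat33 diag3_mat33 mult.commute)

lemma quat_inv_norm_right:
  assumes "s\<^sup>2 + c * t\<^sup>2 \<noteq> 0"
  shows "albert_conj (quat_inv a b c d) (quat_inv a b c (d * (s\<^sup>2 + c * t\<^sup>2)))"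
proof -
  obtain q where "det q = 1" "transpose q ** diag3 c d (inverse (c * d)) ** q
     = diag3 c (d * (s\<^sup>2 + c * t\<^sup>2)) (inverse (c * (d * (s\<^sup>2 + c * t\<^sup>2))))"
    using ternary_isometry[OF assms nz(3,4)] by blast
  then show ?thesis
    unfolding quat_inv_def using nz
    by (intro diag_inv_conj[where q = q and p = "mat 1"]) simp_all
qed

end

text \<open>The long root move multiplies the first entries of both forms by \<open>1 / n\<close>. Scaling both forms by
  this factor and then removing squares transfers it to the other two entries of each form.\<close>

lemma quat_inv_norm_both:
  fixes a b c d :: "'k::field"
  assumes nz: "a \<noteq> 0" "b \<noteq> 0" "c \<noteq> 0" "d \<noteq> 0" and n: "s\<^sup>2 + c * t\<^sup>2 \<noteq> 0"
  shows "albert_conj (quat_inv a b c d) (quat_inv a (b * (s\<^sup>2 + c * t\<^sup>2)) c (d * (s\<^sup>2 + c * t\<^sup>2)))"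
proof -
  define n where "n = inverse (s\<^sup>2 + c * t\<^sup>2)"
  have n0: "n \<noteq> 0" using n by (simp add: n_def)
  let ?x3 = "inverse (a * b)" and ?y3 = "inverse (c * d)"
  have "albert_conj (quat_inv a b c d) (diag_inv (n * a) b ?x3 (n * c) d ?y3)"
    unfolding quat_inv_def using nz n
    by (intro diag_inv_long_root[where p = s and q = "t / a"])
      (simp_all add: n_def field_simps power2_eq_square)
  also have "diag_inv (n * a) b ?x3 (n * c) d ?y3 = diag_inv (n * (n * a)) (n * b) (n * ?x3) (n * (n * c)) (n * d) (n * ?y3)"
    using nz n0 by (intro diag_inv_scale[symmetric]) simp_all
  also have "albert_conj \<dots> (quat_inv a (b * n) c (d * n))"
    unfolding quat_inv_def using nz n0
    by (intro diag_inv_conj[where p = "diag3 (inverse n) 1 (inverse n)" and q = "diag3 (inverse n) 1 (inverse n)"])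
      (simp_all, simp_all add: diag3_mat33 field_simps)
  also have "albert_conj \<dots> (quat_inv (a * 1\<^sup>2) (b * n * (inverse n)\<^sup>2) (c * 1\<^sup>2) (d * n * (inverse n)\<^sup>2))"
    using nz n0 by (intro quat_inv_squares) simp_all
  also have "\<dots> = quat_inv a (b * (s\<^sup>2 + c * t\<^sup>2)) c (d * (s\<^sup>2 + c * t\<^sup>2))"
  proof -
    have "n * (inverse n)\<^sup>2 = s\<^sup>2 + c * t\<^sup>2"
      using n0 by (simp add: power2_eq_square mult.assoc[symmetric]) (simp add: n_def power2_eq_square)
    then show ?thesis by (simp add: mult.assoc)
  qed
  finally show ?thesis .
qed

text \<open>The move on the second symbol alone is an isometry of \<open>v\<close>; undoing it leaves a move on the
  first symbol that is controlled by the second one. In terms of \<open>H\<^sub>3(D, \<gamma>)\<close> this says that the entries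
  of \<open>\<gamma>\<close> may be multiplied by norms from \<open>D\<close>.\<close>

lemma quat_inv_norm_cross:
  fixes a b c d :: "'k::field"
  assumes nz: "a \<noteq> 0" "b \<noteq> 0" "c \<noteq> 0" "d \<noteq> 0" and n: "s\<^sup>2 + c * t\<^sup>2 \<noteq> 0"
  shows "albert_conj (quat_inv a b c d) (quat_inv a (b * (s\<^sup>2 + c * t\<^sup>2)) c d)"
proof -
  let ?n = "s\<^sup>2 + c * t\<^sup>2"
  have "albert_conj (quat_inv a (b * ?n) c d) (quat_inv a (b * ?n) c (d * ?n))"
    using nz n by (intro quat_inv_norm_right) simp_all
  then show ?thesis
    using quat_inv_norm_both[OF nz n] albert_conj_sym albert_conj_trans by blast
qed

section \<open>The centre of the automorphism group\<close>

lemma case_prod_zero: "case_prod f 0 = f 0 0"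
  by (simp add: zero_prod_def)

lemma Aut_zero: "z \<in> carrier albert_Aut \<Longrightarrow> z 0 = 0"
  unfolding mem_albert_Aut by (metis add_cancel_left_left)

lemma albert_scale_1 [simp]: "albert_scale 1 x = x"
  by (cases x rule: albert_cases) (simp add: albert_scale_def)

lemma albert_scale_m1: "albert_scale (-1) x = - (x :: 'k::field albert)"
  by (cases x rule: albert_cases) (simp add: albert_scale_def)

lemma Aut_uminus: "z \<in> carrier albert_Aut \<Longrightarrow> z (- x) = - z x"
  unfolding mem_albert_Aut by (metis albert_scale_m1)

lemma conj_aut_mat33:
  assumes "p ** p' = mat 1" "q ** q' = mat 1"
  shows "conj_aut p q (a0, a1, a2) = (p ** a0 ** p', p ** a1 ** q', q ** a2 ** p')"
  using assms by (simp add: conj_aut_def matrix_inv_eqI)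

text \<open>A central \<open>z\<close> maps the vector \<open>(0, E\<^sub>1\<^sub>1, 0)\<close> to a vector fixed by the stabilizer of the former. The
  transvections in this stabilizer force the image into \<open>(scalars, k E\<^sub>1\<^sub>1, 0)\<close>, and an element that
  changes the sign of \<open>E\<^sub>1\<^sub>1\<close> and fixes the scalars removes the first component.\<close>

lemma central_Aut_on_E11:
  fixes z :: "'k::field albert \<Rightarrow> 'k albert"
  assumes two: "(2::'k) \<noteq> 0" and z: "z \<in> carrier albert_Aut" and comm: "\<And>x. x \<in> carrier albert_Aut \<Longrightarrow> z \<circ> x = x \<circ> z"
  obtains c where "z (0, mat33 1 0 0 0 0 0 0 0 0, 0) = (0, mat33 c 0 0 0 0 0 0 0 0, 0)"
proof -
  let ?e = "(0, mat33 1 0 0 0 0 0 0 0 0, 0) :: 'k albert"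
  have fix_e: "(p ** b0 ** p', p ** b1 ** q', q ** b2 ** p') = (b0, b1, b2)"
    if "z ?e = (b0, b1, b2)" "p ** p' = mat 1" "q ** q' = mat 1" "det p = 1" "det q = 1"
      "p ** mat33 1 0 0 0 0 0 0 0 0 ** q' = mat33 1 0 0 0 0 0 0 0 0" for p p' q q' b0 b1 b2
  proof -
    have "conj_aut p q (z ?e) = z (conj_aut p q ?e)"
      using comm[OF conj_aut_Aut[of p q]] that by (simp add: fun_eq_iff)
    then show ?thesis using that by (simp add: conj_aut_mat33[OF that(2,3)])
  qed
  obtain b0 b1 b2 where b: "z ?e = (b0, b1, b2)" by (metis prod_cases3)
  note f = fix_e[OF b]
  have neg1: "z (- ?e) = - (b0, b1, b2)" by (simp only: Aut_uminus[OF z] b)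
  have neg2: "conj_aut (diag3 (-1) (-1) 1) (mat 1) (z ?e) = z (conj_aut (diag3 (-1) (-1) 1) (mat 1) ?e)"
    using comm[OF conj_aut_Aut[of "diag3 (-1) (-1) 1" "mat 1"]] by (simp add: fun_eq_iff det_diag3)
  have neg: "diag3 (-1) (-1) 1 ** b0 ** diag3 (-1) (-1) 1 = - b0"
  proof -
    let ?d = "diag3 (-1) (-1) 1 :: 'k^3^3"
    have d: "conj_aut ?d (mat 1) (a0, a1, a2) = (?d ** a0 ** ?d, ?d ** a1 ** mat 1, mat 1 ** a2 ** ?d)" for a0 a1 a2
      by (rule conj_aut_mat33) (simp_all add: diag3_mat33 one_mat33)
    have "conj_aut ?d (mat 1) ?e = - ?e" by (simp add: d) (simp add: diag3_mat33 zero_mat33)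
    then show ?thesis using neg1 neg2 by (simp only: b d) simp
  qed
  \<comment> \<open>transvections that fix \<open>E\<^sub>1\<^sub>1\<close> from the left (\<open>f\<close>) or from the right (\<open>g\<close>)\<close>
  note f12 = f[of "mat33 1 1 0 0 1 0 0 0 1" "mat33 1 (-1) 0 0 1 0 0 0 1" "mat 1" "mat 1"]
  note f13 = f[of "mat33 1 0 1 0 1 0 0 0 1" "mat33 1 0 (-1) 0 1 0 0 0 1" "mat 1" "mat 1"]
  note f23 = f[of "mat33 1 0 0 0 1 1 0 0 1" "mat33 1 0 0 0 1 (-1) 0 0 1" "mat 1" "mat 1"]
  note f32 = f[of "mat33 1 0 0 0 1 0 0 1 1" "mat33 1 0 0 0 1 0 0 (-1) 1" "mat 1" "mat 1"]
  note g21 = f[of "mat 1" "mat 1" "mat33 1 0 0 (-1) 1 0 0 0 1" "mat33 1 0 0 1 1 0 0 0 1"]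
  note g31 = f[of "mat 1" "mat 1" "mat33 1 0 0 0 1 0 (-1) 0 1" "mat33 1 0 0 0 1 0 1 0 1"]
  note g23 = f[of "mat 1" "mat 1" "mat33 1 0 0 0 1 (-1) 0 0 1" "mat33 1 0 0 0 1 1 0 0 1"]
  note g32 = f[of "mat 1" "mat 1" "mat33 1 0 0 0 1 0 0 (-1) 1" "mat33 1 0 0 0 1 0 0 1 1"]
  have nn: "x = - x \<longleftrightarrow> x = 0" "- x = x \<longleftrightarrow> x = 0" for x :: 'k
    using two by (metis add_eq_0_iff2 mult_2 mult_eq_0_iff neg_0_equal_iff_equal)+
  obtain c where "b0 = 0" "b1 = mat33 c 0 0 0 0 0 0 0 0" "b2 = 0"
    using f12 f13 f23 f32 g21 g31 g23 g32 neg
    by (cases b0 rule: mat33_cases; cases b1 rule: mat33_cases; cases b2 rule: mat33_cases)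
      (simp add: one_mat33 zero_mat33 diag3_mat33 nn)
  then show ?thesis using b that by blast
qed

text \<open>By the previous lemma and permutation matrices, \<open>z\<close> multiplies \<open>a\<^sub>1\<close> by a scalar \<open>c\<close>, and because it
  commutes with \<open>g\<close> it multiplies \<open>a\<^sub>2\<close> by the same \<open>c\<close>. The square of \<open>(0, a, 0)\<close> is \<open>(0, 0, a\<^sup>#)\<close>, so
  \<open>c\<^sup>2 = c\<close>. The products of the vectors \<open>(0, a, 0)\<close> and \<open>(0, 0, b)\<close> yield all \<open>(m, 0, 0)\<close>.\<close>

lemma Aut_centre_trivial:
  fixes z :: "'k::field albert \<Rightarrow> 'k albert"
  assumes two: "(2::'k) \<noteq> 0" and z: "z \<in> carrier albert_Aut" and comm: "\<And>x. x \<in> carrier albert_Aut \<Longrightarrow> z \<circ> x = x \<circ> z"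
  shows "z = id"
proof -
  obtain c where c: "z (0, mat33 1 0 0 0 0 0 0 0 0, 0) = (0, mat33 c 0 0 0 0 0 0 0 0, 0)"
    using central_Aut_on_E11[OF assms] .
  have add: "z (x + y) = z x + z y" and scale: "z (albert_scale t x) = albert_scale t (z x)"
    and mult: "z (albert_mult x y) = albert_mult (z x) (z y)" for x y t
    using z by (auto simp: mem_albert_Aut)
  define cyc :: "'k^3^3" where "cyc = mat33 0 1 0 0 0 1 1 0 0"
  have move: "z (0, p ** mat33 1 0 0 0 0 0 0 0 0 ** q', 0) = albert_scale c (0, p ** mat33 1 0 0 0 0 0 0 0 0 ** q', 0)"
    if "p ** p' = mat 1" "q ** q' = mat 1" "det p = 1" "det q = 1" for p p' q q'
  proof -
    have "z (conj_aut p q (0, mat33 1 0 0 0 0 0 0 0 0, 0)) = conj_aut p q (z (0, mat33 1 0 0 0 0 0 0 0 0, 0))"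
      using comm[OF conj_aut_Aut[of p q]] that by (simp add: fun_eq_iff)
    also have "\<dots> = conj_aut p q (albert_scale c (0, mat33 1 0 0 0 0 0 0 0 0, 0))"
    proof -
      have "albert_scale c (0, mat33 1 0 0 0 0 0 0 0 0, 0) = (0, mat33 c 0 0 0 0 0 0 0 0, 0)"
        by (simp add: albert_scale_def zero_mat33)
      then show ?thesis by (simp only: c)
    qed
    also have "\<dots> = albert_scale c (conj_aut p q (0, mat33 1 0 0 0 0 0 0 0 0, 0))"
      using conj_aut_Aut[of p q] that unfolding mem_albert_Aut by simp
    finally show ?thesis by (simp add: conj_aut_mat33[OF that(1,2)])
  qed
  note rows = move[of "mat 1" "mat 1"] move[of "mat33 0 1 0 0 0 1 1 0 0" "mat33 0 0 1 1 0 0 0 1 0"]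
     move[of "mat33 0 0 1 1 0 0 0 1 0" "mat33 0 1 0 0 0 1 1 0 0"]
  note cells = rows[of "mat 1" "mat 1"] rows[of "mat33 0 1 0 0 0 1 1 0 0" "mat33 0 0 1 1 0 0 0 1 0"]
     rows[of "mat33 0 0 1 1 0 0 0 1 0" "mat33 0 1 0 0 0 1 1 0 0"]
  have one: "z (0, a, 0) = (0, mscale c a, 0)" for a
  proof (cases a rule: mat33_cases)
    case (mat33 a11 a12 a13 a21 a22 a23 a31 a32 a33)
    define E where "E x = ((0, x, 0) :: 'k albert)" for x
    have "z (E a) = z (albert_scale a11 (E (mat33 1 0 0 0 0 0 0 0 0)) + albert_scale a12 (E (mat33 0 1 0 0 0 0 0 0 0))
       + albert_scale a13 (E (mat33 0 0 1 0 0 0 0 0 0)) + albert_scale a21 (E (mat33 0 0 0 1 0 0 0 0 0))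
       + albert_scale a22 (E (mat33 0 0 0 0 1 0 0 0 0)) + albert_scale a23 (E (mat33 0 0 0 0 0 1 0 0 0))
       + albert_scale a31 (E (mat33 0 0 0 0 0 0 1 0 0)) + albert_scale a32 (E (mat33 0 0 0 0 0 0 0 1 0))
       + albert_scale a33 (E (mat33 0 0 0 0 0 0 0 0 1)))"
      by (rule arg_cong[where f = z]) (simp add: E_def mat33 albert_scale_def zero_mat33)
    also have "\<dots> = E (mscale c a)"
      using cells by (simp add: add scale E_def one_mat33) (simp add: mat33 albert_scale_def zero_mat33 mult.commute)
    finally show ?thesis by (simp add: E_def)
  qed
  have two': "z (0, 0, a) = (0, 0, mscale c a)" for a
  proof -
    have "z (g_elt (0, transpose a, 0)) = g_elt (z (0, transpose a, 0))"
      using comm[OF g_elt_Aut] by (simp add: fun_eq_iff)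
    also have "\<dots> = (0, 0, mscale c a)"
      unfolding one by (cases a rule: mat33_cases) (simp add: g_elt_def zero_mat33)
    also have "g_elt (0, transpose a, 0) = (0, 0, a)"
      by (cases a rule: mat33_cases) (simp add: g_elt_def zero_mat33)
    finally show ?thesis .
  qed
  have "c = 1"
  proof -
    have sq: "albert_mult (0, mat33 1 0 0 0 1 0 0 0 1, 0) (0, mat33 1 0 0 0 1 0 0 0 1, 0) = ((0, 0, mat33 1 0 0 0 1 0 0 0 1) :: 'k albert)"
      using two by (simp add: albert_op_defs zero_mat33 one_mat33)
    have "z (albert_mult (0, mat33 1 0 0 0 1 0 0 0 1, 0) (0, mat33 1 0 0 0 1 0 0 0 1, 0)) = (0, 0, mat33 (c*c) 0 0 0 (c*c) 0 0 0 (c*c))"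
      using two by (simp only: mult one) (simp add: albert_op_defs zero_mat33 one_mat33)
    then have "c * c = c" by (simp add: sq two')
    moreover have "c \<noteq> 0"
    proof
      assume "c = 0"
      then have "z (0, 0, mat33 1 0 0 0 1 0 0 0 1) = 0" by (simp only: two') (simp add: zero_mat33 zero_prod_def)
      also have "\<dots> = z 0" using z by (simp add: Aut_zero)
      finally have "(0, 0, mat33 1 0 0 0 1 0 0 0 1) = (0 :: 'k albert)"
        using z by (simp add: mem_albert_Aut bij_def inj_eq)
      then show False by (simp add: zero_mat33 zero_prod_def)
    qed
    ultimately show ?thesis by simp
  qed
  have zero: "z (a, 0, 0) = (a, 0, 0)" for a
  proof -
    \<comment> \<open>solves \<open>(tr m - m) / 2 = a\<close>\<close>
    let ?m = "mscale (trace a) (mat 1) - mscale 2 a"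
    have p: "albert_mult (0, mat 1, 0) (0, 0, ?m) = (a, 0, 0)"
      using two by (cases a rule: mat33_cases) (simp add: albert_op_defs zero_mat33 one_mat33 case_prod_zero field_simps)
    have "z (albert_mult (0, mat 1, 0) (0, 0, ?m)) = albert_mult (0, mat 1, 0) (0, 0, ?m)"
      by (simp only: mult one two' \<open>c = 1\<close> mscale_1)
    then show ?thesis by (simp only: p)
  qed
  show ?thesis
  proof
    fix x :: "'k albert"
    obtain a b d where x: "x = (a, b, d)" by (metis prod_cases3)
    have "z x = z ((a, 0, 0) + (0, b, 0) + (0, 0, d))" by (simp add: x)
    also have "\<dots> = id x" by (simp only: add zero one two' \<open>c = 1\<close> mscale_1) (simp add: x)
    finally show "z x = id x" .
  qed
qed


lemma albert_Aut_simps: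
  "mult albert_Aut = (\<circ>)" "one albert_Aut = id"
  by (simp_all add: albert_Aut_def)

interpretation Aut: group "albert_Aut :: ('k::field albert \<Rightarrow> 'k albert) monoid"
proof (rule groupI)
  fix x :: "'k albert \<Rightarrow> 'k albert" assume x: "x \<in> carrier albert_Aut"
  then show "\<exists>y\<in>carrier albert_Aut. y \<otimes>\<^bsub>albert_Aut\<^esub> x = \<one>\<^bsub>albert_Aut\<^esub>"
    using inv_Aut[OF x] Aut_inv_comp(1)[OF x] by (auto simp: albert_Aut_simps)
qed (auto simp: albert_Aut_simps comp_Aut id_Aut comp_assoc)

lemma inv_albert_Aut: "s \<in> carrier albert_Aut \<Longrightarrow> inv\<^bsub>albert_Aut\<^esub> s = inv_into UNIV s"
  using inv_Aut[of s] Aut_inv_comp(1)[of s] by (intro Aut.inv_equality) (auto simp: albert_Aut_simps)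

interpretation AutoAut: group "AutoGroup (albert_Aut :: ('k::field albert \<Rightarrow> 'k albert) monoid)"
  by (rule Aut.AutoGroup)

lemma inner_aut_apply:
  "s \<in> carrier albert_Aut \<Longrightarrow> x \<in> carrier albert_Aut \<Longrightarrow> inner_aut s x = s \<circ> x \<circ> inv_into UNIV s"
  by (simp add: inner_aut_def inv_albert_Aut) (simp add: albert_Aut_simps)

lemma inner_aut_extensional: "inner_aut s \<in> extensional (carrier albert_Aut)"
  by (simp add: inner_aut_def)

lemma inner_aut_eqI:
  assumes "\<And>x. x \<in> carrier albert_Aut \<Longrightarrow> inner_aut s x = f x" "f \<in> extensional (carrier albert_Aut)"
  shows "inner_aut s = f"
  by (rule extensionalityI[OF inner_aut_extensional assms(2)]) (rule assms(1))

lemma inner_aut_comp: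
  assumes s: "s \<in> carrier albert_Aut" and t: "t \<in> carrier albert_Aut" and x: "x \<in> carrier albert_Aut"
  shows "inner_aut s (inner_aut t x) = inner_aut (s \<circ> t) x"
proof -
  have "s \<otimes>\<^bsub>albert_Aut\<^esub> (t \<otimes>\<^bsub>albert_Aut\<^esub> x \<otimes>\<^bsub>albert_Aut\<^esub> inv\<^bsub>albert_Aut\<^esub> t) \<otimes>\<^bsub>albert_Aut\<^esub> inv\<^bsub>albert_Aut\<^esub> s
      = (s \<otimes>\<^bsub>albert_Aut\<^esub> t) \<otimes>\<^bsub>albert_Aut\<^esub> x \<otimes>\<^bsub>albert_Aut\<^esub> inv\<^bsub>albert_Aut\<^esub> (s \<otimes>\<^bsub>albert_Aut\<^esub> t)"
    using s t x by (simp add: Aut.inv_mult_group Aut.m_assoc)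
  then show ?thesis using s t x by (simp add: inner_aut_def) (simp add: albert_Aut_simps)
qed

lemma inner_aut_closed: "s \<in> carrier albert_Aut \<Longrightarrow> x \<in> carrier albert_Aut \<Longrightarrow> inner_aut s x \<in> carrier albert_Aut"
  by (simp add: inner_aut_def)

lemma inner_aut_id: "inner_aut id = (\<lambda>x\<in>carrier albert_Aut. x)"
  by (rule inner_aut_eqI) (auto simp: inner_aut_apply id_Aut)

lemma inner_aut_auto:
  fixes s :: "'k::field albert \<Rightarrow> 'k albert"
  assumes s: "s \<in> carrier albert_Aut" shows "inner_aut s \<in> auto albert_Aut"
proof -
  have "inner_aut s \<in> hom albert_Aut albert_Aut"
  proof (rule homI)
    fix x y :: "'k albert \<Rightarrow> 'k albert" assume xy: "x \<in> carrier albert_Aut" "y \<in> carrier albert_Aut"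
    have "s \<otimes>\<^bsub>albert_Aut\<^esub> (x \<otimes>\<^bsub>albert_Aut\<^esub> y) \<otimes>\<^bsub>albert_Aut\<^esub> inv\<^bsub>albert_Aut\<^esub> s
      = (s \<otimes>\<^bsub>albert_Aut\<^esub> x \<otimes>\<^bsub>albert_Aut\<^esub> inv\<^bsub>albert_Aut\<^esub> s) \<otimes>\<^bsub>albert_Aut\<^esub> (s \<otimes>\<^bsub>albert_Aut\<^esub> y \<otimes>\<^bsub>albert_Aut\<^esub> inv\<^bsub>albert_Aut\<^esub> s)"
    proof -
      have "inv\<^bsub>albert_Aut\<^esub> s \<otimes>\<^bsub>albert_Aut\<^esub> (s \<otimes>\<^bsub>albert_Aut\<^esub> w) = w" if "w \<in> carrier albert_Aut" for w
        using s that by (simp flip: Aut.m_assoc)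
      then show ?thesis using s xy by (simp add: Aut.m_assoc)
    qed
    then show "inner_aut s (x \<otimes>\<^bsub>albert_Aut\<^esub> y) = inner_aut s x \<otimes>\<^bsub>albert_Aut\<^esub> inner_aut s y"
      using xy by (simp add: inner_aut_def)
  qed (simp add: inner_aut_closed s)
  moreover have "bij_betw (inner_aut s) (carrier albert_Aut) (carrier albert_Aut)"
  proof (rule bij_betw_byWitness[where f' = "inner_aut (inv_into UNIV s)"])
    have i: "inv_into UNIV s \<in> carrier albert_Aut" by (rule inv_Aut[OF s])
    show "\<forall>a\<in>carrier albert_Aut. inner_aut (inv_into UNIV s) (inner_aut s a) = a"
     "\<forall>a\<in>carrier albert_Aut. inner_aut s (inner_aut (inv_into UNIV s) a) = a"
      using s i by (auto simp: inner_aut_comp Aut_inv_comp inner_aut_id)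
    show "inner_aut s ` carrier albert_Aut \<subseteq> carrier albert_Aut"
     "inner_aut (inv_into UNIV s) ` carrier albert_Aut \<subseteq> carrier albert_Aut"
      using s i inner_aut_closed by auto
  qed
  ultimately show ?thesis by (simp add: auto_def Bij_def inner_aut_extensional)
qed

lemma carrier_AutoGroup: "carrier (AutoGroup G) = auto G"
  by (simp add: AutoGroup_def)

lemma mult_inner_aut:
  assumes s: "s \<in> carrier albert_Aut" and t: "t \<in> carrier albert_Aut"
  shows "inner_aut s \<otimes>\<^bsub>AutoGroup albert_Aut\<^esub> inner_aut t = inner_aut (s \<circ> t)"
proof -
  have "inner_aut s \<in> Bij (carrier albert_Aut)" "inner_aut t \<in> Bij (carrier albert_Aut)"
    using inner_aut_auto s t by (auto simp: auto_def)
  then have "inner_aut s \<otimes>\<^bsub>AutoGroup albert_Aut\<^esub> inner_aut t = compose (carrier albert_Aut) (inner_aut s) (inner_aut t)"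
    by (simp add: AutoGroup_def BijGroup_def)
  also have "\<dots> = inner_aut (s \<circ> t)"
    using s t by (intro inner_aut_eqI[symmetric]) (auto simp: compose_def inner_aut_comp)
  finally show ?thesis .
qed

lemma one_AutoGroup: "\<one>\<^bsub>AutoGroup albert_Aut\<^esub> = inner_aut id"
  by (simp add: inner_aut_id AutoGroup_def BijGroup_def)

lemma inv_inner_aut:
  assumes s: "s \<in> carrier albert_Aut"
  shows "inv\<^bsub>AutoGroup albert_Aut\<^esub> inner_aut s = inner_aut (inv_into UNIV s)"
  using s inv_Aut[OF s]
  by (intro AutoAut.inv_equality) (simp_all add: mult_inner_aut one_AutoGroup Aut_inv_comp carrier_AutoGroup inner_aut_auto)

text \<open>If \<open>s\<close> and \<open>t\<close> induce the same inner automorphism, then \<open>t\<^sup>-\<^sup>1 s\<close> is central.\<close>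

lemma inner_aut_inject:
  fixes s t :: "'k::field albert \<Rightarrow> 'k albert"
  assumes two: "(2::'k) \<noteq> 0" and s: "s \<in> carrier albert_Aut" and t: "t \<in> carrier albert_Aut"
    and eq: "inner_aut s = inner_aut t"
  shows "s = t"
proof -
  let ?z = "inv_into UNIV t \<circ> s"
  have z: "?z \<in> carrier albert_Aut" using s t by (intro comp_Aut inv_Aut)
  have "?z \<circ> x = x \<circ> ?z" if x: "x \<in> carrier albert_Aut" for x
  proof -
    have 1: "s \<circ> x \<circ> inv_into UNIV s = t \<circ> x \<circ> inv_into UNIV t"
      using eq inner_aut_apply[OF s x] inner_aut_apply[OF t x] by simp
    have "inv_into UNIV t \<circ> (s \<circ> x \<circ> inv_into UNIV s) \<circ> s = inv_into UNIV t \<circ> (t \<circ> x \<circ> inv_into UNIV t) \<circ> s"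
      by (simp only: 1)
    moreover have "inv_into UNIV t (t y) = y" "inv_into UNIV s (s y) = y" for y
      using Aut_inv_comp[OF s] Aut_inv_comp[OF t] by (simp_all add: fun_eq_iff)
    ultimately show ?thesis by (simp add: fun_eq_iff)
  qed
  from Aut_centre_trivial[OF two z this] have "inv_into UNIV t (s y) = y" for y
    by (simp add: fun_eq_iff)
  then have "t (inv_into UNIV t (s y)) = t y" for y by simp
  then show ?thesis using Aut_inv_comp(2)[OF t] by (simp add: fun_eq_iff)
qed

lemma isomorphic_inner_aut_iff:
  fixes s t :: "'k::field albert \<Rightarrow> 'k albert"
  assumes two: "(2::'k) \<noteq> 0" and s: "s \<in> carrier albert_Aut" and t: "t \<in> carrier albert_Aut"
  shows "isomorphic_involutions (inner_aut s) (inner_aut t) \<longleftrightarrow> albert_conj s t"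
proof -
  have "inner_aut h \<otimes>\<^bsub>AutoGroup albert_Aut\<^esub> inner_aut s \<otimes>\<^bsub>AutoGroup albert_Aut\<^esub> inv\<^bsub>AutoGroup albert_Aut\<^esub> (inner_aut h)
     = inner_aut (h \<circ> s \<circ> inv_into UNIV h)" if "h \<in> carrier albert_Aut" for h
    using that s by (simp add: inv_inner_aut mult_inner_aut comp_Aut inv_Aut)
  then have "isomorphic_involutions (inner_aut s) (inner_aut t) \<longleftrightarrow>
      (\<exists>h\<in>carrier albert_Aut. inner_aut t = inner_aut (h \<circ> s \<circ> inv_into UNIV h))"
    by (simp add: isomorphic_involutions_def)
  also have "\<dots> \<longleftrightarrow> (\<exists>h\<in>carrier albert_Aut. t = h \<circ> s \<circ> inv_into UNIV h)"
    using inner_aut_inject[OF two t] s by (metis comp_Aut inv_Aut)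
  also have "\<dots> \<longleftrightarrow> albert_conj t s"
  proof -
    have "t = h \<circ> s \<circ> inv_into UNIV h \<longleftrightarrow> t \<circ> h = h \<circ> s" if h: "h \<in> carrier albert_Aut" for h
    proof -
      have "h (inv_into UNIV h y) = y" "inv_into UNIV h (h y) = y" for y
        using Aut_inv_comp[OF h] by (simp_all add: fun_eq_iff)
      then show ?thesis by (auto simp: fun_eq_iff) (metis)
    qed
    then show ?thesis by (simp add: albert_conj_def)
  qed
  finally show ?thesis using albert_conj_sym by blast
qed

section \<open>The fixed subalgebras\<close>

definition mat22 :: "'a::zero \<Rightarrow> 'a \<Rightarrow> 'a \<Rightarrow> 'a \<Rightarrow> 'a^2^2" where
  "mat22 a b c d = vector [vector [a, b], vector [c, d]]"

lemma two_neq [simp]: "(1::2) \<noteq> 2" "(2::2) \<noteq> 1"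
  by simp_all

lemma mat22_nth [simp]:
  "mat22 a b c d $ 1 $ 1 = a" "mat22 a b c d $ 1 $ 2 = b" "mat22 a b c d $ 2 $ 1 = c" "mat22 a b c d $ 2 $ 2 = d"
  by (simp_all only: mat22_def vector_2)

lemma mat22_eq_conv: "m = mat22 a b c d \<longleftrightarrow> m$1$1 = a \<and> m$1$2 = b \<and> m$2$1 = c \<and> m$2$2 = d"
  unfolding vec_eq_iff[of m] vec_eq_iff[of "m $ _"] forall_2 mat22_nth by blast

lemma mat22_eq_iff [simp]: "mat22 a b c d = mat22 a' b' c' d' \<longleftrightarrow> a = a' \<and> b = b' \<and> c = c' \<and> d = d'"
  by (simp only: mat22_eq_conv mat22_nth)

lemma mat22_ops [simp]:
  "mat22 a b c d + mat22 a' b' c' d' = (mat22 (a+a') (b+b') (c+c') (d+d') :: 'k::field^2^2)"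
  "mat22 a b c d - mat22 a' b' c' d' = (mat22 (a-a') (b-b') (c-c') (d-d') :: 'k::field^2^2)"
  "- mat22 a b c d = (mat22 (-a) (-b) (-c) (-d) :: 'k::field^2^2)"
  "mscale s (mat22 a b c d) = mat22 (s*a) (s*b) (s*c) (s*d)"
  "mat22 a b c d ** mat22 a' b' c' d' = (mat22 (a*a'+b*c') (a*b'+b*d') (c*a'+d*c') (c*b'+d*d') :: 'k::field^2^2)"
  "adjugate (mat22 a b c d) = (mat22 d (-b) (-c) a :: 'k::field^2^2)"
  "det (mat22 a b c d) = (a * d - b * c :: 'k::field)"
  by (simp_all add: mat22_eq_conv mscale_def matrix_matrix_mult_def sum_2 adjugate_def det_2 axis_def)

lemma zero_one_mat22: "0 = mat22 0 0 0 0" "mat 1 = (mat22 1 0 0 1 :: 'k::field^2^2)"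
  by (simp_all add: mat22_eq_conv mat_def)

interpretation oct: vector_space "oct_scale :: 'k::field \<Rightarrow> 'k oct \<Rightarrow> 'k oct"
  by unfold_locales (auto simp: oct_scale_def mscale_def vec_eq_iff algebra_simps)

text \<open>The element \<open>w + x i + y j + z i j\<close> of a quaternion algebra with \<open>i\<^sup>2 = -c\<close>, \<open>j\<^sup>2 = -d\<close> inside the
  split octonions: \<open>i\<close> is a \<open>2 \<times> 2\<close> matrix of norm \<open>c\<close> and trace \<open>0\<close>, and \<open>j\<close> is a vector of norm \<open>d\<close> in the
  second summand, which is orthogonal to the first.\<close>

definition quat :: "'k::field \<Rightarrow> 'k \<Rightarrow> 'k \<Rightarrow> 'k \<Rightarrow> 'k \<Rightarrow> 'k \<Rightarrow> 'k oct" where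
  "quat c d w x y z = (mat22 w (- c * x) x w, mat22 y (- c * z) (- d * z) (- d * y))"

lemma quat_ops [simp]:
  "quat c d w x y z + quat c d w' x' y' z' = quat c d (w+w') (x+x') (y+y') (z+z')"
  "oct_scale s (quat c d w x y z) = quat c d (s*w) (s*x) (s*y) (s*z)"
  "oct_conj (quat c d w x y z) = quat c d w (-x) (-y) (-z)"
  "oct_mult (quat c d w x y z) (quat c d w' x' y' z') =
     quat c d (w*w' - c*x*x' - d*y*y' - c*d*z*z') (w*x' + x*w' + d*(y*z' - z*y'))
       (w*y' + y*w' - c*(x*z' - z*x')) (w*z' + z*w' + x*y' - y*x')"
  by (simp_all add: quat_def oct_scale_def oct_conj_def oct_mult_def algebra_simps)

lemma quat_nth:
  "fst (quat c d w x y z) $ 1 $ 1 = w" "fst (quat c d w x y z) $ 2 $ 1 = x"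
  "snd (quat c d w x y z) $ 1 $ 1 = y" "snd (quat c d w x y z) $ 1 $ 2 = - c * z"
  by (simp_all add: quat_def)

lemma quat_eq_iff:
  "d \<noteq> 0 \<Longrightarrow> quat c d w x y z = quat c d w' x' y' z' \<longleftrightarrow> w = w' \<and> x = x' \<and> y = y' \<and> z = z'"
  by (auto simp: quat_def)

lemma oct_one_quat: "oct_one = quat c d 1 0 0 0"
  by (simp add: oct_one_def quat_def zero_one_mat22)

lemma zero_quat: "0 = quat c d 0 0 0 0"
  by (simp add: quat_def zero_prod_def zero_one_mat22)

lemma oct_norm_quat: "oct_norm (quat c d w x y z) = w*w + c*(x*x) + d*(y*y) + c*d*(z*z)"
  by (simp add: oct_norm_def quat_def algebra_simps)

definition quat_alg :: "'k::field \<Rightarrow> 'k \<Rightarrow> 'k oct set" where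
  "quat_alg c d = {quat c d w x y z | w x y z. True}"

lemma quat_mem [simp]: "quat c d w x y z \<in> quat_alg c d"
  by (auto simp: quat_alg_def)

lemma quat_algE:
  assumes "p \<in> quat_alg c d" obtains w x y z where "p = quat c d w x y z"
  using assms by (auto simp only: quat_alg_def mem_Collect_eq)

text \<open>Used to read off dimensions from explicit parametrizations.\<close>

lemma dim_range_linear:
  fixes L :: "'k::field^'n \<Rightarrow> 'b::ab_group_add"
  assumes "vector_space sc" "\<And>x y. L (x + y) = L x + L y" "\<And>c x. L (c *s x) = sc c (L x)" "inj L"
  shows "vector_space.dim sc (range L) = CARD('n)"
proof -
  interpret V: vector_space sc by fact
  interpret pair: finite_dimensional_vector_space_pair_1 "(*s)" "cart_basis :: ('k^'n) set" sc
    by unfold_locales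
  have "Vector_Spaces.linear (*s) sc L"
    using assms by (simp add: Vector_Spaces.linear_iff vec.vector_space_axioms)
  then have "V.dim (range L) = vec.dim (UNIV :: ('k^'n) set)"
    using assms(4) by (intro pair.dim_image_eq) (auto intro: inj_on_subset)
  then show ?thesis by (simp only: vec_dim_card)
qed

lemma quaternion_subalgebra_quat_alg:
  fixes c d :: "'k::field"
  assumes two: "(2::'k) \<noteq> 0" and nz: "c \<noteq> 0" "d \<noteq> 0"
  shows "quaternion_subalgebra (quat_alg c d)"
  unfolding quaternion_subalgebra_def
proof (intro conjI ballI impI)
  show "module.subspace oct_scale (quat_alg c d)"
  proof (rule oct.subspaceI)
    show "0 \<in> quat_alg c d" by (simp add: zero_quat[of c d])
  qed (auto elim!: quat_algE)
  show "vector_space.dim oct_scale (quat_alg c d) = 4"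
  proof -
    let ?L = "\<lambda>v::'k^4. quat c d (v$1) (v$2) (v$3) (v$4)"
    have "quat_alg c d = range ?L"
    proof -
      have "quat c d w x y z = ?L (\<chi> i. if i = 1 then w else if i = 2 then x else if i = 3 then y else z)" for w x y z
        by simp
      then show ?thesis unfolding quat_alg_def by blast
    qed
    moreover have "vector_space.dim oct_scale (range ?L) = CARD(4)"
      using nz by (intro dim_range_linear) (auto simp: oct.vector_space_axioms inj_on_def quat_eq_iff vec_eq_iff forall_4)
    ultimately show ?thesis by simp
  qed
  show "oct_one \<in> quat_alg c d" by (simp add: oct_one_quat[of c d])
  show "oct_mult x y \<in> quat_alg c d" if "x \<in> quat_alg c d" "y \<in> quat_alg c d" for x y
    using that by (auto elim!: quat_algE)
  show "x = 0" if x: "x \<in> quat_alg c d" and o: "\<forall>y\<in>quat_alg c d. oct_polar x y = 0" for x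
  proof -
    obtain w1 x1 y1 z1 where xq: "x = quat c d w1 x1 y1 z1" using x by (rule quat_algE)
    have "2 * (w1*w + c*(x1*x) + d*(y1*y) + c*d*(z1*z)) = 0" for w x y z
    proof -
      have "oct_polar (quat c d w1 x1 y1 z1) (quat c d w x y z) = 0" using o xq by simp
      then show ?thesis by (simp add: oct_polar_def oct_norm_quat algebra_simps)
    qed
    from this[of 1 0 0 0] this[of 0 1 0 0] this[of 0 0 1 0] this[of 0 0 0 1]
    show ?thesis using two nz by (simp add: xq zero_quat[of c d])
  qed
qed

text \<open>The equations are solved for half of the off-diagonal entries of \<open>a\<^sub>0\<close> and for \<open>a\<^sub>2\<close>, so that later
  calculations can substitute them.\<close>

lemma mem_fixed_quat_inv:
  assumes "a \<noteq> 0" "b \<noteq> 0" "c \<noteq> 0" "d \<noteq> 0"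
  shows "(mat33 a11 a12 a13 a21 a22 a23 a31 a32 a33, mat33 b11 b12 b13 b21 b22 b23 b31 b32 b33,
          mat33 c11 c12 c13 c21 c22 c23 c31 c32 c33) \<in> fixed_subalgebra (quat_inv a b c d) \<longleftrightarrow>
     a21 = a / b * a12 \<and> a13 = a31 / (a * (a * b)) \<and> a23 = a32 / (b * (a * b)) \<and>
     c11 = a / c * b11 \<and> c12 = b / c * b21 \<and> c13 = b31 / (a * b * c) \<and>
     c21 = a / d * b12 \<and> c22 = b / d * b22 \<and> c23 = b32 / (a * b * d) \<and>
     c31 = a * (c * d) * b13 \<and> c32 = b * (c * d) * b23 \<and> c33 = (c * d) / (a * b) * b33"
  using assms
  by (simp add: fixed_subalgebra_def quat_inv_def diag_inv_mat33) (auto simp: field_simps)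

text \<open>The index \<open>(i, s)\<close> stands for the diagonal entry \<open>i\<close>, for the off-diagonal position opposite to
  \<open>i\<close>, or for an entry of row \<open>i\<close> of \<open>a\<^sub>1\<close>; this makes \<open>3 \<cdot> (2 + 3) = 15\<close> coordinates.\<close>

definition fixed_param :: "'k::field \<Rightarrow> 'k \<Rightarrow> 'k \<Rightarrow> 'k \<Rightarrow> 'k^(3 \<times> (2 + 3)) \<Rightarrow> 'k albert" where
  "fixed_param a b c d v =
    (let A = (\<lambda>i. v $ (i, Inl 1)); Z = (\<lambda>i. v $ (i, Inl 2)); R = (\<lambda>i l. v $ (i, Inr l)); e = inverse (a * b) in
     (mat33 (A 1) (b * Z 3) (e * Z 2) (a * Z 3) (A 2) (e * Z 1) (a * Z 2) (b * Z 1) (A 3),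
      mat33 (R 1 1) (R 1 2) (R 1 3) (R 2 1) (R 2 2) (R 2 3) (R 3 1) (R 3 2) (R 3 3),
      mat33 (a / c * R 1 1) (b / c * R 2 1) (e / c * R 3 1)
            (a / d * R 1 2) (b / d * R 2 2) (e / d * R 3 2)
            (a * (c * d) * R 1 3) (b * (c * d) * R 2 3) (e * (c * d) * R 3 3)))"

lemma dim_fixed_quat_inv:
  fixes a b c d :: "'k::field"
  assumes nz: "a \<noteq> 0" "b \<noteq> 0" "c \<noteq> 0" "d \<noteq> 0"
  shows "vector_space.dim albert_scale (fixed_subalgebra (quat_inv a b c d)) = 15"
proof -
  have "fixed_subalgebra (quat_inv a b c d) = range (fixed_param a b c d)"
  proof (intro equalityI subsetI)
    fix x assume x: "x \<in> fixed_subalgebra (quat_inv a b c d)"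
    show "x \<in> range (fixed_param a b c d)"
    proof (cases x rule: albert_cases)
      case (albert a11 a12 a13 a21 a22 a23 a31 a32 a33 b11 b12 b13 b21 b22 b23 b31 b32 b33 c11 c12 c13 c21 c22 c23 c31 c32 c33)
      define A where "A i = (if i = 1 then a11 else if i = 2 then a22 else a33)" for i :: 3
      define Z where "Z i = (if i = 1 then a32 / b else if i = 2 then a31 / a else a12 / b)" for i :: 3
      define R where "R = mat33 b11 b12 b13 b21 b22 b23 b31 b32 b33"
      define v :: "'k^(3 \<times> (2 + 3))" where
        "v = (\<chi> p. case snd p of Inl t \<Rightarrow> if t = 1 then A (fst p) else Z (fst p) | Inr l \<Rightarrow> R $ fst p $ l)"
      have "x = fixed_param a b c d v"
        using x nz unfolding albert mem_fixed_quat_inv[OF nz]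
        by (elim conjE) (simp add: fixed_param_def v_def A_def Z_def R_def field_simps)
      then show ?thesis by simp
    qed
  next
    fix x assume "x \<in> range (fixed_param a b c d)"
    then show "x \<in> fixed_subalgebra (quat_inv a b c d)"
      using nz by (auto simp: fixed_param_def Let_def mem_fixed_quat_inv field_simps)
  qed
  moreover have "vector_space.dim albert_scale (range (fixed_param a b c d)) = CARD(3 \<times> (2 + 3))"
  proof (rule dim_range_linear[OF albert.vector_space_axioms])
    show "fixed_param a b c d (x + y) = fixed_param a b c d x + fixed_param a b c d y" for x y
      by (simp add: fixed_param_def Let_def algebra_simps add_divide_distrib)
    show "fixed_param a b c d (t *s x) = albert_scale t (fixed_param a b c d x)" for t x
      by (simp add: fixed_param_def Let_def albert_scale_def)
    show "inj (fixed_param a b c d)"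
    proof (rule injI)
      fix x y assume "fixed_param a b c d x = fixed_param a b c d y"
      then have "\<forall>i. x $ (i, Inl 1) = y $ (i, Inl 1) \<and> x $ (i, Inl 2) = y $ (i, Inl 2) \<and> (\<forall>l. x $ (i, Inr l) = y $ (i, Inr l))"
        using nz by (simp add: fixed_param_def Let_def forall_3)
      then have "x $ (i, s) = y $ (i, s)" for i s
      proof (cases s)
        case (Inl t)
        then show ?thesis using \<open>\<forall>i. _ i\<close> exhaust_2[of t] by auto
      qed simp
      then show "x = y" by (simp add: vec_eq_iff split_paired_All)
    qed
  qed
  ultimately show ?thesis by simp
qed


definition adj_cross :: "'k::field^3^3 \<Rightarrow> 'k^3^3 \<Rightarrow> 'k^3^3" where
  "adj_cross m n = adjugate (m + n) - adjugate m - adjugate n"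

lemma mat33_adj_cross [simp]:
  "adj_cross (mat33 a b c d e f g h i) (mat33 a' b' c' d' e' f' g' h' i') =
    mat33 (e*i'+e'*i-f*h'-f'*h) (c*h'+c'*h-b*i'-b'*i) (b*f'+b'*f-c*e'-c'*e)
      (f*g'+f'*g-d*i'-d'*i) (a*i'+a'*i-c*g'-c'*g) (c*d'+c'*d-a*f'-a'*f)
      (d*h'+d'*h-e*g'-e'*g) (b*g'+b'*g-a*h'-a'*h) (a*e'+a'*e-b*d'-b'*d)"
  by (simp add: adj_cross_def algebra_simps)

text \<open>On \<open>a\<^sub>0\<close> the product is the Jordan product of matrices, and \<open>a\<^sub>0\<close> acts on the other components
  through \<open>tr(a\<^sub>0) - a\<^sub>0\<close>. This form is short enough for calculations with all coordinates.\<close>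

lemma albert_mult_eq:
  fixes A B C :: "'k::field^3^3"
  shows "albert_mult (A, B, C) (A', B', C') =
    (let bar = (\<lambda>m. mscale (trace m) (mat 1) - m); h = mscale (1 / 2) in
     (h (A ** A' + A' ** A + bar (B ** C' + B' ** C)),
      h (adj_cross C C' + bar A ** B' + bar A' ** B),
      h (adj_cross B B' + C ** bar A' + C' ** bar A)))"
proof -
  have 1: "adj_cross A A' + mscale (trace A) A' + mscale (trace A') A - mscale (trace (adj_cross A A')) (mat 1) = A ** A' + A' ** A"
    by (cases A rule: mat33_cases; cases A' rule: mat33_cases) (simp add: one_mat33, simp add: algebra_simps)
  have tr: "trace (x + y) = trace x + trace y" "trace (x - y) = trace x - trace y" "trace (- x) = - trace x" for x y :: "'k^3^3"
    by (simp_all add: trace_def sum.distrib sum_subtractf sum_negf)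
  have ms: "mscale (x + y) m = mscale x m + mscale y m" "mscale (x - y) m = mscale x m - mscale y m" 
     for x y and m :: "'k^3^3"
    by (simp_all add: mscale_def vec_eq_iff algebra_simps)
  have m1: "mscale t (mat 1) ** m = mscale t m" "m ** mscale t (mat 1) = mscale t m" for t and m :: "'k^3^3"
    by (simp_all add: mscale_mult_left mscale_mult_right)
  show ?thesis
    unfolding 1[symmetric] Let_def
    by (simp add: albert_mult_def albert_cross_def albert_Sr_def albert_sharp_def albert_trace_def albert_scale_def albert_one_def
       matrix_mult_distribs tr ms m1 adj_cross_def) (simp add: mscale_def vec_eq_iff algebra_simps)
qed

text \<open>The off-diagonal position \<open>(j, k)\<close> and the row \<open>i\<close> of \<open>a\<^sub>1\<close>, for a cyclic permutation \<open>(i, j, k)\<close>, form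
  a Peirce space of the fixed subalgebra. It has dimension four and its quadratic form is similar to
  \<open>\<langle>1, 1/c, 1/d, c d\<rangle>\<close>, a quaternion norm form. The entry of \<open>a\<^sub>0\<close> becomes the real part of a quaternion,
  the row becomes its pure part. The signs match the cross product in \<open>a\<^sub>1\<^sup>#\<close> with the
  commutator of quaternions, and the scalars come from \<open>\<gamma> = (a, b, (a b)\<^sup>-\<^sup>1)\<close>.\<close>

definition fixed_to_H3 :: "'k::field \<Rightarrow> 'k \<Rightarrow> 'k \<Rightarrow> 'k \<Rightarrow> 'k albert \<Rightarrow> 'k oct^3^3" where
  "fixed_to_H3 a b c d = (\<lambda>(A, B, C).
    (let q = (\<lambda>s t i. quat (inverse c) (inverse d) s (t * B$i$1) (t * B$i$2) (t * (c * d) * B$i$3)) in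
      mat33 (q (A$1$1) 0 1) (q (A$1$2) (- inverse a) 3) (q (A$1$3) (inverse a) 2)
            (q (A$2$1) (inverse b) 3) (q (A$2$2) 0 1) (q (A$2$3) (- inverse b) 1)
            (q (A$3$1) (- (a * b)) 2) (q (A$3$2) (a * b) 1) (q (A$3$3) 0 1)))"

definition H3_to_fixed :: "'k::field \<Rightarrow> 'k \<Rightarrow> 'k \<Rightarrow> 'k \<Rightarrow> 'k oct^3^3 \<Rightarrow> 'k albert" where
  "H3_to_fixed a b c d X =
    (let re = (\<lambda>i j. fst (X$i$j) $ 1 $ 1); x = (\<lambda>i j. fst (X$i$j) $ 2 $ 1); y = (\<lambda>i j. snd (X$i$j) $ 1 $ 1);
         z = (\<lambda>i j. - snd (X$i$j) $ 1 $ 2 / d);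
         B = mat33 (- b * x 2 3) (- b * y 2 3) (- b * z 2 3)
                  (- x 3 1 / (a * b)) (- y 3 1 / (a * b)) (- z 3 1 / (a * b))
                  (- a * x 1 2) (- a * y 1 2) (- a * z 1 2) in
     (mat33 (re 1 1) (re 1 2) (re 1 3) (re 2 1) (re 2 2) (re 2 3) (re 3 1) (re 3 2) (re 3 3), B,
      mat33 (a / c * B$1$1) (b / c * B$2$1) (B$3$1 / (a * b * c))
            (a / d * B$1$2) (b / d * B$2$2) (B$3$2 / (a * b * d))
            (a * (c * d) * B$1$3) (b * (c * d) * B$2$3) (c * d / (a * b) * B$3$3)))"

lemma omat_mat33:
  "H3_mult (mat33 a b c d e f g h i) (mat33 a' b' c' d' e' f' g' h' i') =
   (let m = (\<lambda>x y z x' y' z' u v w u' v' w'. oct_scale (1/2) ((oct_mult x x' + oct_mult y y' + oct_mult z z') + (oct_mult u' u + oct_mult v' v + oct_mult w' w))) in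
    mat33 (m a b c a' d' g' a d g a' b' c') (m a b c b' e' h' b e h a' b' c') (m a b c c' f' i' c f i a' b' c')
          (m d e f a' d' g' a d g d' e' f') (m d e f b' e' h' b e h d' e' f') (m d e f c' f' i' c f i d' e' f')
          (m g h i a' d' g' a d g g' h' i') (m g h i b' e' h' b e h g' h' i') (m g h i c' f' i' c f i g' h' i'))"
  "omat_scale s (mat33 a b c d e f g h i) = mat33 (oct_scale s a) (oct_scale s b) (oct_scale s c) (oct_scale s d) (oct_scale s e) (oct_scale s f) (oct_scale s g) (oct_scale s h) (oct_scale s i)"
  by (simp_all add: mat33_eq_conv H3_mult_def omat_mult_def omat_scale_def sum_3 Let_def)

lemma mem_H3_mat33:
  "mat33 a b c d e f g h i \<in> H3 D \<gamma> \<longleftrightarrow>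
    ({a, b, c, d, e, f, g, h, i} \<subseteq> D \<and> {a, e, i} \<subseteq> range (\<lambda>c. oct_scale c oct_one)) \<and>
     oct_scale (inverse (\<gamma> $ 1) * \<gamma> $ 1) (oct_conj a) = a \<and> oct_scale (inverse (\<gamma> $ 1) * \<gamma> $ 2) (oct_conj d) = b \<and>
     oct_scale (inverse (\<gamma> $ 1) * \<gamma> $ 3) (oct_conj g) = c \<and> oct_scale (inverse (\<gamma> $ 2) * \<gamma> $ 1) (oct_conj b) = d \<and>
     oct_scale (inverse (\<gamma> $ 2) * \<gamma> $ 2) (oct_conj e) = e \<and> oct_scale (inverse (\<gamma> $ 2) * \<gamma> $ 3) (oct_conj h) = f \<and>
     oct_scale (inverse (\<gamma> $ 3) * \<gamma> $ 1) (oct_conj c) = g \<and> oct_scale (inverse (\<gamma> $ 3) * \<gamma> $ 2) (oct_conj f) = h \<and>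
     oct_scale (inverse (\<gamma> $ 3) * \<gamma> $ 3) (oct_conj i) = i"
  by (simp only: H3_def mem_Collect_eq forall_3 mat33_nth) blast

lemma fixed_to_H3_mult:
  fixes a b c d :: "'k::field"
  assumes two: "(2::'k) \<noteq> 0" and nz: "a \<noteq> 0" "b \<noteq> 0" "c \<noteq> 0" "d \<noteq> 0"
   and x: "x \<in> fixed_subalgebra (quat_inv a b c d)" and y: "y \<in> fixed_subalgebra (quat_inv a b c d)"
  shows "fixed_to_H3 a b c d (albert_mult x y) = H3_mult (fixed_to_H3 a b c d x) (fixed_to_H3 a b c d y)"
  using x y nz two
  apply (cases x rule: albert_cases; cases y rule: albert_cases)
   apply (simp only: mem_fixed_quat_inv[OF nz], elim conjE)
  apply (hypsubst)
  apply (simp add: fixed_to_H3_def albert_mult_eq Let_def omat_mat33 one_mat33 quat_eq_iff)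
  apply (intro conjI)
  apply (simp_all add: field_simps)
  done

lemma H3_quat_cases:
  fixes \<gamma> :: "'k::field^3"
  assumes "X \<in> H3 (quat_alg c d) \<gamma>"
  shows "\<exists>r1 r2 r3 w1 x1 y1 z1 w2 x2 y2 z2 w3 x3 y3 z3. X = mat33 (quat c d r1 0 0 0) (quat c d w3 x3 y3 z3) (oct_scale (inverse (\<gamma> $ 1) * \<gamma> $ 3) (quat c d w2 (-x2) (-y2) (-z2)))
      (oct_scale (inverse (\<gamma> $ 2) * \<gamma> $ 1) (quat c d w3 (-x3) (-y3) (-z3))) (quat c d r2 0 0 0) (quat c d w1 x1 y1 z1)
      (quat c d w2 x2 y2 z2) (oct_scale (inverse (\<gamma> $ 3) * \<gamma> $ 2) (quat c d w1 (-x1) (-y1) (-z1))) (quat c d r3 0 0 0)"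
proof -
  obtain m11 m12 m13 m21 m22 m23 m31 m32 m33 where X: "X = mat33 m11 m12 m13 m21 m22 m23 m31 m32 m33"
    by (rule mat33_cases)
  have real: "\<exists>r. m = quat c d r 0 0 0" if "m \<in> range (\<lambda>s. oct_scale s oct_one)" for m
    using that by (auto simp: oct_one_quat[of c d])
  have "m11 \<in> range (\<lambda>s. oct_scale s oct_one)" "m22 \<in> range (\<lambda>s. oct_scale s oct_one)" "m33 \<in> range (\<lambda>s. oct_scale s oct_one)"
     "m12 \<in> quat_alg c d" "m23 \<in> quat_alg c d" "m31 \<in> quat_alg c d"
   and c: "m21 = oct_scale (inverse (\<gamma> $ 2) * \<gamma> $ 1) (oct_conj m12)"
     "m32 = oct_scale (inverse (\<gamma> $ 3) * \<gamma> $ 2) (oct_conj m23)"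
     "m13 = oct_scale (inverse (\<gamma> $ 1) * \<gamma> $ 3) (oct_conj m31)"
    using assms unfolding X mem_H3_mat33 by auto
  then obtain r1 r2 r3 w1 x1 y1 z1 w2 x2 y2 z2 w3 x3 y3 z3 where
    "m11 = quat c d r1 0 0 0" "m22 = quat c d r2 0 0 0" "m33 = quat c d r3 0 0 0"
    "m12 = quat c d w3 x3 y3 z3" "m23 = quat c d w1 x1 y1 z1" "m31 = quat c d w2 x2 y2 z2"
    using real by (metis quat_algE)
  then show ?thesis using c unfolding X by (simp del: quat_ops(2)) blast
qed

lemma isomorphic_to_H3_quat_inv:
  fixes a b c d :: "'k::field"
  assumes two: "(2::'k) \<noteq> 0" and nz: "a \<noteq> 0" "b \<noteq> 0" "c \<noteq> 0" "d \<noteq> 0"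
  shows "isomorphic_to_H3 (fixed_subalgebra (quat_inv a b c d)) (quat_alg (inverse c) (inverse d)) (vector [a, b, inverse (a * b)])"
    (is "isomorphic_to_H3 ?F ?D ?\<gamma>")
  unfolding isomorphic_to_H3_def
proof (intro exI conjI ballI allI)
  let ?f = "fixed_to_H3 a b c d"
  have real: "quat (inverse c) (inverse d) s 0 0 0 \<in> range (\<lambda>c. oct_scale c oct_one)" for s
    by (rule range_eqI[of _ _ s]) (simp add: oct_one_quat[of "inverse c" "inverse d"])
  show "bij_betw ?f ?F (H3 ?D ?\<gamma>)"
  proof (rule bij_betw_byWitness[where f' = "H3_to_fixed a b c d"])
    show "\<forall>x\<in>?F. H3_to_fixed a b c d (?f x) = x"
    proof
      fix x assume x: "x \<in> ?F"
      then show "H3_to_fixed a b c d (?f x) = x"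
        using nz by (cases x rule: albert_cases)
         (simp add: mem_fixed_quat_inv fixed_to_H3_def H3_to_fixed_def Let_def quat_def, simp add: field_simps)
    qed
    show "?f ` ?F \<subseteq> H3 ?D ?\<gamma>"
    proof (rule image_subsetI)
      fix x assume x: "x \<in> ?F"
      then show "?f x \<in> H3 ?D ?\<gamma>"
        using nz by (cases x rule: albert_cases)
         (simp add: mem_fixed_quat_inv fixed_to_H3_def Let_def mem_H3_mat33 real quat_eq_iff, simp add: field_simps)
    qed
    have onto: "H3_to_fixed a b c d X \<in> ?F \<and> ?f (H3_to_fixed a b c d X) = X" if X: "X \<in> H3 ?D ?\<gamma>" for X
      using H3_quat_cases[OF X] nz
      by (elim exE) (simp add: H3_to_fixed_def Let_def quat_nth mem_fixed_quat_inv fixed_to_H3_def quat_eq_iff, simp add: field_simps)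
    then show "\<forall>X\<in>H3 ?D ?\<gamma>. ?f (H3_to_fixed a b c d X) = X" "H3_to_fixed a b c d ` H3 ?D ?\<gamma> \<subseteq> ?F" by auto
  qed
  fix x y s assume x: "x \<in> ?F"
  show "?f (albert_scale s x) = omat_scale s (?f x)"
    by (cases x rule: albert_cases)
      (simp add: fixed_to_H3_def albert_scale_def Let_def omat_mat33 algebra_simps)
  assume y: "y \<in> ?F"
  show "?f (x + y) = ?f x + ?f y"
    by (cases x rule: albert_cases; cases y rule: albert_cases)
      (simp add: fixed_to_H3_def Let_def algebra_simps)
  show "?f (albert_mult x y) = H3_mult (?f x) (?f y)"
    using fixed_to_H3_mult[OF two nz x y] .
qed

section \<open>Isomorphism classes and conjugacy classes\<close>

lemma torus_elt_eq_conj_aut: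
  "torus_elt u1 u2 v1 v2 = conj_aut (diag3 u1 (inverse u1 * u2) (inverse u2)) (diag3 v1 (inverse v1 * v2) (inverse v2))"
  by (simp add: torus_elt_def conj_aut_def Let_def)

lemma quat_inv_Aut:
  assumes "a \<noteq> 0" "b \<noteq> 0" "c \<noteq> 0" "d \<noteq> 0"
  shows "quat_inv a b c d \<in> carrier albert_Aut"
  unfolding quat_inv_eq_g_torus[OF assms] torus_elt_eq_conj_aut
  by (intro comp_Aut g_elt_Aut conj_aut_Aut) (use assms in \<open>simp_all add: det_diag3 field_simps\<close>)

lemma quat_inv_involutive:
  assumes "a \<noteq> 0" "b \<noteq> 0" "c \<noteq> 0" "d \<noteq> 0"
  shows "quat_inv a b c d (quat_inv a b c d x) = x"
  using assms by (cases x rule: albert_cases) (simp add: quat_inv_def diag_inv_mat33)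

lemma quat_inv_neq_id:
  assumes "a \<noteq> 0" "b \<noteq> 0" "c \<noteq> 0" "d \<noteq> 0"
  shows "quat_inv a b c d \<noteq> id"
proof
  assume "quat_inv a b c d = id"
  then have "quat_inv a b c d (mat33 0 0 0 0 0 0 0 0 0, mat33 1 0 0 0 0 0 0 0 0, mat33 0 0 0 0 0 0 0 0 0)
     = (mat33 0 0 0 0 0 0 0 0 0, mat33 1 0 0 0 0 0 0 0 0, mat33 0 0 0 0 0 0 0 0 0)" by simp
  then show False using assms by (simp add: quat_inv_def diag_inv_mat33)
qed

text \<open>The fixed subalgebra is \<open>H\<^sub>3(D, \<gamma>)\<close>, where the second symbol determines \<open>D\<close> and the first
  determines \<open>\<gamma>\<close>.\<close>

lemma type_I_quat_inv:
  fixes a b c d :: "'k::field"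
  assumes two: "(2::'k) \<noteq> 0" and nz: "a \<noteq> 0" "b \<noteq> 0" "c \<noteq> 0" "d \<noteq> 0"
  shows "type_I (quat_inv a b c d)"
  unfolding type_I_def
proof (intro conjI exI)
  show "quaternion_subalgebra (quat_alg (inverse c) (inverse d))"
    using two nz by (intro quaternion_subalgebra_quat_alg) simp_all
  show "\<forall>i. (vector [a, b, inverse (a * b)] :: 'k^3) $ i \<noteq> 0"
    using nz by (simp add: forall_3)
  show "quat_inv a b c d \<circ> quat_inv a b c d = id"
    using nz by (simp add: fun_eq_iff quat_inv_involutive)
  show "isomorphic_to_H3 (fixed_subalgebra (quat_inv a b c d)) (quat_alg (inverse c) (inverse d)) (vector [a, b, inverse (a * b)])"
    using assms by (rule isomorphic_to_H3_quat_inv)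
qed (use nz in \<open>simp_all add: quat_inv_Aut quat_inv_neq_id dim_fixed_quat_inv\<close>)

text \<open>An inner automorphism is trivial only if the inducing element is, because the centre is
  trivial.\<close>

lemma k_involution_quat_inv:
  fixes a b c d :: "'k::field"
  assumes two: "(2::'k) \<noteq> 0" and nz: "a \<noteq> 0" "b \<noteq> 0" "c \<noteq> 0" "d \<noteq> 0"
  shows "k_involution (inner_aut (quat_inv a b c d))"
proof -
  have s: "quat_inv a b c d \<in> carrier albert_Aut" using nz by (rule quat_inv_Aut)
  have "quat_inv a b c d \<circ> quat_inv a b c d = id"
    using nz by (simp add: fun_eq_iff quat_inv_involutive)
  moreover have "inner_aut (quat_inv a b c d) \<noteq> inner_aut id"
    using inner_aut_inject[OF two s id_Aut] quat_inv_neq_id[OF nz] by auto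
  ultimately show ?thesis
    using s by (simp add: k_involution_def carrier_AutoGroup inner_aut_auto one_AutoGroup mult_inner_aut)
qed

lemma gt_involutions_eq:
  assumes two: "(2::'k::field) \<noteq> 0"
  shows "gt_involutions TYPE('k) = {inner_aut (quat_inv a b c d) | a b c d. a \<noteq> 0 \<and> b \<noteq> 0 \<and> c \<noteq> 0 \<and> d \<noteq> 0}"
proof (intro equalityI subsetI)
  fix \<phi> :: "'k aut_map" assume "\<phi> \<in> gt_involutions TYPE('k)"
  then obtain u1 u2 v1 v2 where "u1 \<noteq> 0" "u2 \<noteq> 0" "v1 \<noteq> 0" "v2 \<noteq> 0" "\<phi> = inner_aut (g_elt \<circ> torus_elt u1 u2 v1 v2)"
    by (auto simp: gt_involutions_def)
  then have "\<phi> = inner_aut (quat_inv u1 (u2 / u1) v1 (v2 / v1))" "u2 / u1 \<noteq> 0" "v2 / v1 \<noteq> 0"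
    by (simp_all add: g_torus_eq_quat_inv)
  then show "\<phi> \<in> {inner_aut (quat_inv a b c d) | a b c d. a \<noteq> 0 \<and> b \<noteq> 0 \<and> c \<noteq> 0 \<and> d \<noteq> 0}"
    using \<open>u1 \<noteq> 0\<close> \<open>v1 \<noteq> 0\<close> by blast
next
  fix \<phi> :: "'k aut_map"
  assume "\<phi> \<in> {inner_aut (quat_inv a b c d) | a b c d. a \<noteq> 0 \<and> b \<noteq> 0 \<and> c \<noteq> 0 \<and> d \<noteq> 0}"
  then obtain a b c d where nz: "a \<noteq> 0" "b \<noteq> 0" "c \<noteq> 0" "d \<noteq> 0" and \<phi>: "\<phi> = inner_aut (quat_inv a b c d)"
    by blast
  have "a \<noteq> 0 \<and> a * b \<noteq> 0 \<and> c \<noteq> 0 \<and> c * d \<noteq> 0 \<and> type_I (g_elt \<circ> torus_elt a (a * b) c (c * d)) \<and>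
    \<phi> = inner_aut (g_elt \<circ> torus_elt a (a * b) c (c * d))"
    unfolding quat_inv_eq_g_torus[OF nz, symmetric] using two nz \<phi> by (simp add: type_I_quat_inv)
  moreover have "k_involution \<phi>" using k_involution_quat_inv[OF two nz] \<phi> by simp
  ultimately show "\<phi> \<in> gt_involutions TYPE('k)"
    unfolding gt_involutions_def mem_Collect_eq by blast
qed

definition quat_symbols :: "('k::field \<times> 'k \<times> 'k \<times> 'k) set" where
  "quat_symbols = {(a, b, c, d). a \<noteq> 0 \<and> b \<noteq> 0 \<and> c \<noteq> 0 \<and> d \<noteq> 0}"

definition symbol_inv :: "'k::field \<times> 'k \<times> 'k \<times> 'k \<Rightarrow> 'k albert \<Rightarrow> 'k albert" where
  "symbol_inv = (\<lambda>(a, b, c, d). quat_inv a b c d)"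

lemma symbol_inv_Aut: "q \<in> quat_symbols \<Longrightarrow> symbol_inv q \<in> carrier albert_Aut"
  by (auto simp: quat_symbols_def symbol_inv_def intro: quat_inv_Aut)

lemma gt_involutions_symbols:
  assumes two: "(2::'k::field) \<noteq> 0"
  shows "gt_involutions TYPE('k) = (\<lambda>q. inner_aut (symbol_inv q)) ` quat_symbols"
  unfolding gt_involutions_eq[OF two] quat_symbols_def symbol_inv_def image_def by auto

definition conj_rel :: "('k::field aut_map \<times> 'k aut_map) set" where
  "conj_rel = {(\<phi>, \<phi>'). \<phi> \<in> gt_involutions TYPE('k) \<and> \<phi>' \<in> gt_involutions TYPE('k) \<and> isomorphic_involutions \<phi> \<phi>'}"

lemma gt_classes_conj_rel: "gt_involution_classes TYPE('k::field) = gt_involutions TYPE('k) // conj_rel"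
  by (simp add: gt_involution_classes_def conj_rel_def)

lemma conj_rel_iff:
  fixes q r :: "'k::field \<times> 'k \<times> 'k \<times> 'k"
  assumes two: "(2::'k) \<noteq> 0" and "q \<in> quat_symbols" "r \<in> quat_symbols"
  shows "(inner_aut (symbol_inv q), inner_aut (symbol_inv r)) \<in> conj_rel \<longleftrightarrow> albert_conj (symbol_inv q) (symbol_inv r)"
  using assms isomorphic_inner_aut_iff[OF two symbol_inv_Aut symbol_inv_Aut]
  by (simp add: conj_rel_def gt_involutions_symbols)

lemma equiv_conj_rel:
  assumes two: "(2::'k::field) \<noteq> 0"
  shows "equiv (gt_involutions TYPE('k)) (conj_rel :: ('k aut_map \<times> 'k aut_map) set)"
proof (rule equivI)
  have el: "\<exists>q\<in>quat_symbols. \<phi> = inner_aut (symbol_inv q)" if "\<phi> \<in> gt_involutions TYPE('k)" for \<phi>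
    using that by (auto simp: gt_involutions_symbols[OF two])
  have rel: "\<exists>q\<in>quat_symbols. \<exists>r\<in>quat_symbols. \<phi> = inner_aut (symbol_inv q) \<and> \<psi> = inner_aut (symbol_inv r) \<and> albert_conj (symbol_inv q) (symbol_inv r)"
    if "(\<phi>, \<psi>) \<in> conj_rel" for \<phi> \<psi> :: "'k aut_map"
    using that conj_rel_iff[OF two] el unfolding conj_rel_def by blast
  note iff = conj_rel_iff[OF two]
  show "conj_rel \<subseteq> gt_involutions TYPE('k) \<times> gt_involutions TYPE('k)"
    by (auto simp: conj_rel_def)
  show "refl_on (gt_involutions TYPE('k)) conj_rel"
    using el iff albert_conj_refl unfolding refl_on_def by blast
  show "sym (conj_rel :: ('k aut_map \<times> 'k aut_map) set)"
  proof (rule symI)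
    fix \<phi> \<psi> :: "'k aut_map" assume 1: "(\<phi>, \<psi>) \<in> conj_rel"
    obtain q r where q: "q \<in> quat_symbols" "r \<in> quat_symbols" "\<phi> = inner_aut (symbol_inv q)" "\<psi> = inner_aut (symbol_inv r)"
      "albert_conj (symbol_inv q) (symbol_inv r)" using rel[OF 1] by blast
    then show "(\<psi>, \<phi>) \<in> conj_rel" using iff[OF q(2,1)] albert_conj_sym by blast
  qed
  show "trans (conj_rel :: ('k aut_map \<times> 'k aut_map) set)"
  proof (rule transI)
    fix \<phi> \<psi> \<rho> :: "'k aut_map" assume 1: "(\<phi>, \<psi>) \<in> conj_rel" and 2: "(\<psi>, \<rho>) \<in> conj_rel"
    obtain q r where q: "q \<in> quat_symbols" "r \<in> quat_symbols" "\<phi> = inner_aut (symbol_inv q)" "\<psi> = inner_aut (symbol_inv r)"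
      "albert_conj (symbol_inv q) (symbol_inv r)" using rel[OF 1] by blast
    obtain t where t: "t \<in> quat_symbols" "\<rho> = inner_aut (symbol_inv t)" using rel[OF 2] by blast
    have "albert_conj (symbol_inv r) (symbol_inv t)" using 2 iff[OF q(2) t(1)] q t by simp
    then show "(\<phi>, \<rho>) \<in> conj_rel" using albert_conj_trans q t iff by blast
  qed
qed

lemma card_quotient_eq_card_reps:
  assumes "equiv A r" "R \<subseteq> A" "\<And>x. x \<in> A \<Longrightarrow> \<exists>y\<in>R. (x, y) \<in> r"
    "\<And>x y. x \<in> R \<Longrightarrow> y \<in> R \<Longrightarrow> (x, y) \<in> r \<Longrightarrow> x = y"
  shows "card (A // r) = card R"
proof -
  have "A // r = (\<lambda>x. r `` {x}) ` R"
  proof (intro equalityI subsetI)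
    fix X assume "X \<in> A // r"
    then obtain x where x: "x \<in> A" "X = r `` {x}" by (auto simp: quotient_def)
    then obtain y where "y \<in> R" "(x, y) \<in> r" using assms(3) by blast
    then show "X \<in> (\<lambda>x. r `` {x}) ` R" using x equiv_class_eq[OF assms(1)] by blast
  qed (use assms(2) in \<open>auto simp: quotient_def\<close>)
  moreover have "inj_on (\<lambda>x. r `` {x}) R"
    by (rule inj_onI) (metis assms(1,2,4) eq_equiv_class_iff subsetD)
  ultimately show ?thesis by (simp add: card_image)
qed

text \<open>Counting classes amounts to giving a system of representatives for conjugacy of the
  elements \<open>quat_inv a b c d\<close>.\<close>

lemma card_gt_classes:
  fixes R :: "('k::field \<times> 'k \<times> 'k \<times> 'k) set"
  assumes two: "(2::'k) \<noteq> 0" and R: "R \<subseteq> quat_symbols"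
    and cover: "\<And>q. q \<in> quat_symbols \<Longrightarrow> \<exists>r\<in>R. albert_conj (symbol_inv q) (symbol_inv r)"
    and distinct: "\<And>q r. q \<in> R \<Longrightarrow> r \<in> R \<Longrightarrow> albert_conj (symbol_inv q) (symbol_inv r) \<Longrightarrow> q = r"
  shows "card (gt_involution_classes TYPE('k)) = card R"
proof -
  let ?f = "\<lambda>q. inner_aut (symbol_inv q)"
  note A = gt_involutions_symbols[OF two]
  note iso = conj_rel_iff[OF two]
  have "card (gt_involution_classes TYPE('k)) = card (?f ` R)"
    unfolding gt_classes_conj_rel
  proof (rule card_quotient_eq_card_reps[OF equiv_conj_rel[OF two]])
    show "?f ` R \<subseteq> gt_involutions TYPE('k)" unfolding A using R by blast
    show "\<exists>y\<in>?f ` R. (x, y) \<in> conj_rel" if "x \<in> gt_involutions TYPE('k)" for x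
    proof -
      obtain q where q: "q \<in> quat_symbols" "x = ?f q" using \<open>x \<in> _\<close> unfolding A by blast
      obtain r where r: "r \<in> R" "albert_conj (symbol_inv q) (symbol_inv r)" using cover[OF q(1)] by blast
      then have "(x, ?f r) \<in> conj_rel" using iso[of q r] q R by blast
      then show ?thesis using r by blast
    qed
    show "x = y" if "x \<in> ?f ` R" "y \<in> ?f ` R" "(x, y) \<in> conj_rel" for x y
    proof -
      obtain q r where q: "q \<in> R" "r \<in> R" "x = ?f q" "y = ?f r" using \<open>x \<in> _\<close> \<open>y \<in> _\<close> by blast
      then have "albert_conj (symbol_inv q) (symbol_inv r)"
        using iso[of q r] R \<open>(x, y) \<in> conj_rel\<close> by blast
      then show ?thesis using distinct q by blast
    qed
  qed
  also have "\<dots> = card R"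
  proof (rule card_image, rule inj_onI)
    fix q r assume q: "q \<in> R" "r \<in> R" "?f q = ?f r"
    have m: "q \<in> quat_symbols" "r \<in> quat_symbols" using q R by auto
    have "(?f q, ?f q) \<in> conj_rel" using iso[OF m(1) m(1)] albert_conj_refl by blast
    then have "(?f q, ?f r) \<in> conj_rel" using q(3) by simp
    then have "albert_conj (symbol_inv q) (symbol_inv r)" using iso[OF m] by simp
    then show "q = r" using q distinct by blast
  qed
  finally show ?thesis .
qed

lemma infinite_gt_classes:
  fixes R :: "('k::field \<times> 'k \<times> 'k \<times> 'k) set"
  assumes two: "(2::'k) \<noteq> 0" and R: "R \<subseteq> quat_symbols" "infinite R"
    and distinct: "\<And>q r. q \<in> R \<Longrightarrow> r \<in> R \<Longrightarrow> albert_conj (symbol_inv q) (symbol_inv r) \<Longrightarrow> q = r"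
  shows "infinite (gt_involution_classes TYPE('k))"
proof
  assume fin: "finite (gt_involution_classes TYPE('k))"
  let ?f = "\<lambda>q. conj_rel `` {inner_aut (symbol_inv q)}"
  note A = gt_involutions_symbols[OF two]
  have "?f ` R \<subseteq> gt_involution_classes TYPE('k)"
    unfolding gt_classes_conj_rel A quotient_def using R(1) by blast
  moreover have "inj_on ?f R"
  proof (rule inj_onI)
    fix q r assume q: "q \<in> R" "r \<in> R" "?f q = ?f r"
    then have "(inner_aut (symbol_inv q), inner_aut (symbol_inv r)) \<in> conj_rel"
      using eq_equiv_class_iff[OF equiv_conj_rel[OF two], of "inner_aut (symbol_inv q)" "inner_aut (symbol_inv r)"] R(1)
      unfolding A by blast
    then have "albert_conj (symbol_inv q) (symbol_inv r)"
      using q R(1) conj_rel_iff[OF two] by blast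
    then show "q = r" using q distinct by blast
  qed
  ultimately show False using fin R(2) by (meson finite_imageD finite_subset)
qed

section \<open>The quaternion algebra as a centralizer\<close>

text \<open>In \<open>H\<^sub>3(C) = H\<^sub>3(D) \<oplus> D\<^sup>3\<close> the fixed subalgebra \<open>H\<^sub>3(D)\<close> acts on the \<open>-1\<close>-eigenspace \<open>D\<^sup>3\<close>, essentially by left
  multiplication with hermitian matrices.\<close>

definition skew_part :: "('k::field albert \<Rightarrow> 'k albert) \<Rightarrow> 'k albert set" where
  "skew_part s = {w. s w = - w}"

text \<open>The centralizer of this action consists of the right multiplications with elements of
  \<open>D\<close>. It is therefore a copy of \<open>D\<close> (or its opposite) which is defined by the involution alone.\<close>

definition centralizing :: "('k::field albert \<Rightarrow> 'k albert) \<Rightarrow> ('k albert \<Rightarrow> 'k albert) \<Rightarrow> bool" where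
  "centralizing s E \<longleftrightarrow>
    (\<forall>w\<in>skew_part s. E w \<in> skew_part s) \<and>
    (\<forall>w\<in>skew_part s. \<forall>w'\<in>skew_part s. E (w + w') = E w + E w') \<and>
    (\<forall>t. \<forall>w\<in>skew_part s. E (albert_scale t w) = albert_scale t (E w)) \<and>
    (\<forall>x\<in>fixed_subalgebra s. \<forall>w\<in>skew_part s. E (albert_mult x w) = albert_mult x (E w))"

text \<open>The quaternions \<open>e \<notin> k\<close> with \<open>e\<^sup>2 = \<mu>\<close> are pure of norm \<open>-\<mu>\<close>. So the set of these \<open>\<mu>\<close> is the set
  of negatives of values of the norm form on pure quaternions, an invariant of the conjugacy class.\<close>

definition has_sqrt :: "('k::field albert \<Rightarrow> 'k albert) \<Rightarrow> 'k \<Rightarrow> bool" where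
  "has_sqrt s \<mu> \<longleftrightarrow> (\<exists>E. centralizing s E \<and> (\<forall>w\<in>skew_part s. E (E w) = albert_scale \<mu> w) \<and>
     \<not> (\<exists>t. \<forall>w\<in>skew_part s. E w = albert_scale t w))"

lemma has_sqrt_conj:
  assumes "albert_conj s t" "has_sqrt s \<mu>"
  shows "has_sqrt t \<mu>"
proof -
  obtain h where h: "h \<in> carrier albert_Aut" and ht: "s \<circ> h = h \<circ> t"
    using assms(1) by (auto simp: albert_conj_def)
  let ?k = "inv_into UNIV h"
  have k: "?k \<in> carrier albert_Aut" by (rule inv_Aut[OF h])
  have hk: "h (?k x) = x" "?k (h x) = x" for x using Aut_inv_comp[OF h] by (simp_all add: fun_eq_iff)
  have lin: "h (x + y) = h x + h y" "h (albert_scale c x) = albert_scale c (h x)" "h (albert_mult x y) = albert_mult (h x) (h y)"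
    "?k (x + y) = ?k x + ?k y" "?k (albert_scale c x) = albert_scale c (?k x)" "?k (albert_mult x y) = albert_mult (?k x) (?k y)" for x y c
    using h k by (simp_all add: mem_albert_Aut)
  have sh: "s (h x) = h (t x)" for x using ht by (simp add: fun_eq_iff)
  have tk: "t (?k x) = ?k (s x)" for x by (metis hk sh)
  have F: "h x \<in> fixed_subalgebra s" if "x \<in> fixed_subalgebra t" for x
    using that by (simp add: fixed_subalgebra_def sh)
  have W: "h x \<in> skew_part s" if "x \<in> skew_part t" for x
    using that by (simp add: skew_part_def sh Aut_uminus[OF h])
  have W': "?k x \<in> skew_part t" if "x \<in> skew_part s" for x
    using that by (simp add: skew_part_def tk Aut_uminus[OF k])
  obtain E where E: "centralizing s E" "\<And>w. w \<in> skew_part s \<Longrightarrow> E (E w) = albert_scale \<mu> w"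
     "\<not> (\<exists>t. \<forall>w\<in>skew_part s. E w = albert_scale t w)" using assms(2) by (auto simp: has_sqrt_def)
  have E1: "w \<in> skew_part s \<Longrightarrow> E w \<in> skew_part s"
     "w \<in> skew_part s \<Longrightarrow> w' \<in> skew_part s \<Longrightarrow> E (w + w') = E w + E w'"
     "w \<in> skew_part s \<Longrightarrow> E (albert_scale c w) = albert_scale c (E w)"
     "x \<in> fixed_subalgebra s \<Longrightarrow> w \<in> skew_part s \<Longrightarrow> E (albert_mult x w) = albert_mult x (E w)" for w w' c x
    using E(1) by (auto simp: centralizing_def)
  let ?E = "\<lambda>w. ?k (E (h w))"
  have "centralizing t ?E"
    unfolding centralizing_def by (auto simp: W W' F E1 lin hk(2))
  moreover have "?E (?E w) = albert_scale \<mu> w" if "w \<in> skew_part t" for w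
    using that by (simp add: hk W E(2) lin)
  moreover have "\<not> (\<exists>c. \<forall>w\<in>skew_part t. ?E w = albert_scale c w)"
  proof
    assume "\<exists>c. \<forall>w\<in>skew_part t. ?E w = albert_scale c w"
    then obtain c where c: "\<And>w. w \<in> skew_part t \<Longrightarrow> ?E w = albert_scale c w" by blast
    have "E w = albert_scale c w" if "w \<in> skew_part s" for w
    proof -
      have "h (?E (?k w)) = h (albert_scale c (?k w))" using c W' that by simp
      then show ?thesis by (simp add: hk lin)
    qed
    then show False using E(3) by blast
  qed
  ultimately show ?thesis unfolding has_sqrt_def by blast
qed

lemma albert_mult_scale_right: "albert_mult x (albert_scale t w) = albert_scale t (albert_mult x w)"
  by (cases x rule: albert_cases; cases w rule: albert_cases)
    (simp add: albert_mult_eq Let_def one_mat33 albert_scale_def; simp add: algebra_simps)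

lemma fixed_mult_skew:
  assumes s: "s \<in> carrier albert_Aut" and "x \<in> fixed_subalgebra s" "w \<in> skew_part s"
  shows "albert_mult x w \<in> skew_part s"
  using assms albert_mult_scale_right[of x "-1" w]
  by (simp add: mem_albert_Aut fixed_subalgebra_def skew_part_def albert_scale_m1)

context
  fixes a b c d :: "'k::field"
  assumes two: "(2::'k) \<noteq> 0" and nz: "a \<noteq> 0" "b \<noteq> 0" "c \<noteq> 0" "d \<noteq> 0"
begin

definition skew_elt :: "'k \<Rightarrow> 'k \<Rightarrow> 'k \<Rightarrow> 'k^3^3 \<Rightarrow> 'k albert" where
  "skew_elt p q r B =
    (mat33 0 (b * r) (- q / (a * b)) (- a * r) 0 (p / (a * b)) (a * q) (- b * p) 0, B,
     mat33 (- a / c * B$1$1) (- b / c * B$2$1) (- B$3$1 / (a * b * c))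
           (- a / d * B$1$2) (- b / d * B$2$2) (- B$3$2 / (a * b * d))
           (- a * (c * d) * B$1$3) (- b * (c * d) * B$2$3) (- c * d / (a * b) * B$3$3))"

definition sym_elt :: "'k \<Rightarrow> 'k \<Rightarrow> 'k \<Rightarrow> 'k \<Rightarrow> 'k \<Rightarrow> 'k \<Rightarrow> 'k^3^3 \<Rightarrow> 'k albert" where
  "sym_elt x y z p q r B =
    (mat33 x (b * r) (q / (a * b)) (a * r) y (p / (a * b)) (a * q) (b * p) z, B,
     mat33 (a / c * B$1$1) (b / c * B$2$1) (B$3$1 / (a * b * c))
           (a / d * B$1$2) (b / d * B$2$2) (B$3$2 / (a * b * d))
           (a * (c * d) * B$1$3) (b * (c * d) * B$2$3) (c * d / (a * b) * B$3$3))"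

lemma mem_skew_quat_inv:
  "(mat33 a11 a12 a13 a21 a22 a23 a31 a32 a33, mat33 b11 b12 b13 b21 b22 b23 b31 b32 b33,
          mat33 c11 c12 c13 c21 c22 c23 c31 c32 c33) \<in> skew_part (quat_inv a b c d) \<longleftrightarrow>
     a11 = 0 \<and> a22 = 0 \<and> a33 = 0 \<and> a21 = - a / b * a12 \<and> a13 = - a31 / (a * (a * b)) \<and> a32 = - (b * (a * b)) * a23 \<and>
     c11 = - a / c * b11 \<and> c12 = - b / c * b21 \<and> c13 = - b31 / (a * b * c) \<and>
     c21 = - a / d * b12 \<and> c22 = - b / d * b22 \<and> c23 = - b32 / (a * b * d) \<and>
     c31 = - a * (c * d) * b13 \<and> c32 = - b * (c * d) * b23 \<and> c33 = - (c * d) / (a * b) * b33"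
proof -
  have neg: "y = - x \<longleftrightarrow> x = - y" "x = - x \<longleftrightarrow> x = 0" for x y :: 'k
    using two by (metis add.inverse_inverse, metis add_eq_0_iff2 mult_2 mult_eq_0_iff neg_0_equal_iff_equal)
  show ?thesis
    using nz by (simp add: skew_part_def quat_inv_def diag_inv_mat33 neg(2)) (auto simp: field_simps)
qed

lemma skew_part_quat_inv: "skew_part (quat_inv a b c d) = {skew_elt p q r B | p q r B. True}"
proof (intro equalityI subsetI)
  fix w assume w: "w \<in> skew_part (quat_inv a b c d)"
  show "w \<in> {skew_elt p q r B | p q r B. True}"
  proof (cases w rule: albert_cases)
    case (albert a11 a12 a13 a21 a22 a23 a31 a32 a33 b11 b12 b13 b21 b22 b23 b31 b32 b33 c11 c12 c13 c21 c22 c23 c31 c32 c33)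
    have "w = skew_elt (a * b * a23) (a31 / a) (a12 / b) (mat33 b11 b12 b13 b21 b22 b23 b31 b32 b33)"
      using w nz unfolding albert mem_skew_quat_inv
      by (elim conjE) (simp add: skew_elt_def field_simps)
    then show ?thesis by blast
  qed
next
  fix w assume "w \<in> {skew_elt p q r B | p q r B. True}"
  then obtain p q r B where w: "w = skew_elt p q r B" by blast
  show "w \<in> skew_part (quat_inv a b c d)"
    using nz by (cases B rule: mat33_cases)
      (simp add: w skew_part_def quat_inv_def diag_inv_mat33 skew_elt_def field_simps)
qed

lemma skew_elt_mem: "skew_elt p q r B \<in> skew_part (quat_inv a b c d)"
  unfolding skew_part_quat_inv by blast

lemma sym_elt_mem: "sym_elt x y z p q r B \<in> fixed_subalgebra (quat_inv a b c d)"
  using nz by (cases B rule: mat33_cases) (simp add: sym_elt_def mem_fixed_quat_inv field_simps)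

lemma fixed_cases:
  assumes "x \<in> fixed_subalgebra (quat_inv a b c d)"
  obtains x1 x2 x3 p q r B where "x = sym_elt x1 x2 x3 p q r B"
proof (cases x rule: albert_cases)
  case (albert a11 a12 a13 a21 a22 a23 a31 a32 a33 b11 b12 b13 b21 b22 b23 b31 b32 b33 c11 c12 c13 c21 c22 c23 c31 c32 c33)
  have "x = sym_elt a11 a22 a33 (a32 / b) (a31 / a) (a12 / b) (mat33 b11 b12 b13 b21 b22 b23 b31 b32 b33)"
    using assms nz by (simp add: albert mem_fixed_quat_inv sym_elt_def field_simps)
  then show ?thesis by (rule that)
qed

text \<open>Right multiplication with a pure quaternion \<open>i\<close> with \<open>i\<^sup>2 = -c\<close>, when the entry \<open>p\<close>, \<open>q\<close> or \<open>r\<close> of a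
  skew element and the corresponding row of \<open>B\<close> are read as the real and pure part of a
  quaternion.\<close>

definition right_i :: "'k albert \<Rightarrow> 'k albert" where
  "right_i = (\<lambda>(A, B, C). 
     skew_elt (- a * B$1$1) (- b * B$2$1) (- B$3$1 / (a * b))
      (mat33 (b * c * A$2$3) (c * d * B$1$3) (- B$1$2 / d)
             (c / (a * b) * A$3$1) (c * d * B$2$3) (- B$2$2 / d)
             (a * c * A$1$2) (c * d * B$3$3) (- B$3$2 / d)))"

lemma right_i_skew:
  "right_i (skew_elt p q r B) = skew_elt (- a * B$1$1) (- b * B$2$1) (- B$3$1 / (a * b))
    (mat33 (c / a * p) (c * d * B$1$3) (- B$1$2 / d) (c / b * q) (c * d * B$2$3) (- B$2$2 / d)
           (a * b * c * r) (c * d * B$3$3) (- B$3$2 / d))"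
  using nz by (simp add: right_i_def skew_elt_def)

lemma has_sqrt_minus_c: "has_sqrt (quat_inv a b c d) (- c)"
  unfolding has_sqrt_def
proof (intro exI conjI ballI)
  show "centralizing (quat_inv a b c d) right_i"
    unfolding centralizing_def
  proof (intro conjI ballI allI)
    fix w assume "w \<in> skew_part (quat_inv a b c d)"
    then obtain p q r B where w: "w = skew_elt p q r B" unfolding skew_part_quat_inv by blast
    show "right_i w \<in> skew_part (quat_inv a b c d)" by (simp add: w right_i_skew skew_elt_mem)
    show "right_i (albert_scale t w) = albert_scale t (right_i w)" for t
      by (cases B rule: mat33_cases) (simp add: w right_i_def skew_elt_def albert_scale_def algebra_simps)
    show "right_i (w + w') = right_i w + right_i w'" if "w' \<in> skew_part (quat_inv a b c d)" for w'
      using nz by (cases w rule: albert_cases; cases w' rule: albert_cases) (simp add: right_i_def skew_elt_def; simp add: field_simps)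
    show "right_i (albert_mult x w) = albert_mult x (right_i w)" if x: "x \<in> fixed_subalgebra (quat_inv a b c d)" for x
    proof -
      obtain x1 x2 x3 p' q' r' B' where "x = sym_elt x1 x2 x3 p' q' r' B'" using x by (rule fixed_cases)
      then show ?thesis
        using nz two unfolding w right_i_skew
        apply (cases B rule: mat33_cases; cases B' rule: mat33_cases)
        apply (simp add: right_i_def skew_elt_def sym_elt_def albert_mult_eq one_mat33 Let_def)
        apply (intro conjI)
        apply (simp_all add: field_simps)
        done
    qed
  qed
  show "right_i (right_i w) = albert_scale (- c) w" if skew: "w \<in> skew_part (quat_inv a b c d)" for w
  proof -
    obtain p q r B where w: "w = skew_elt p q r B" using skew unfolding skew_part_quat_inv by blast
    show ?thesis unfolding w right_i_skew using nz
      by (cases B rule: mat33_cases) (simp add: skew_elt_def albert_scale_def; simp add: field_simps)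
  qed
  show "\<not> (\<exists>t. \<forall>w\<in>skew_part (quat_inv a b c d). right_i w = albert_scale t w)"
  proof
    assume "\<exists>t. \<forall>w\<in>skew_part (quat_inv a b c d). right_i w = albert_scale t w"
    then obtain t where "right_i (skew_elt 1 0 0 0) = albert_scale t (skew_elt 1 0 0 0)" using skew_elt_mem by blast
    then show False unfolding right_i_skew using nz
      by (simp add: skew_elt_def albert_scale_def zero_mat33)
  qed
qed


abbreviation row1 :: "'k \<Rightarrow> 'k \<Rightarrow> 'k \<Rightarrow> 'k \<Rightarrow> 'k albert" where
  "row1 p x y z \<equiv> skew_elt p 0 0 (mat33 x y z 0 0 0 0 0 0)"

lemma idempotent_mult_skew:
  "albert_mult (sym_elt 1 0 0 0 0 0 0) (skew_elt p q r B) =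
    albert_scale (1 / 2) (skew_elt 0 q r (mat33 0 0 0 (B$2$1) (B$2$2) (B$2$3) (B$3$1) (B$3$2) (B$3$3)))"
  using nz two by (cases B rule: mat33_cases)
    (simp add: sym_elt_def skew_elt_def albert_mult_eq one_mat33 zero_mat33 Let_def albert_scale_def)

lemma unit3_mult_row1:
  "albert_mult (sym_elt 0 0 0 0 0 1 0) (row1 p x y z) =
    skew_elt 0 (- b / 2 * p) 0 (mat33 0 0 0 (- a / 2 * x) (- a / 2 * y) (- a / 2 * z) 0 0 0)"
  using nz two by (simp add: sym_elt_def skew_elt_def albert_mult_eq one_mat33 zero_mat33 Let_def; simp add: field_simps)

lemma unit2_mult_row1:
  "albert_mult (sym_elt 0 0 0 0 1 0 0) (row1 p x y z) =
    skew_elt 0 0 (- p / (2 * a * b)) (mat33 0 0 0 0 0 0 (- a / 2 * x) (- a / 2 * y) (- a / 2 * z))"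
  using nz two by (simp add: sym_elt_def skew_elt_def albert_mult_eq one_mat33 zero_mat33 Let_def; simp add: field_simps)

text \<open>Multiplying by \<open>left_quat p x y z\<close>, and then by a fixed element that returns to the first row, is
  left multiplication with the quaternion \<open>(p; x, y, z)\<close> on the quaternions \<open>row1\<close>. It maps \<open>1\<close> to
  that quaternion and the quaternion to its square.\<close>

abbreviation left_quat :: "'k \<Rightarrow> 'k \<Rightarrow> 'k \<Rightarrow> 'k \<Rightarrow> 'k albert" where
  "left_quat p x y z \<equiv> sym_elt 0 0 0 0 0 (4 * p / (a * b)) (mat33 0 0 0 0 0 0 (4 * a * x) (4 * a * y) (4 * a * z))"

lemma left_quat_mult:
  "albert_mult (sym_elt 0 0 0 0 0 1 0) (albert_mult (left_quat p x y z) (row1 1 0 0 0)) = row1 p x y z"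
  "albert_mult (sym_elt 0 0 0 0 0 1 0) (albert_mult (left_quat p x y z) (row1 p x y z)) =
     row1 (p\<^sup>2 - a\<^sup>2 * (x\<^sup>2 / c + y\<^sup>2 / d + c * d * z\<^sup>2)) (2 * p * x) (2 * p * y) (2 * p * z)"
proof -
  have "(4::'k) \<noteq> 0" using two by (metis mult_2 mult_eq_0_iff numeral_Bit0)
  then show "albert_mult (sym_elt 0 0 0 0 0 1 0) (albert_mult (left_quat p x y z) (row1 1 0 0 0)) = row1 p x y z"
    "albert_mult (sym_elt 0 0 0 0 0 1 0) (albert_mult (left_quat p x y z) (row1 p x y z)) =
     row1 (p\<^sup>2 - a\<^sup>2 * (x\<^sup>2 / c + y\<^sup>2 / d + c * d * z\<^sup>2)) (2 * p * x) (2 * p * y) (2 * p * z)"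
    using nz two
    by (simp_all add: sym_elt_def skew_elt_def albert_mult_eq one_mat33 zero_mat33 Let_def)
     (simp_all add: field_simps power2_eq_square)
qed

lemma row1_eq_iff: "row1 p x y z = row1 p' x' y' z' \<longleftrightarrow> p = p' \<and> x = x' \<and> y = y' \<and> z = z'"
  using nz by (auto simp: skew_elt_def)

text \<open>An operator \<open>E\<close> of the centralizer maps \<open>1 = row1 1 0 0 0\<close> to a quaternion \<open>e\<close>, since it commutes with
  the idempotent that cuts out the first row. It also commutes with left multiplication by \<open>e\<close>, so
  \<open>\<mu> = E (E 1) = e\<^sup>2\<close>. Hence \<open>e\<close> is a scalar or pure. If \<open>e\<close> is a scalar, then so is \<open>E\<close>, because \<open>1\<close>
  generates the \<open>-1\<close>-eigenspace under the fixed subalgebra.\<close>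

lemma has_sqrt_imp_represented:
  assumes "has_sqrt (quat_inv a b c d) \<mu>"
  shows "\<exists>x y z. \<mu> = - (c * x\<^sup>2 + d * y\<^sup>2 + inverse (c * d) * z\<^sup>2)"
proof -
  let ?s = "quat_inv a b c d"
  obtain E where E: "centralizing ?s E" and sq: "\<And>w. w \<in> skew_part ?s \<Longrightarrow> E (E w) = albert_scale \<mu> w"
     and ns: "\<not> (\<exists>t. \<forall>w\<in>skew_part ?s. E w = albert_scale t w)"
    using assms by (auto simp: has_sqrt_def)
  have Es: "w \<in> skew_part ?s \<Longrightarrow> E w \<in> skew_part ?s"
     "w \<in> skew_part ?s \<Longrightarrow> w' \<in> skew_part ?s \<Longrightarrow> E (w + w') = E w + E w'"
     "w \<in> skew_part ?s \<Longrightarrow> E (albert_scale t w) = albert_scale t (E w)"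
     "x \<in> fixed_subalgebra ?s \<Longrightarrow> w \<in> skew_part ?s \<Longrightarrow> E (albert_mult x w) = albert_mult x (E w)" for w w' t x
    using E by (auto simp: centralizing_def)
  have Em: "E (albert_mult (sym_elt x1 x2 x3 p q r B) (skew_elt p' q' r' B')) = albert_mult (sym_elt x1 x2 x3 p q r B) (E (skew_elt p' q' r' B'))"
    for x1 x2 x3 p q r B p' q' r' B' by (intro Es sym_elt_mem skew_elt_mem)
  have zero: "skew_elt 0 0 0 (mat33 0 0 0 0 0 0 0 0 0) = 0" by (simp add: skew_elt_def zero_mat33 zero_prod_def)
  have scale_0: "albert_scale 0 w = 0" for w :: "'k albert"
    by (cases w rule: albert_cases) (simp add: albert_scale_def zero_mat33 zero_prod_def)
  have E0: "E 0 = 0" using Es(3)[OF skew_elt_mem, of 0] by (simp add: scale_0)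
  have "E (row1 1 0 0 0) \<in> skew_part ?s" by (intro Es skew_elt_mem)
  then obtain p q r B where w1: "E (row1 1 0 0 0) = skew_elt p q r B" unfolding skew_part_quat_inv by blast
  have "albert_mult (sym_elt 1 0 0 0 0 0 0) (skew_elt p q r B) = E (albert_mult (sym_elt 1 0 0 0 0 0 0) (row1 1 0 0 0))"
    by (simp only: Em w1)
  also have "\<dots> = 0" by (simp only: idempotent_mult_skew mat33_nth zero E0) (simp add: E0 albert.scale_zero_right)
  finally have z: "albert_scale (1 / 2) (skew_elt 0 q r (mat33 0 0 0 (B$2$1) (B$2$2) (B$2$3) (B$3$1) (B$3$2) (B$3$3))) = 0"
    by (simp only: idempotent_mult_skew)
  obtain x y z where w1: "E (row1 1 0 0 0) = row1 p x y z"
    using z nz two by (cases B rule: mat33_cases) (simp add: w1, simp add: skew_elt_def zero_mat33 zero_prod_def albert_scale_def)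
  have "row1 \<mu> 0 0 0 = albert_scale \<mu> (row1 1 0 0 0)"
    by (simp add: skew_elt_def albert_scale_def)
  also have "\<dots> = E (row1 p x y z)" by (simp only: sq[OF skew_elt_mem, symmetric] w1)
  also have "\<dots> = albert_mult (sym_elt 0 0 0 0 0 1 0) (albert_mult (left_quat p x y z) (E (row1 1 0 0 0)))"
  proof -
    have "albert_mult (left_quat p x y z) (row1 1 0 0 0) \<in> skew_part ?s"
      by (rule fixed_mult_skew[OF quat_inv_Aut[OF nz] sym_elt_mem skew_elt_mem])
    then show ?thesis
      by (subst left_quat_mult(1)[symmetric]) (simp only: Es(4)[OF sym_elt_mem] Em)
  qed
  finally have "p\<^sup>2 - a\<^sup>2 * (x\<^sup>2 / c + y\<^sup>2 / d + c * d * z\<^sup>2) = \<mu>" "2 * p * x = 0" "2 * p * y = 0" "2 * p * z = 0"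
    unfolding w1 left_quat_mult row1_eq_iff by auto
  note eqs = this
  have "p = 0"
  proof (rule ccontr)
    assume "p \<noteq> 0"
    then have "x = 0" "y = 0" "z = 0" using eqs two by simp_all
    then have w1: "E (row1 1 0 0 0) = albert_scale p (row1 1 0 0 0)"
      using w1 by (simp add: skew_elt_def albert_scale_def)
    have mult: "E (albert_mult x w) = albert_scale p (albert_mult x w) \<and> albert_mult x w \<in> skew_part ?s"
       if "x \<in> fixed_subalgebra ?s" "w \<in> skew_part ?s" "E w = albert_scale p w" for x w
      using that Es(4)[OF that(1,2)] fixed_mult_skew[OF quat_inv_Aut[OF nz] that(1,2)] by (simp add: albert_mult_scale_right)
    have r1: "E (row1 t x y z) = albert_scale p (row1 t x y z)" for t x y z
      using mult[OF sym_elt_mem conjunct2[OF mult[OF sym_elt_mem skew_elt_mem w1]]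
           conjunct1[OF mult[OF sym_elt_mem skew_elt_mem w1]], of 0 0 0 0 0 1 0 0 0 0 0 0 "4 * t / (a * b)" "mat33 0 0 0 0 0 0 (4 * a * x) (4 * a * y) (4 * a * z)"]
      unfolding left_quat_mult by blast
    have "E w = albert_scale p w" if skew: "w \<in> skew_part ?s" for w
    proof -
      obtain o1 o2 o3 b11 b12 b13 b21 b22 b23 b31 b32 b33 where w: "w = skew_elt o1 o2 o3 (mat33 b11 b12 b13 b21 b22 b23 b31 b32 b33)"
        using skew unfolding skew_part_quat_inv mem_Collect_eq by (metis mat33_cases)
      let ?w2 = "albert_mult (sym_elt 0 0 0 0 0 1 0) (row1 (- 2 / b * o2) (- 2 / a * b21) (- 2 / a * b22) (- 2 / a * b23))"
      let ?w3 = "albert_mult (sym_elt 0 0 0 0 1 0 0) (row1 (- 2 * a * b * o3) (- 2 / a * b31) (- 2 / a * b32) (- 2 / a * b33))"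
      have "w = (row1 o1 b11 b12 b13 + ?w2) + ?w3"
        using nz two unfolding unit2_mult_row1 unit3_mult_row1 w by (simp add: skew_elt_def field_simps)
      moreover have "E (row1 o1 b11 b12 b13 + ?w2 + ?w3) = albert_scale p (row1 o1 b11 b12 b13 + ?w2 + ?w3)"
      proof -
        have w2: "?w2 \<in> skew_part ?s" "E ?w2 = albert_scale p ?w2" using mult[OF sym_elt_mem skew_elt_mem r1] by blast+
        have w3: "?w3 \<in> skew_part ?s" "E ?w3 = albert_scale p ?w3" using mult[OF sym_elt_mem skew_elt_mem r1] by blast+
        have add: "u + v \<in> skew_part ?s \<and> E (u + v) = albert_scale p (u + v)"
          if "u \<in> skew_part ?s" "E u = albert_scale p u" "v \<in> skew_part ?s" "E v = albert_scale p v" for u v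
        proof
          show "u + v \<in> skew_part ?s"
            using that quat_inv_Aut[OF nz] unfolding skew_part_def by (simp add: mem_albert_Aut)
          show "E (u + v) = albert_scale p (u + v)" using that by (simp add: Es(2) albert.scale_right_distrib)
        qed
        show ?thesis using add[OF conjunct1 conjunct2 w3, OF add add, OF skew_elt_mem r1 w2 skew_elt_mem r1 w2] by blast
      qed
      ultimately show ?thesis by simp
    qed
    then show False using ns by blast
  qed
  then have "\<mu> = - (c * (a * x / c)\<^sup>2 + d * (a * y / d)\<^sup>2 + inverse (c * d) * (a * c * d * z)\<^sup>2)"
    using eqs(1) nz by (simp add: field_simps power2_eq_square)
  then show ?thesis by blast
qed

end

section \<open>Norms and quaternion symbols\<close>

text \<open>For a nonsquare \<open>x\<close> the nonzero \<open>y\<close> with this property are the norms from \<open>k(\<surd>x)\<close>; the relation is the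
  vanishing of the quaternion symbol \<open>(x, y)\<close>.\<close>

definition norm_of :: "'k::field \<Rightarrow> 'k \<Rightarrow> bool" where
  "norm_of x y \<longleftrightarrow> (\<exists>s t. y = s\<^sup>2 - x * t\<^sup>2)"

lemma norm_of_square: "norm_of x (w\<^sup>2)"
  unfolding norm_of_def by (intro exI[of _ w] exI[of _ 0]) simp

lemma norm_of_neg: "norm_of x (- x)"
  unfolding norm_of_def by (intro exI[of _ 0] exI[of _ 1]) simp

lemma norm_of_mult: "norm_of x y \<Longrightarrow> norm_of x z \<Longrightarrow> norm_of x (y * z)"
proof -
  assume "norm_of x y" "norm_of x z"
  then obtain s t u v where yz: "y = s\<^sup>2 - x * t\<^sup>2" "z = u\<^sup>2 - x * v\<^sup>2" by (auto simp: norm_of_def)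
  have "y * z = (s * u + x * t * v)\<^sup>2 - x * (s * v + t * u)\<^sup>2"
    unfolding yz by (simp add: power2_eq_square algebra_simps)
  then show ?thesis unfolding norm_of_def by blast
qed

lemma norm_of_cancel:
  assumes "norm_of x (y * z)" "norm_of x y" "y \<noteq> 0" shows "norm_of x z"
proof -
  have "norm_of x (y * z * y * (inverse y)\<^sup>2)"
    by (rule norm_of_mult[OF norm_of_mult[OF assms(1,2)] norm_of_square])
  also have "y * z * y * (inverse y)\<^sup>2 = z" using assms(3) by (simp add: power2_eq_square field_simps)
  finally show ?thesis .
qed

text \<open>The form \<open>s\<^sup>2 - w\<^sup>2 t\<^sup>2\<close> is hyperbolic.\<close>

lemma norm_of_square_universal:
  fixes w :: "'k::field"
  assumes "(2::'k) \<noteq> 0" "w \<noteq> 0" shows "norm_of (w\<^sup>2) y"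
proof -
  define h where "h = inverse (2::'k)"
  have h: "2 * h = 1" using assms(1) by (simp add: h_def)
  have "((y + 1) * h)\<^sup>2 - ((y - 1) * h)\<^sup>2 = (2 * h) * (2 * h) * y"
    by (simp add: power2_eq_square algebra_simps)
  also have "(y - 1) * h = w * ((y - 1) * h / w)" using assms(2) by simp
  finally have "y = ((y + 1) * h)\<^sup>2 - w\<^sup>2 * ((y - 1) * h / w)\<^sup>2"
    by (simp only: h power_mult_distrib) simp
  then show ?thesis unfolding norm_of_def by blast
qed

lemma norm_of_sym:
  fixes x y :: "'k::field"
  assumes "(2::'k) \<noteq> 0" "x \<noteq> 0" "y \<noteq> 0" "norm_of x y"
  shows "norm_of y x"
proof -
  obtain s t where y: "y = s\<^sup>2 - x * t\<^sup>2" using assms by (auto simp: norm_of_def)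
  show ?thesis
  proof (cases "t = 0")
    case True
    then show ?thesis using norm_of_square_universal[of s x] assms y by auto
  next
    case False
    then have "x = (s / t)\<^sup>2 - y * (1 / t)\<^sup>2" using y by (simp add: field_simps power2_eq_square)
    then show ?thesis unfolding norm_of_def by blast
  qed
qed

context
  fixes a b c d :: "'k::field"
  assumes nz: "a \<noteq> 0" "b \<noteq> 0" "c \<noteq> 0" "d \<noteq> 0"
begin

text \<open>The values of \<open>\<langle>1, c\<rangle>\<close> and the squares may be moved into \<open>d\<close>, and \<open>d' = d (d d') d\<^sup>-\<^sup>2\<close>.\<close>

lemma quat_inv_change_d:
  assumes "norm_of (- c) (d * d')" "d' \<noteq> 0"
  shows "albert_conj (quat_inv a b c d) (quat_inv a b c d')"
proof -
  obtain s t where n: "d * d' = s\<^sup>2 + c * t\<^sup>2" using assms by (auto simp: norm_of_def)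
  have "albert_conj (quat_inv a b c d) (quat_inv a b c (d * (s\<^sup>2 + c * t\<^sup>2)))"
    using nz assms(2) by (intro quat_inv_norm_right) (auto simp flip: n)
  also have "albert_conj \<dots> (quat_inv (a * 1\<^sup>2) (b * 1\<^sup>2) (c * 1\<^sup>2) (d * (s\<^sup>2 + c * t\<^sup>2) * (inverse d)\<^sup>2))"
    using nz assms(2) by (intro quat_inv_squares) (auto simp flip: n)
  also have "d * (s\<^sup>2 + c * t\<^sup>2) * (inverse d)\<^sup>2 = d'" using nz unfolding n[symmetric] by (simp add: power2_eq_square field_simps)
  finally show ?thesis by simp
qed

lemma quat_inv_change_b_cross:
  assumes "norm_of (- c) (b * b')" "b' \<noteq> 0"
  shows "albert_conj (quat_inv a b c d) (quat_inv a b' c d)"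
proof -
  obtain s t where n: "b * b' = s\<^sup>2 + c * t\<^sup>2" using assms by (auto simp: norm_of_def)
  have "albert_conj (quat_inv a b c d) (quat_inv a (b * (s\<^sup>2 + c * t\<^sup>2)) c d)"
    using nz assms(2) by (intro quat_inv_norm_cross) (auto simp flip: n)
  also have "albert_conj \<dots> (quat_inv (a * 1\<^sup>2) (b * (s\<^sup>2 + c * t\<^sup>2) * (inverse b)\<^sup>2) (c * 1\<^sup>2) (d * 1\<^sup>2))"
    using nz assms(2) by (intro quat_inv_squares) (auto simp flip: n)
  also have "b * (s\<^sup>2 + c * t\<^sup>2) * (inverse b)\<^sup>2 = b'" using nz unfolding n[symmetric] by (simp add: power2_eq_square field_simps)
  finally show ?thesis by simp
qed

end

lemma quat_inv_normalize_left:
  fixes a b c d :: "'k::field"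
  assumes "a \<noteq> 0" "b \<noteq> 0" "c \<noteq> 0" "d \<noteq> 0"
    and ch: "\<And>a b b'. a \<noteq> 0 \<Longrightarrow> b \<noteq> 0 \<Longrightarrow> b' \<noteq> 0 \<Longrightarrow> albert_conj (quat_inv a b c d) (quat_inv a b' c d)"
  shows "albert_conj (quat_inv a b c d) (quat_inv 1 1 c d)"
proof -
  have "albert_conj (quat_inv a b c d) (quat_inv a 1 c d)" using assms by (intro ch) auto
  also have "albert_conj \<dots> (quat_inv 1 a c d)" using assms by (intro quat_inv_swap_left) auto
  also have "albert_conj \<dots> (quat_inv 1 1 c d)" using assms by (intro ch) auto
  finally show ?thesis .
qed

text \<open>If the second symbol is split, it can be brought to the form \<open>c = -1\<close>, \<open>d = 1\<close>. Then every scalar is a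
  value of \<open>\<langle>1, -1\<rangle>\<close>, and the cross move trivializes the first symbol.\<close>

lemma quat_inv_split:
  fixes a b c d :: "'k::field"
  assumes two: "(2::'k) \<noteq> 0" and nz: "a \<noteq> 0" "b \<noteq> 0" "c \<noteq> 0" "d \<noteq> 0" and iso: "norm_of (- c) (- d)"
  shows "albert_conj (quat_inv a b c d) (quat_inv 1 1 (-1) 1)"
proof -
  have univ: "norm_of 1 y" for y :: 'k using norm_of_square_universal[OF two, of 1] by simp
  have "albert_conj (quat_inv a b c d) (quat_inv a b c (-1))"
    using nz iso by (intro quat_inv_change_d) auto
  also have "albert_conj \<dots> (quat_inv a b (-1) c)" using nz by (intro quat_inv_swap_right) auto
  also have "albert_conj \<dots> (quat_inv a b (-1) 1)"
    using nz univ by (intro quat_inv_change_d) auto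
  also have "albert_conj \<dots> (quat_inv 1 1 (-1) 1)"
    using nz univ by (intro quat_inv_normalize_left quat_inv_change_b_cross) auto
  finally show ?thesis .
qed

section \<open>Algebraically closed fields and prime fields\<close>

text \<open>If binary forms are universal, every quaternion symbol is split.\<close>

lemma one_class_if_universal:
  assumes two: "(2::'k::field) \<noteq> 0" and univ: "\<And>x y :: 'k. x \<noteq> 0 \<Longrightarrow> norm_of x y"
  shows "card (gt_involution_classes TYPE('k)) = 1"
proof -
  have "card (gt_involution_classes TYPE('k)) = card {(1::'k, 1::'k, - 1::'k, 1::'k)}"
  proof (rule card_gt_classes[OF two])
    show "\<exists>r\<in>{(1, 1, -1, 1)}. albert_conj (symbol_inv q) (symbol_inv r)" if "q \<in> quat_symbols" for q :: "'k \<times> 'k \<times> 'k \<times> 'k"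
      using that quat_inv_split[OF two] univ by (auto simp: quat_symbols_def symbol_inv_def)
  qed (auto simp: quat_symbols_def)
  then show ?thesis by simp
qed

lemma one_class_alg_closed:
  assumes "CHAR('a::alg_closed_field) \<noteq> 2"
  shows "card (gt_involution_classes TYPE('a)) = 1"
proof (rule one_class_if_universal)
  show "(2::'a) \<noteq> 0"
  proof
    assume "(2::'a) = 0"
    then have "CHAR('a) dvd 2" using of_nat_eq_0_iff_char_dvd[where 'a = 'a, of 2] by simp
    then have "CHAR('a) = 1 \<or> CHAR('a) = 2" using two_is_prime_nat prime_nat_iff by blast
    then show False using assms CHAR_not_1'[where 'a = 'a] by simp
  qed
  fix x y :: 'a
  obtain w where "w\<^sup>2 = y" using nth_root_exists[of 2 y] by auto
  then show "norm_of x y" using norm_of_square by blast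
qed

lemma inj_on_squares_mod:
  fixes p :: int
  assumes p: "prime p" "2 < p" and a: "\<not> p dvd a"
  shows "inj_on (\<lambda>s. (n + a * s\<^sup>2) mod p) {0..(p - 1) div 2}"
proof (rule inj_onI)
  fix s t assume s: "s \<in> {0..(p - 1) div 2}" and t: "t \<in> {0..(p - 1) div 2}"
    and eq: "(n + a * s\<^sup>2) mod p = (n + a * t\<^sup>2) mod p"
  have "p dvd (n + a * s\<^sup>2) - (n + a * t\<^sup>2)" using eq by (simp add: mod_eq_dvd_iff)
  also have "(n + a * s\<^sup>2) - (n + a * t\<^sup>2) = a * ((s - t) * (s + t))" by (simp add: power2_eq_square algebra_simps)
  finally have "p dvd s - t \<or> p dvd s + t" using p a by (simp add: prime_dvd_mult_iff)
  moreover have "\<bar>s - t\<bar> < p" "0 \<le> s + t" "s + t < p" using s t p by auto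
  ultimately have "s - t = 0 \<or> s + t = 0"
    using zdvd_imp_le dvd_imp_le_int by (smt (verit) abs_of_nonneg)
  then show "s = t" using s t by auto
qed

text \<open>The sets of residues \<open>a s\<^sup>2\<close> and \<open>n - b t\<^sup>2\<close> have \<open>(p + 1) / 2\<close> elements each, so they meet.\<close>

lemma binary_form_universal_mod:
  fixes p :: int
  assumes p: "prime p" "2 < p" and a: "\<not> p dvd a" and b: "\<not> p dvd b"
  shows "\<exists>s t. p dvd a * s\<^sup>2 + b * t\<^sup>2 - n"
proof -
  let ?I = "{0..(p - 1) div 2}"
  let ?S = "(\<lambda>s. (0 + a * s\<^sup>2) mod p) ` ?I" and ?T = "(\<lambda>t. (n + (- b) * t\<^sup>2) mod p) ` ?I"
  have odd: "odd p" using p prime_odd_int by auto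
  have "card ?S = card ?I" "card ?T = card ?I"
    using card_image[OF inj_on_squares_mod[OF p a, of 0]] card_image[OF inj_on_squares_mod[OF p, of "- b" n]] b by simp_all
  moreover have "2 * card ?I = nat (p + 1)" using odd p by (auto elim!: oddE)
  ultimately have "card ?S + card ?T = nat (p + 1)" by simp
  moreover have "card (?S \<union> ?T) \<le> card {0..<p}"
    using p by (intro card_mono) auto
  moreover have "card (?S \<union> ?T) = card ?S + card ?T" if "?S \<inter> ?T = {}"
    using that by (intro card_Un_disjoint) auto
  ultimately have "?S \<inter> ?T \<noteq> {}" using p by auto
  then obtain s t where "(0 + a * s\<^sup>2) mod p = (n + (- b) * t\<^sup>2) mod p" by blast
  then have "p dvd (0 + a * s\<^sup>2) - (n + (- b) * t\<^sup>2)" by (simp only: mod_eq_dvd_iff)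
  then show ?thesis by (intro exI[of _ s] exI[of _ t]) (simp add: algebra_simps)
qed

lemma one_class_prime_field:
  assumes "CARD('p::prime_card) > 2"
  shows "card (gt_involution_classes TYPE('p mod_ring)) = 1"
proof (rule one_class_if_universal)
  let ?p = "int CARD('p)"
  have p: "prime ?p" "2 < ?p" using prime_card[where 'a = 'p] assms by auto
  have of_int_0: "(of_int m :: 'p mod_ring) = 0 \<longleftrightarrow> ?p dvd m" for m
    using of_int_eq_0_iff_char_dvd[where 'a = "'p mod_ring", of m] by simp
  have ex: "\<exists>m. x = of_int m" for x :: "'p mod_ring"
    by (metis of_int_mod_ring_to_int_mod_ring of_int_of_int_mod_ring)
  show "(2 :: 'p mod_ring) \<noteq> 0" using of_int_0[of 2] p zdvd_imp_le[of ?p 2] by auto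
  fix x y :: "'p mod_ring" assume "x \<noteq> 0"
  obtain m n where m: "x = of_int m" "y = of_int n" using ex by metis
  have "\<not> ?p dvd - m" using of_int_0 \<open>x \<noteq> 0\<close> m by simp
  moreover have "\<not> ?p dvd 1" using p by auto
  ultimately obtain s t where "?p dvd 1 * s\<^sup>2 + (- m) * t\<^sup>2 - n" using binary_form_universal_mod[OF p] by blast
  then have "(of_int (1 * s\<^sup>2 + (- m) * t\<^sup>2 - n) :: 'p mod_ring) = 0" by (simp only: of_int_0)
  then have "y = (of_int s)\<^sup>2 - x * (of_int t)\<^sup>2" by (simp add: m)
  then show "norm_of x y" unfolding norm_of_def by blast
qed

section \<open>Real numbers\<close>

text \<open>Over the reals and for a division algebra \<open>D\<close>, this separates the definite hermitian forms \<open>\<gamma>\<close> from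
  the indefinite ones.\<close>

definition has_square_zero :: "('k::field albert \<Rightarrow> 'k albert) \<Rightarrow> bool" where
  "has_square_zero s \<longleftrightarrow> (\<exists>x\<in>fixed_subalgebra s. x \<noteq> 0 \<and> albert_mult x x = 0)"

lemma has_square_zero_conj:
  assumes "albert_conj s t" "has_square_zero t" shows "has_square_zero s"
proof -
  obtain h where h: "h \<in> carrier albert_Aut" and ht: "\<And>x. s (h x) = h (t x)"
    using assms(1) by (auto simp: albert_conj_def fun_eq_iff)
  obtain x where x: "t x = x" "x \<noteq> 0" "albert_mult x x = 0"
    using assms(2) by (auto simp: has_square_zero_def fixed_subalgebra_def)
  have "h x \<noteq> 0" using h x(2) Aut_zero[OF h] by (auto simp: mem_albert_Aut bij_def dest: injD[of h x 0])
  moreover have "albert_mult (h x) (h x) = 0" using h x(3) Aut_zero[OF h] by (simp add: mem_albert_Aut flip: x(3))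
  ultimately show ?thesis using ht[of x] x(1) by (auto simp: has_square_zero_def fixed_subalgebra_def)
qed

text \<open>Up to squares all parameters are signs. The second symbol is split unless \<open>c, d > 0\<close>; if it is not
  split, the first symbol can be either definite or indefinite. The split algebra contains a
  quaternion \<open>e\<close> outside the reals with \<open>e\<^sup>2 = 1\<close>; in the definite case the trace form on the fixed
  subalgebra is positive definite, so it contains no element of square zero.\<close>

lemma real_three_classes: "card (gt_involution_classes TYPE(real)) = 3"
proof -
  let ?R = "{(1, 1, -1, 1), (1, 1, 1, 1), (-1, 1, 1, 1)} :: (real \<times> real \<times> real \<times> real) set"
  have "card (gt_involution_classes TYPE(real)) = card ?R"
  proof (rule card_gt_classes)
    show "\<exists>r\<in>?R. albert_conj (symbol_inv q) (symbol_inv r)" if q: "q \<in> quat_symbols" for q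
    proof -
      obtain a b c d where abcd: "q = (a, b, c, d)" and nz: "a \<noteq> 0" "b \<noteq> 0" "c \<noteq> 0" "d \<noteq> 0"
        using q by (auto simp: quat_symbols_def)
      have sq: "x * (1 / sqrt \<bar>x\<bar>)\<^sup>2 = sgn x" if "x \<noteq> 0" for x :: real
        using that by (simp add: power_divide sgn_if)
      have signs: "albert_conj (quat_inv a b c d) (quat_inv (sgn a) (sgn b) (sgn c) (sgn d))"
        using quat_inv_squares[OF nz, of "1 / sqrt \<bar>a\<bar>" "1 / sqrt \<bar>b\<bar>" "1 / sqrt \<bar>c\<bar>" "1 / sqrt \<bar>d\<bar>"] nz
        by (simp add: sq)
      show ?thesis
      proof (cases "0 < c \<and> 0 < d")
        case False
        then have "c < 0 \<or> d < 0" using nz by linarith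
        have "norm_of (- c) (- d)"
        proof (cases "c < 0")
          case True
          then show ?thesis using norm_of_square_universal[of "sqrt (- c)" "- d"] by simp
        next
          case False
          then show ?thesis using norm_of_square[of "- c" "sqrt (- d)"] \<open>c < 0 \<or> d < 0\<close> by simp
        qed
        then have "albert_conj (quat_inv a b c d) (quat_inv 1 1 (-1) 1)" using nz by (intro quat_inv_split) auto
        then show ?thesis by (simp add: abcd symbol_inv_def)
      next
        case True
        have "albert_conj (quat_inv a b c d) (quat_inv 1 1 1 1) \<or> albert_conj (quat_inv a b c d) (quat_inv (-1) 1 1 1)"
        proof (cases "0 < a")
          case a: True
          show ?thesis
          proof (cases "0 < b")
            case True
            then show ?thesis using signs \<open>0 < c \<and> 0 < d\<close> a by simp
          next
            case False
            then have "albert_conj (quat_inv a b c d) (quat_inv 1 (-1) 1 1)" using signs \<open>0 < c \<and> 0 < d\<close> a nz by simp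
            also have "albert_conj \<dots> (quat_inv (-1) 1 1 1)" by (intro quat_inv_swap_left) auto
            finally show ?thesis ..
          qed
        next
          case a: False
          show ?thesis
          proof (cases "0 < b")
            case True
            then show ?thesis using signs \<open>0 < c \<and> 0 < d\<close> a nz by simp
          next
            case False
            then have "albert_conj (quat_inv a b c d) (quat_inv (-1) (-1) 1 1)" using signs \<open>0 < c \<and> 0 < d\<close> a nz by simp
            also have "albert_conj \<dots> (quat_inv (-1) (inverse ((-1) * (-1))) 1 1)" by (intro quat_inv_rot_left) auto
            finally show ?thesis by simp
          qed
        qed
        then show ?thesis by (auto simp: abcd symbol_inv_def)
      qed
    qed
    have sqrt: "has_sqrt (quat_inv 1 1 (-1) (1::real)) 1"
      using has_sqrt_minus_c[of 1 1 "-1" "1::real"] by simp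
    have no_sqrt: "\<not> has_sqrt (quat_inv a 1 1 (1::real)) 1" if "a \<noteq> 0" for a
    proof
      assume "has_sqrt (quat_inv a 1 1 1) 1"
      then obtain x y z :: real where "1 = - (1 * x\<^sup>2 + 1 * y\<^sup>2 + inverse (1 * 1) * z\<^sup>2)"
        using has_sqrt_imp_represented[of a 1 1 1 1] \<open>a \<noteq> 0\<close> by auto
      then show False using zero_le_power2[of x] zero_le_power2[of y] zero_le_power2[of z] by simp
    qed
    have zero: "has_square_zero (quat_inv (-1) 1 1 (1::real))"
      unfolding has_square_zero_def
    proof (intro bexI conjI)
      let ?x = "(mat33 1 1 0 (-1) (-1) 0 0 0 0, mat33 0 0 0 0 0 0 0 0 0, mat33 0 0 0 0 0 0 0 0 0) :: real albert"
      show "?x \<noteq> 0" by (simp add: zero_prod_def zero_mat33)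
      show "albert_mult ?x ?x = 0" by (simp add: albert_op_defs one_mat33 zero_prod_def zero_mat33)
      show "?x \<in> fixed_subalgebra (quat_inv (-1) 1 1 1)" by (simp add: mem_fixed_quat_inv)
    qed
    have no_zero: "\<not> has_square_zero (quat_inv 1 1 1 (1::real))"
    proof
      assume "has_square_zero (quat_inv 1 1 1 (1::real))"
      then obtain x :: "real albert" where x: "x \<in> fixed_subalgebra (quat_inv 1 1 1 1)" "x \<noteq> 0" "albert_mult x x = 0"
        by (auto simp: has_square_zero_def)
      obtain x1 x2 x3 p q r B where xe: "x = sym_elt 1 1 1 1 x1 x2 x3 p q r B"
        using x(1) fixed_cases[of 1 1 1 "1::real"] by (metis zero_neq_one zero_neq_numeral)
      obtain b11 b12 b13 b21 b22 b23 b31 b32 b33 where B: "B = mat33 b11 b12 b13 b21 b22 b23 b31 b32 b33" by (rule mat33_cases)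
      have "albert_trace (albert_mult x x) = x1\<^sup>2 + x2\<^sup>2 + x3\<^sup>2 + 2 * (p\<^sup>2 + q\<^sup>2 + r\<^sup>2) + 2 * (b11\<^sup>2 + b12\<^sup>2 + b13\<^sup>2 + b21\<^sup>2 + b22\<^sup>2 + b23\<^sup>2 + b31\<^sup>2 + b32\<^sup>2 + b33\<^sup>2)"
        by (simp add: xe B sym_elt_def albert_mult_eq Let_def one_mat33 albert_trace_def) (simp add: field_simps power2_eq_square)
      also have "albert_trace (albert_mult x x) = 0" by (simp add: x(3) albert_trace_def zero_prod_def zero_mat33)
      finally have "x1 = 0 \<and> x2 = 0 \<and> x3 = 0 \<and> p = 0 \<and> q = 0 \<and> r = 0 \<and> b11 = 0 \<and> b12 = 0 \<and> b13 = 0 \<and> b21 = 0 \<and> b22 = 0 \<and> b23 = 0 \<and> b31 = 0 \<and> b32 = 0 \<and> b33 = 0"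
        by (simp add: add_nonneg_eq_0_iff)
      then have "x = 0" by (simp add: xe B sym_elt_def zero_prod_def zero_mat33)
      then show False using x(2) by simp
    qed
    show "q = r" if q: "q \<in> ?R" and r: "r \<in> ?R" and conj: "albert_conj (symbol_inv q) (symbol_inv r)" for q r
    proof -
      note conj' = conj albert_conj_sym[OF conj]
      from q r show ?thesis
        using has_sqrt_conj[OF conj'(1)] has_sqrt_conj[OF conj'(2)] has_square_zero_conj[OF conj'(1)] has_square_zero_conj[OF conj'(2)]
          sqrt no_sqrt[of 1] no_sqrt[of "-1"] zero no_zero
        by (auto simp: symbol_inv_def)
    qed
  qed (auto simp: quat_symbols_def)
  then show ?thesis by simp
qed


section \<open>Fields with norm groups of index two\<close>

text \<open>The first two hypotheses say that the norm group of every quadratic extension has index two.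
  Then there is one nonsplit quaternion symbol up to isometry: given two of them, some \<open>z\<close> is
  outside both norm groups, and both symbols can be rewritten with \<open>z\<close> as one slot. Moreover every
  \<open>n \<noteq> 0\<close> is a value of a form \<open>\<langle>1, e\<rangle>\<close> for a slot \<open>e\<close> of that symbol: take \<open>e = n\<close>, unless \<open>-n\<close> is a
  square, and then use \<open>m = 1 + u\<^sup>2\<close>, which makes \<open>-1\<close> a norm from \<open>k(\<surd>m)\<close>. So the first symbol can be
  trivialized also over the nonsplit second symbol.\<close>

lemma two_classes_if_norm_index_two:
  fixes m :: "'k::field"
  assumes two: "(2::'k) \<noteq> 0"
    and proper: "\<And>x :: 'k. x \<noteq> 0 \<Longrightarrow> \<nexists>w. x = w\<^sup>2 \<Longrightarrow> \<exists>y. y \<noteq> 0 \<and> \<not> norm_of x y"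
    and index: "\<And>x y z :: 'k. x \<noteq> 0 \<Longrightarrow> y \<noteq> 0 \<Longrightarrow> z \<noteq> 0 \<Longrightarrow> \<nexists>w. x = w\<^sup>2 \<Longrightarrow> \<not> norm_of x y \<Longrightarrow> \<not> norm_of x z \<Longrightarrow> norm_of x (y * z)"
    and m: "m \<noteq> 0" "\<nexists>w. m = w\<^sup>2" "m = 1 + u\<^sup>2"
  shows "card (gt_involution_classes TYPE('k)) = 2"
proof -
  have nonsq: "\<nexists>w. x = w\<^sup>2" if "\<not> norm_of x y" "x \<noteq> 0" for x y :: 'k
    using that norm_of_square_universal[OF two] by auto
  have change_right: "albert_conj (quat_inv a b c d) (quat_inv a b c' d')"
    if nz: "a \<noteq> 0" "b \<noteq> 0" "c \<noteq> 0" "d \<noteq> 0" "c' \<noteq> 0" "d' \<noteq> 0"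
      and an: "\<not> norm_of (- c) (- d)" "\<not> norm_of (- c') (- d')" for a b c d c' d' :: 'k
  proof -
    have ns: "\<nexists>w. - c = w\<^sup>2" "\<nexists>w. - c' = w\<^sup>2" using nonsq an nz by auto
    \<comment> \<open>a group is not the union of two proper subgroups\<close>
    obtain z where z: "z \<noteq> 0" "\<not> norm_of (- c) z" "\<not> norm_of (- c') z"
    proof (cases "norm_of (- c') (- d) \<and> norm_of (- c) (- d')")
      case True
      have "\<not> norm_of (- c) (- d' * - d)" "\<not> norm_of (- c') (- d * - d')"
        using norm_of_cancel[of "- c" "- d'" "- d"] norm_of_cancel[of "- c'" "- d" "- d'"] True an nz by auto
      then show ?thesis using that[of "d * d'"] nz by (simp add: mult.commute)
    next
      case False
      then show ?thesis using that[of "- d"] that[of "- d'"] nz an by auto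
    qed
    have z': "\<not> norm_of z (- c)" "\<not> norm_of z (- c')"
      using norm_of_sym[OF two, of z "- c"] norm_of_sym[OF two, of z "- c'"] z nz by auto
    have "norm_of (- c) (- d * z)" "norm_of (- c') (z * - d')"
      using index[of "- c" "- d" z] index[of "- c'" z "- d'"] nz an ns z by auto
    then have 1: "norm_of (- c) (d * - z)" "norm_of (- c') (- z * d')" by simp_all
    have "norm_of z (- c * - c')"
      using index[of z "- c" "- c'"] z z' nonsq nz by auto
    then have 2: "norm_of (- (- z)) (c * c')" by simp
    have "albert_conj (quat_inv a b c d) (quat_inv a b c (- z))"
      using nz z 1 by (intro quat_inv_change_d) auto
    also have "albert_conj \<dots> (quat_inv a b (- z) c)" using nz z by (intro quat_inv_swap_right) auto
    also have "albert_conj \<dots> (quat_inv a b (- z) c')" using nz z 2 by (intro quat_inv_change_d) auto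
    also have "albert_conj \<dots> (quat_inv a b c' (- z))" using nz z by (intro quat_inv_swap_right) auto
    also have "albert_conj \<dots> (quat_inv a b c' d')" using nz z 1 by (intro quat_inv_change_d) auto
    finally show ?thesis .
  qed
  have change_left: "albert_conj (quat_inv a b c d) (quat_inv a b' c d)"
    if nz: "a \<noteq> 0" "b \<noteq> 0" "b' \<noteq> 0" "c \<noteq> 0" "d \<noteq> 0" and an: "\<not> norm_of (- c) (- d)" for a b b' c d :: 'k
  proof -
    let ?n = "b * b'"
    obtain e where e: "e \<noteq> 0" "\<nexists>w. - e = w\<^sup>2" "norm_of (- e) ?n"
    proof (cases "\<exists>w. - ?n = w\<^sup>2")
      case False
      then show ?thesis using that[of ?n] nz norm_of_neg[of "- ?n"] by auto
    next
      case True
      then obtain w where w: "?n = - w\<^sup>2" by (metis minus_minus)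
      have "?n = (w * u)\<^sup>2 - m * w\<^sup>2"
        unfolding w by (simp add: m(3) power2_eq_square algebra_simps)
      then have "norm_of (- (- m)) ?n" unfolding norm_of_def by auto
      then show ?thesis using m(1,2) by (intro that[of "- m"]) simp_all
    qed
    obtain f where f: "f \<noteq> 0" "\<not> norm_of (- e) (- f)"
      using proper[of "- e"] e by (metis minus_minus neg_equal_0_iff_equal)
    have "albert_conj (quat_inv a b c d) (quat_inv a b e f)" using nz e f an by (intro change_right)
    also have "albert_conj \<dots> (quat_inv a b' e f)" using nz e f by (intro quat_inv_change_b_cross)
    also have "albert_conj \<dots> (quat_inv a b' c d)" using nz e f an by (intro change_right)
    finally show ?thesis .
  qed
  obtain y where y: "y \<noteq> 0" "\<not> norm_of m y" using proper m(1,2) by blast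
  let ?R = "{(1, 1, -1, 1), (1, 1, - m, - y)} :: ('k \<times> 'k \<times> 'k \<times> 'k) set"
  have "card (gt_involution_classes TYPE('k)) = card ?R"
  proof (rule card_gt_classes[OF two])
    show "\<exists>r\<in>?R. albert_conj (symbol_inv q) (symbol_inv r)" if "q \<in> quat_symbols" for q
    proof -
      obtain a b c d where q: "q = (a, b, c, d)" and nz: "a \<noteq> 0" "b \<noteq> 0" "c \<noteq> 0" "d \<noteq> 0"
        using \<open>q \<in> _\<close> by (auto simp: quat_symbols_def)
      show ?thesis
      proof (cases "norm_of (- c) (- d)")
        case True
        then show ?thesis using quat_inv_split[OF two nz] by (simp add: q symbol_inv_def)
      next
        case False
        have "albert_conj (quat_inv a b c d) (quat_inv 1 1 c d)"
          using nz False by (intro quat_inv_normalize_left change_left) auto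
        also have "albert_conj \<dots> (quat_inv 1 1 (- m) (- y))"
          using nz False m(1,2) y by (intro change_right) auto
        finally show ?thesis by (simp add: q symbol_inv_def)
      qed
    qed
    have yes: "has_sqrt (quat_inv 1 1 (-1) (1::'k)) 1" using has_sqrt_minus_c[OF two, of 1 1 "-1" 1] by simp
    have no: "\<not> has_sqrt (quat_inv 1 1 (- m) (- y)) 1"
    proof
      assume "has_sqrt (quat_inv 1 1 (- m) (- y)) 1"
      then obtain r s t where "1 = - ((- m) * r\<^sup>2 + (- y) * s\<^sup>2 + inverse ((- m) * (- y)) * t\<^sup>2)"
        using has_sqrt_imp_represented[OF two, of 1 1 "- m" "- y" 1] m(1,2) y by auto
      then have "1 - m * r\<^sup>2 = y * s\<^sup>2 - inverse (m * y) * t\<^sup>2" by (simp add: algebra_simps)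
      also have "\<dots> = y * (s\<^sup>2 - m * (t / (m * y))\<^sup>2)"
        using m(1,2) y by (simp add: field_simps power2_eq_square)
      finally have eq: "1 - m * r\<^sup>2 = y * (s\<^sup>2 - m * (t / (m * y))\<^sup>2)" .
      have "norm_of m (1 - m * r\<^sup>2)" unfolding norm_of_def by (intro exI[of _ 1] exI[of _ r]) simp
      then have "norm_of m ((s\<^sup>2 - m * (t / (m * y))\<^sup>2) * y)" unfolding eq by (simp add: mult.commute)
      moreover have "norm_of m (s\<^sup>2 - m * (t / (m * y))\<^sup>2)" unfolding norm_of_def by blast
      moreover have "s\<^sup>2 - m * (t / (m * y))\<^sup>2 \<noteq> 0"
      proof
        assume "s\<^sup>2 - m * (t / (m * y))\<^sup>2 = 0"
        then have "1 = m * r\<^sup>2" using eq by simp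
        then have "m = (1 / r)\<^sup>2" by (cases "r = 0") (simp_all add: field_simps power2_eq_square)
        then show False using m(2) by blast
      qed
      ultimately show False using norm_of_cancel y by blast
    qed
    show "q = r" if q: "q \<in> ?R" and r: "r \<in> ?R" and conj: "albert_conj (symbol_inv q) (symbol_inv r)" for q r
      using q r has_sqrt_conj[OF conj] has_sqrt_conj[OF albert_conj_sym[OF conj]] yes no
      by (auto simp: symbol_inv_def)
  qed (use m(1,2) y in \<open>auto simp: quat_symbols_def\<close>)
  also have "\<dots> = 2"
  proof -
    have "(1::'k, 1::'k, -1::'k, 1::'k) \<noteq> (1, 1, - m, - y)" using m(2) by (metis minus_minus one_power2 prod.inject)
    then show ?thesis by (subst card_2_iff) blast
  qed
  finally show ?thesis .
qed

section \<open>Rational numbers\<close>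

text \<open>A product of numbers that are \<open>0\<close>, \<open>1\<close> or \<open>2\<close> modulo \<open>4\<close> is never \<open>3\<close> modulo \<open>4\<close>.\<close>

lemma prime_factor_3_mod_4:
  fixes n :: nat
  assumes "n mod 4 = 3"
  shows "\<exists>p. prime p \<and> p mod 4 = 3 \<and> p dvd n"
  using assms
proof (induction n rule: less_induct)
  case (less n)
  show ?case
  proof (cases "prime n")
    case True
    have "n dvd n" by simp
    with True less.prems show ?thesis by (intro exI[of _ n] conjI)
  next
    case False
    have "n > 1" using less.prems by presburger
    then obtain a where a: "a dvd n" "a \<noteq> 1" "a \<noteq> n" using False by (auto simp: prime_nat_iff)
    then obtain b where b: "n = a * b" by (elim dvdE)
    have "0 < a" "0 < b" "b \<noteq> 1" using b a(3) \<open>n > 1\<close> by (auto intro!: Nat.gr0I)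
    then have ab: "n = a * b" "a < n" "b < n" using b a(2) by (simp_all add: nat_neq_iff)
    have "(a mod 4) * (b mod 4) mod 4 = 3" using less.prems ab(1) by (simp add: mod_mult_eq)
    moreover have "a mod 4 \<in> {0, 1, 2, 3}" "b mod 4 \<in> {0, 1, 2, 3}" by auto
    ultimately have "a mod 4 = 3 \<or> b mod 4 = 3" by auto
    then show ?thesis using less.IH[of a] less.IH[of b] ab by (metis dvd_mult dvd_mult2)
  qed
qed

text \<open>Euclid's argument with \<open>4 \<cdot> m! - 1\<close>.\<close>

lemma infinite_primes_3_mod_4: "infinite {p :: nat. prime p \<and> p mod 4 = 3}"
  unfolding infinite_nat_iff_unbounded
proof
  fix m :: nat
  let ?N = "4 * fact m - 1 :: nat"
  have "(fact m :: nat) \<ge> 1" by (simp add: fact_ge_1)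
  then have N: "?N = 4 * (fact m - 1) + 3" by (simp add: algebra_simps)
  have "?N mod 4 = 3" unfolding N by simp
  then obtain p where p: "prime p" "p mod 4 = 3" "p dvd ?N" using prime_factor_3_mod_4 by blast
  have "m < p"
  proof (rule ccontr)
    assume "\<not> m < p"
    then have "p dvd fact m" using p(1) by (simp add: prime_dvd_fact_iff)
    then have "p dvd 4 * fact m" by simp
    then have "p dvd 4 * fact m - ?N" using p(3) by (rule dvd_diff_nat)
    also have "4 * fact m - ?N = 1" using \<open>fact m \<ge> 1\<close> by simp
    finally show False using p(1) by simp
  qed
  then show "\<exists>n>m. n \<in> {p. prime p \<and> p mod 4 = 3}" using p by blast
qed

text \<open>Otherwise \<open>-1\<close> would be a square modulo \<open>p\<close>: raising \<open>x\<^sup>2 = -z\<^sup>2\<close> to the odd power \<open>(p - 1) / 2\<close>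
  contradicts Fermat's theorem.\<close>

lemma prime_3_mod_4_dvd_sum_squares:
  fixes x z :: int
  assumes p: "prime p" "p mod 4 = (3::nat)" and dvd: "int p dvd x\<^sup>2 + z\<^sup>2"
  shows "int p dvd x"
proof (rule ccontr)
  assume x: "\<not> int p dvd x"
  have ip: "prime (int p)" using p by simp
  have z: "\<not> int p dvd z"
  proof
    assume "int p dvd z"
    then have "int p dvd x\<^sup>2" using dvd by (metis dvd_add_left_iff dvd_power zero_less_numeral dvd_trans)
    then show False using x ip by (simp add: prime_dvd_power_iff)
  qed
  define k where "k = (p - 1) div 2"
  have "p = 4 * (p div 4) + 3" using p(2) by presburger
  then have k: "2 * k = p - 1" "odd k" unfolding k_def by presburger+
  have fermat: "[y ^ (p - 1) = 1] (mod int p)" if "\<not> int p dvd y" for y :: int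
  proof -
    have "\<not> p dvd nat \<bar>y\<bar>" using that by (metis dvd_abs_iff int_dvd_int_iff int_nat_eq abs_ge_zero)
    then have "[nat \<bar>y\<bar> ^ (p - 1) = 1] (mod p)" using p(1) by (rule fermat_theorem[rotated])
    then have "[int (nat \<bar>y\<bar> ^ (p - 1)) = int 1] (mod int p)" by (simp only: cong_int_iff)
    moreover have "int (nat \<bar>y\<bar> ^ (p - 1)) = y ^ (p - 1)"
    proof -
      have "\<bar>y\<bar> ^ (p - 1) = y ^ (p - 1)" by (metis k(1) power_mult power2_abs)
      then show ?thesis by simp
    qed
    ultimately show ?thesis by simp
  qed
  have "[x\<^sup>2 = - (z\<^sup>2)] (mod int p)" using dvd by (simp add: cong_iff_dvd_diff)
  then have "[(x\<^sup>2) ^ k = (- (z\<^sup>2)) ^ k] (mod int p)" by (rule cong_pow)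
  moreover have "(x\<^sup>2) ^ k = x ^ (p - 1)" "(- (z\<^sup>2)) ^ k = - (z ^ (p - 1))"
    using k by (simp_all add: power_mult[symmetric])
  ultimately have "[x ^ (p - 1) = - (z ^ (p - 1))] (mod int p)" by simp
  then have "[1 = - 1] (mod int p)"
    using fermat[OF x] fermat[OF z] by (meson cong_minus_minus_iff cong_sym cong_trans)
  then have "int p dvd 2" by (simp add: cong_iff_dvd_diff)
  then have "int p \<le> 2" by (rule zdvd_imp_le) simp
  then have "p \<le> 2" by simp
  then show False using p(2) prime_gt_1_nat[OF p(1)] by (cases "p = 2") auto
qed

text \<open>Modulo \<open>p\<close> the equation says \<open>q t\<^sup>2 = y\<^sup>2\<close>. If \<open>p\<close> divides \<open>t\<close>, it divides all unknowns by the previous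
  lemma, and one descends.\<close>

lemma QuadRes_if_represented:
  fixes t x y z q :: int
  assumes p: "prime p" "p mod 4 = (3::nat)" and t: "t \<noteq> 0" and eq: "q * t\<^sup>2 = y\<^sup>2 + int p * (x\<^sup>2 + z\<^sup>2)"
  shows "QuadRes (int p) q"
  using t eq
proof (induction "nat \<bar>t\<bar>" arbitrary: t x y z rule: less_induct)
  case less
  have ip: "prime (int p)" using p by simp
  show ?case
  proof (cases "int p dvd t")
    case False
    then have "coprime t (int p)" using prime_imp_coprime[OF ip False] by (simp add: coprime_commute)
    then obtain t' where t': "[t * t' = 1] (mod int p)" using cong_solve_coprime_int by blast
    have "[(y * t')\<^sup>2 = y\<^sup>2 * t'\<^sup>2] (mod int p)" by (simp add: power_mult_distrib)
    also have "[y\<^sup>2 * t'\<^sup>2 = (q * t\<^sup>2) * t'\<^sup>2] (mod int p)"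
      by (intro cong_mult) (simp_all add: less.prems(2) cong_iff_dvd_diff)
    also have "(q * t\<^sup>2) * t'\<^sup>2 = q * (t * t')\<^sup>2" by (simp add: power_mult_distrib)
    also have "[q * (t * t')\<^sup>2 = q * 1\<^sup>2] (mod int p)" by (intro cong_mult cong_pow t') simp
    finally show ?thesis unfolding QuadRes_def by auto
  next
    case True
    then obtain t1 where t1: "t = int p * t1" by (elim dvdE)
    have "y\<^sup>2 = int p * (int p * (q * t1\<^sup>2) - (x\<^sup>2 + z\<^sup>2))" using less.prems(2) by (simp add: t1 power2_eq_square algebra_simps)
    then have "int p dvd y\<^sup>2" by simp
    then obtain y1 where y1: "y = int p * y1" using ip by (auto simp: prime_dvd_power_iff elim: dvdE)
    have "int p * (x\<^sup>2 + z\<^sup>2) = int p * (int p * (q * t1\<^sup>2 - y1\<^sup>2))" using less.prems(2) by (simp add: t1 y1 power2_eq_square algebra_simps)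
    then have xz: "x\<^sup>2 + z\<^sup>2 = int p * (q * t1\<^sup>2 - y1\<^sup>2)" using prime_gt_0_nat[OF p(1)] by simp
    then have "int p dvd x\<^sup>2 + z\<^sup>2" "int p dvd z\<^sup>2 + x\<^sup>2" by (simp_all add: add.commute)
    then obtain x1 z1 where x1: "x = int p * x1" "z = int p * z1"
      using prime_3_mod_4_dvd_sum_squares[OF p] by (metis dvdE)
    have "int p * (q * t1\<^sup>2) = int p * (y1\<^sup>2 + int p * (x1\<^sup>2 + z1\<^sup>2))" using xz by (simp add: x1 power2_eq_square algebra_simps)
    then have "q * t1\<^sup>2 = y1\<^sup>2 + int p * (x1\<^sup>2 + z1\<^sup>2)" using prime_gt_0_nat[OF p(1)] by simp
    moreover have "t1 \<noteq> 0" using less.prems t1 by auto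
    moreover have "nat \<bar>t1\<bar> < nat \<bar>t\<bar>" using prime_gt_1_nat[OF p(1)] \<open>t1 \<noteq> 0\<close> by (simp add: t1 abs_mult)
    ultimately show ?thesis using less.hyps by blast
  qed
qed

lemma rat_common_denominator:
  fixes x y z :: rat
  obtains D X Y Z :: int where "D \<noteq> 0" "x * of_int D = of_int X" "y * of_int D = of_int Y" "z * of_int D = of_int Z"
proof -
  have "\<exists>a b::int. b \<noteq> 0 \<and> r = of_int a / of_int b" for r :: rat
    by (metis Fract_of_int_quotient Rat_cases less_irrefl)
  then obtain a b c d e f :: int where "b \<noteq> 0" "x = of_int a / of_int b" "d \<noteq> 0" "y = of_int c / of_int d" "f \<noteq> 0" "z = of_int e / of_int f"
    by metis
  then show ?thesis
    by (intro that[of "b * d * f" "a * d * f" "c * b * f" "e * b * d"]) (simp_all add: field_simps)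
qed

text \<open>The algebra for the prime \<open>q\<close> contains a square root of \<open>-q\<close>; so the algebra for \<open>p\<close> does, and \<open>q\<close> is a
  value of \<open>\<langle>p, 1, 1/p\<rangle>\<close>.\<close>

lemma conj_rat_imp_QuadRes:
  assumes p: "prime p" "p mod 4 = (3::nat)" and q: "prime q"
    and conj: "albert_conj (quat_inv 1 1 (of_nat q) 1) (quat_inv 1 1 (of_nat p) (1::rat))"
  shows "QuadRes (int p) (int q)"
proof -
  have pq: "of_nat p \<noteq> (0::rat)" "of_nat q \<noteq> (0::rat)" using prime_gt_0_nat p q by auto
  have "has_sqrt (quat_inv 1 1 (of_nat q) 1) (- of_nat q :: rat)" using pq by (intro has_sqrt_minus_c) auto
  then have "has_sqrt (quat_inv 1 1 (of_nat p) 1) (- of_nat q :: rat)" using conj has_sqrt_conj by blast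
  then have "\<exists>x y z :: rat. - of_nat q = - (of_nat p * x\<^sup>2 + 1 * y\<^sup>2 + inverse (of_nat p * 1) * z\<^sup>2)"
    using pq by (intro has_sqrt_imp_represented[of 1 1]) simp_all
  then obtain x y z :: rat where "- of_nat q = - (of_nat p * x\<^sup>2 + 1 * y\<^sup>2 + inverse (of_nat p * 1) * z\<^sup>2)"
    by blast
  then have e: "of_nat q = y\<^sup>2 + of_nat p * (x\<^sup>2 + (z / of_nat p)\<^sup>2)" using pq by (simp add: field_simps power2_eq_square)
  obtain D X Y Z where D: "D \<noteq> 0" "x * of_int D = of_int X" "y * of_int D = of_int Y" "z / of_nat p * of_int D = of_int Z"
    by (rule rat_common_denominator)
  have "of_nat q * (of_int D)\<^sup>2 = (y * of_int D)\<^sup>2 + of_nat p * ((x * of_int D)\<^sup>2 + (z / of_nat p * of_int D)\<^sup>2)"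
    unfolding e by (simp add: power2_eq_square algebra_simps)
  then have "of_int (int q * D\<^sup>2) = (of_int (Y\<^sup>2 + int p * (X\<^sup>2 + Z\<^sup>2)) :: rat)" unfolding D by simp
  then have "int q * D\<^sup>2 = Y\<^sup>2 + int p * (X\<^sup>2 + Z\<^sup>2)" by (simp only: of_int_eq_iff)
  then show ?thesis using QuadRes_if_represented[OF p D(1)] by blast
qed

text \<open>For distinct primes that are \<open>3\<close> modulo \<open>4\<close>, quadratic reciprocity forbids that each is a square
  modulo the other one.\<close>

lemma infinite_classes_rat: "infinite (gt_involution_classes TYPE(rat))"
proof (rule infinite_gt_classes)
  let ?P = "{p :: nat. prime p \<and> p mod 4 = 3}"
  let ?f = "\<lambda>q :: nat. (1 :: rat, 1 :: rat, of_nat q :: rat, 1 :: rat)"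
  have "inj_on ?f ?P" by (auto intro: inj_onI)
  then show "infinite (?f ` ?P)" using infinite_primes_3_mod_4 by (simp add: finite_image_iff)
  show "?f ` ?P \<subseteq> quat_symbols" using prime_gt_0_nat by (auto simp: quat_symbols_def)
  show "a = b" if a: "a \<in> ?f ` ?P" and b: "b \<in> ?f ` ?P" and conj: "albert_conj (symbol_inv a) (symbol_inv b)" for a b
  proof (rule ccontr)
    assume "a \<noteq> b"
    obtain p q where p: "prime p" "p mod 4 = 3" "a = ?f p" and q: "prime q" "q mod 4 = 3" "b = ?f q" using a b by blast
    have "p \<noteq> q" using p q \<open>a \<noteq> b\<close> by auto
    have "QuadRes (int q) (int p)" "QuadRes (int p) (int q)"
      using conj_rat_imp_QuadRes[OF q(1,2) p(1)] conj_rat_imp_QuadRes[OF p(1,2) q(1)] conj albert_conj_sym[OF conj]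
      by (simp_all add: p q symbol_inv_def)
    then have "Legendre (int p) (int q) * Legendre (int q) (int p) \<ge> 0" by (simp add: Legendre_def)
    moreover have "2 < p" "2 < q" using prime_ge_2_nat[OF p(1)] prime_ge_2_nat[OF q(1)] p(2) q(2) by (cases "p = 2"; cases "q = 2"; simp)+
    then have "Legendre (int p) (int q) * Legendre (int q) (int p) = (-1) ^ ((p - 1) div 2 * ((q - 1) div 2))"
      using Quadratic_Reciprocity[of p q] p(1) q(1) \<open>p \<noteq> q\<close> by simp
    moreover have "odd ((p - 1) div 2 * ((q - 1) div 2))" using p(2) q(2) by (simp, presburger)
    ultimately show False by simp
  qed
qed simp

section \<open>The p-adic numbers\<close>

lemma norm_of_times_square_iff:
  assumes "w \<noteq> 0"
  shows "norm_of x (y * w\<^sup>2) \<longleftrightarrow> norm_of x y" "norm_of (x * w\<^sup>2) y \<longleftrightarrow> norm_of x y"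
proof -
  have "norm_of x (y * w\<^sup>2 * (inverse w)\<^sup>2)" if "norm_of x (y * w\<^sup>2)"
    using that norm_of_square by (rule norm_of_mult)
  moreover have "y * w\<^sup>2 * (inverse w)\<^sup>2 = y" using assms by (simp add: power2_eq_square field_simps)
  ultimately show "norm_of x (y * w\<^sup>2) \<longleftrightarrow> norm_of x y" using norm_of_mult norm_of_square by metis
  show "norm_of (x * w\<^sup>2) y \<longleftrightarrow> norm_of x y"
  proof
    assume "norm_of (x * w\<^sup>2) y"
    then obtain s t where "y = s\<^sup>2 - x * w\<^sup>2 * t\<^sup>2" by (auto simp: norm_of_def)
    then have "y = s\<^sup>2 - x * (w * t)\<^sup>2" by (simp add: power_mult_distrib mult.assoc)
    then show "norm_of x y" unfolding norm_of_def by blast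
  next
    assume "norm_of x y"
    then obtain s t where "y = s\<^sup>2 - x * t\<^sup>2" by (auto simp: norm_of_def)
    then have "y = s\<^sup>2 - x * w\<^sup>2 * (t / w)\<^sup>2" using assms by (simp add: power_divide)
    then show "norm_of (x * w\<^sup>2) y" unfolding norm_of_def by blast
  qed
qed

text \<open>The defining properties of a completion of the rationals for the \<open>p\<close>-adic absolute value.\<close>

locale padic_abs_value =
  fixes p :: nat and N :: "'k::field_char_0 \<Rightarrow> real"
  assumes prime_p: "prime p"
    and N_nonneg: "0 \<le> N x" and N_0_iff: "N x = 0 \<longleftrightarrow> x = 0"
    and N_mult: "N (x * y) = N x * N y" and N_triangle: "N (x + y) \<le> N x + N y"
    and N_rat: "N (of_rat q) = padic_abs p q"
    and dense: "0 < e \<Longrightarrow> \<exists>q. N (x - of_rat q) < e"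
    and complete: "(\<forall>e>0. \<exists>M. \<forall>m\<ge>M. \<forall>n\<ge>M. N (X m - X n) < e) \<Longrightarrow> \<exists>L. (\<lambda>n. N (X n - L)) \<longlonglongrightarrow> 0"
begin

lemma p_gt_1: "1 < p" using prime_p by (rule prime_gt_1_nat)

lemma N_0 [simp]: "N 0 = 0" by (simp add: N_0_iff)

lemma N_pos: "x \<noteq> 0 \<Longrightarrow> 0 < N x" using N_nonneg[of x] N_0_iff[of x] by linarith

lemma N_1 [simp]: "N 1 = 1"
  using N_mult[of 1 1] N_pos[of 1] by simp

lemma N_m1 [simp]: "N (- 1) = 1"
proof -
  have "N (- 1) * N (- 1) = 1" using N_mult[of "- 1" "- 1"] by simp
  then show ?thesis using N_nonneg[of "- 1"] by (metis abs_of_nonneg real_sqrt_abs2 real_sqrt_one)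
qed

lemma N_minus [simp]: "N (- x) = N x"
  using N_mult[of "- 1" x] by simp

lemma N_diff_commute: "N (x - y) = N (y - x)"
  using N_minus[of "x - y"] by simp

lemma N_power: "N (x ^ n) = N x ^ n"
  by (induction n) (simp_all add: N_mult)

lemma N_inverse: "N (inverse x) = inverse (N x)"
proof (cases "x = 0")
  case False
  then have "N x * N (inverse x) = 1" by (simp flip: N_mult)
  then show ?thesis by (rule inverse_unique[symmetric])
qed simp

lemma N_divide: "N (x / y) = N x / N y"
  by (simp add: divide_inverse N_mult N_inverse)

lemma N_of_int: "m \<noteq> 0 \<Longrightarrow> N (of_int m) = real p powi (- int (multiplicity (int p) m))"
  using N_rat[of "of_int m"] by (simp add: padic_abs_def)

lemma N_of_int_dvd: "int p ^ k dvd m \<Longrightarrow> N (of_int m) \<le> real p powi (- int k)"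
proof (cases "m = 0")
  case False
  assume d: "int p ^ k dvd m"
  have "\<not> is_unit (int p)" using p_gt_1 by simp
  then have "k \<le> multiplicity (int p) m" using d False by (intro multiplicity_geI) auto
  then show ?thesis unfolding N_of_int[OF False] using p_gt_1 by (intro power_int_increasing) auto
qed (use p_gt_1 in simp)

lemma N_of_int_le_1: "N (of_int m) \<le> 1"
  using N_of_int_dvd[of 0 m] by simp

lemma N_of_int_unit: "\<not> int p dvd m \<Longrightarrow> N (of_int m) = 1"
  by (subst N_of_int) (auto simp: not_dvd_imp_multiplicity_0)

lemma N_of_int_lt_1_iff: "N (of_int m) < 1 \<longleftrightarrow> int p dvd m"
proof
  show "int p dvd m" if "N (of_int m) < 1" using that N_of_int_unit[of m] by auto
  assume "int p dvd m"
  then have "N (of_int m) \<le> real p powi (- 1)" using N_of_int_dvd[of 1 m] by simp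
  also have "\<dots> < 1" using p_gt_1 by (simp add: field_simps)
  finally show "N (of_int m) < 1" .
qed

lemma N_p: "N (of_nat p) = inverse (real p)"
proof -
  have "multiplicity (int p) (int p) = 1" using prime_p by simp
  then show ?thesis using N_of_int[of "int p"] p_gt_1 by (simp add: power_int_minus)
qed

lemma N_int_ultra: "N (of_int a + of_int b) \<le> max (N (of_int a)) (N (of_int b))"
proof (cases "a = 0 \<or> b = 0")
  case True
  then show ?thesis by auto
next
  case False
  define k where "k = min (multiplicity (int p) a) (multiplicity (int p) b)"
  have "int p ^ k dvd a" "int p ^ k dvd b" unfolding k_def by (intro multiplicity_dvd'; simp)+
  then have "N (of_int (a + b)) \<le> real p powi (- int k)" by (intro N_of_int_dvd dvd_add)
  also have "\<dots> \<le> max (N (of_int a)) (N (of_int b))"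
    using False by (auto simp: N_of_int k_def min_def max_def)
  finally show ?thesis by simp
qed

lemma N_rat_ultra: "N (of_rat q + of_rat r) \<le> max (N (of_rat q)) (N (of_rat r))"
proof -
  obtain D A B Z where D: "D \<noteq> 0" and q: "q * of_int D = of_int A" and r: "r * of_int D = of_int B" and "0 * of_int D = (of_int Z :: rat)"
    by (rule rat_common_denominator)
  have q': "of_rat q * of_int D = (of_int A :: 'k)" and r': "of_rat r * of_int D = (of_int B :: 'k)"
    using arg_cong[OF q, of "of_rat :: rat \<Rightarrow> 'k"] arg_cong[OF r, of "of_rat :: rat \<Rightarrow> 'k"] by (simp_all add: of_rat_mult)
  have D0: "0 < N (of_int D)" using D by (intro N_pos) simp
  have "N (of_rat q + of_rat r) * N (of_int D) = N (of_int A + of_int B)"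
    unfolding N_mult[symmetric] q'[symmetric] r'[symmetric] by (simp add: algebra_simps)
  also have "\<dots> \<le> max (N (of_int A)) (N (of_int B))" by (rule N_int_ultra)
  also have "\<dots> = max (N (of_rat q)) (N (of_rat r)) * N (of_int D)"
    unfolding q'[symmetric] r'[symmetric] N_mult using D0 by (auto simp: max_def)
  finally show ?thesis using D0 by simp
qed

text \<open>The inequality holds on the integers, hence on the rationals, and passes to the completion.\<close>

lemma N_ultra: "N (x + y) \<le> max (N x) (N y)"
proof (rule field_le_epsilon)
  fix e :: real assume "0 < e"
  then obtain q r where q: "N (x - of_rat q) < e / 3" and r: "N (y - of_rat r) < e / 3"
    using dense[of "e / 3" x] dense[of "e / 3" y] by auto
  have "N (of_rat q) \<le> N x + e / 3" "N (of_rat r) \<le> N y + e / 3"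
    using N_triangle[of x "of_rat q - x"] N_triangle[of y "of_rat r - y"] q r by (simp_all add: N_diff_commute)
  then have "N (of_rat q + of_rat r) \<le> max (N x) (N y) + e / 3" using N_rat_ultra[of q r] by linarith
  moreover have "N (x + y) \<le> N (x - of_rat q) + N (y - of_rat r) + N (of_rat q + of_rat r)"
    using N_triangle[of "(x - of_rat q) + (y - of_rat r)" "of_rat q + of_rat r"] N_triangle[of "x - of_rat q" "y - of_rat r"]
    by (simp add: algebra_simps)
  ultimately show "N (x + y) \<le> max (N x) (N y) + e" using q r by linarith
qed

lemma N_ultra_diff: "N (x - y) \<le> max (N x) (N y)"
  using N_ultra[of x "- y"] by simp

lemma N_ultra_eq: "N y < N x \<Longrightarrow> N (x + y) = N x"
  using N_ultra[of x y] N_ultra[of "x + y" "- y"] by (simp add: max_def split: if_splits)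

lemma N_eq_of_close: "N (x - y) < N x \<Longrightarrow> N y = N x"
  using N_ultra_eq[of "y - x" x] by (simp add: N_diff_commute)

text \<open>The iteration \<open>z \<mapsto> t - z\<^sup>2\<close> contracts the set \<open>N z \<le> N t\<close> by the factor \<open>N t < 1\<close>. This
  equation, unlike \<open>w\<^sup>2 = x\<close>, treats all primes alike.\<close>

lemma Hensel_artin_schreier:
  assumes "N t < 1"
  shows "\<exists>z. z\<^sup>2 + z = t"
proof -
  define Z where "Z = rec_nat (0::'k) (\<lambda>_ z. t - z\<^sup>2)"
  have Z_0: "Z 0 = 0" and Z_Suc: "Z (Suc n) = t - (Z n)\<^sup>2" for n by (simp_all add: Z_def)
  define r where "r = N t"
  have r: "0 \<le> r" "r < 1" using assms N_nonneg by (simp_all add: r_def)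
  have bound: "N (Z n) \<le> r" for n
  proof (induction n)
    case (Suc n)
    have "N ((Z n)\<^sup>2) \<le> r * r" unfolding power2_eq_square N_mult using Suc r by (intro mult_mono N_nonneg)
    also have "\<dots> \<le> r" using r by (simp add: mult_left_le)
    finally show ?case using N_ultra_diff[of t "(Z n)\<^sup>2"] by (simp add: Z_Suc r_def)
  qed (simp add: Z_0 r)
  have step: "N (Z (Suc n) - Z n) \<le> r ^ Suc n" for n
  proof (induction n)
    case 0
    then show ?case by (simp add: Z_Suc Z_0 r_def)
  next
    case (Suc n)
    have "Z (Suc (Suc n)) - Z (Suc n) = - ((Z (Suc n) - Z n) * (Z (Suc n) + Z n))"
      by (simp only: Z_Suc[of "Suc n"] Z_Suc[of n]) (simp add: power2_eq_square algebra_simps)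
    then have "N (Z (Suc (Suc n)) - Z (Suc n)) = N (Z (Suc n) - Z n) * N (Z (Suc n) + Z n)" by (simp add: N_mult)
    also have "\<dots> \<le> r ^ Suc n * r"
      using Suc N_ultra[of "Z (Suc n)" "Z n"] bound[of n] bound[of "Suc n"] N_nonneg r by (intro mult_mono) auto
    finally show ?case by (simp add: mult.commute)
  qed
  have far: "N (Z (n + k) - Z n) \<le> r ^ n" for n k
  proof (induction k)
    case (Suc k)
    have "N (Z (Suc (n + k)) - Z (n + k)) \<le> r ^ Suc (n + k)" by (rule step)
    also have "\<dots> \<le> r ^ n" using r by (intro power_decreasing) auto
    finally show ?case using N_ultra[of "Z (Suc (n + k)) - Z (n + k)" "Z (n + k) - Z n"] Suc by simp
  qed (use r in simp)
  have lim: "(\<lambda>n. r ^ n) \<longlonglongrightarrow> 0" using r by (intro LIMSEQ_power_zero) simp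
  have "\<exists>L. (\<lambda>n. N (Z n - L)) \<longlonglongrightarrow> 0"
  proof (rule complete, intro allI impI)
    fix e :: real assume "0 < e"
    then obtain M where M: "r ^ M < e" using r by (meson real_arch_pow_inv)
    have "N (Z m - Z n) < e" if "M \<le> m" "M \<le> n" for m n
    proof -
      have "N (Z m - Z M) \<le> r ^ M" "N (Z n - Z M) \<le> r ^ M"
        using far[of M "m - M"] far[of M "n - M"] that by auto
      then show ?thesis using N_ultra_diff[of "Z m - Z M" "Z n - Z M"] M by simp
    qed
    then show "\<exists>M. \<forall>m\<ge>M. \<forall>n\<ge>M. N (Z m - Z n) < e" by blast
  qed
  then obtain L where L: "(\<lambda>n. N (Z n - L)) \<longlonglongrightarrow> 0" by blast
  have "N (L\<^sup>2 + L - t) \<le> 0"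
  proof (rule field_le_epsilon)
    fix e :: real assume "0 < e"
    define e' where "e' = min e 1"
    have "0 < e'" using \<open>0 < e\<close> by (simp add: e'_def)
    then obtain M where M: "\<And>n. M \<le> n \<Longrightarrow> N (Z n - L) < e'"
      using L N_nonneg unfolding lim_sequentially dist_real_def by (metis abs_of_nonneg diff_zero)
    have 1: "N (Z M - L) < e'" "N (Z (Suc M) - L) < e'" using M by auto
    have NL: "N (L + Z M) \<le> 1"
    proof -
      have "N L \<le> 1" using N_ultra[of "L - Z M" "Z M"] 1 bound[of M] r
        by (simp add: N_diff_commute[of _ L] e'_def max_def split: if_splits)
      then show ?thesis using N_ultra[of L "Z M"] bound[of M] r by simp
    qed
    have eq: "L\<^sup>2 + L - t = (L - Z M) * (L + Z M) + (L - Z (Suc M))"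
      by (simp only: Z_Suc) (simp add: power2_eq_square algebra_simps)
    have "N (L\<^sup>2 + L - t) \<le> max (N (L - Z M) * N (L + Z M)) (N (L - Z (Suc M)))"
      unfolding eq N_mult[symmetric] by (rule N_ultra)
    also have "\<dots> \<le> e'"
      using 1 NL N_nonneg mult_left_le[of "N (L + Z M)" "N (L - Z M)"] by (simp add: N_diff_commute)
    finally show "N (L\<^sup>2 + L - t) \<le> 0 + e" by (simp add: e'_def)
  qed
  then have "L\<^sup>2 + L - t = 0" using N_nonneg[of "L\<^sup>2 + L - t"] N_0_iff by (metis order_antisym)
  then show ?thesis by (intro exI[of _ L]) simp
qed

text \<open>Completing the square: \<open>1 + 4 (z\<^sup>2 + z) = (1 + 2 z)\<^sup>2\<close>.\<close>

lemma square_class_open: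
  assumes "y \<noteq> 0" "N (x - y) < N (4 * y)"
  shows "\<exists>w. x = y * w\<^sup>2"
proof -
  have "N ((x - y) / (4 * y)) < 1" using assms N_pos[of "4 * y"] by (simp add: N_divide)
  then obtain z where "z\<^sup>2 + z = (x - y) / (4 * y)" using Hensel_artin_schreier by blast
  then have "x = y + 4 * y * (z\<^sup>2 + z)" using assms by simp
  also have "\<dots> = y * (1 + 2 * z)\<^sup>2" by (simp add: power2_eq_square algebra_simps)
  finally show ?thesis by blast
qed

lemma value_group: "x \<noteq> 0 \<Longrightarrow> \<exists>k :: int. N x = real p powi k"
proof -
  assume x: "x \<noteq> 0"
  then obtain q where q: "N (x - of_rat q) < N x" using dense N_pos by blast
  then have "N (of_rat q) = N x" by (rule N_eq_of_close)
  moreover have "q \<noteq> 0" using q by auto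
  ultimately show ?thesis by (metis N_rat padic_abs_def)
qed

lemma powi_p_inject: "real p powi j = real p powi k \<Longrightarrow> j = k" for j k :: int
  using p_gt_1 power_int_strict_increasing[of j k "real p"] power_int_strict_increasing[of k j "real p"] 
  by (cases j k rule: linorder_cases) auto

text \<open>A square has even valuation, and \<open>p u t\<^sup>2\<close> has odd valuation.\<close>

lemma N_sq_neq_odd:
  assumes "N u = 1" shows "N (s\<^sup>2) \<noteq> N (of_int (int p) * u * t\<^sup>2) \<or> s = 0 \<and> t = 0"
proof (rule ccontr)
  assume "\<not> ?thesis"
  then have eq: "N (s\<^sup>2) = N (of_int (int p) * u * t\<^sup>2)" and st: "s \<noteq> 0 \<or> t \<noteq> 0" by auto
  have st': "s \<noteq> 0" "t \<noteq> 0"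
    using eq st assms p_gt_1 by (auto simp: N_mult N_p N_power N_0_iff)
  obtain j k where j: "N s = real p powi j" and k: "N t = real p powi k" using value_group st' by blast
  have "real p powi (j * 2) = real p powi (- 1 + k * 2)"
  proof -
    have p0: "real p \<noteq> 0" using p_gt_1 by simp
    have sq: "(real p powi i)\<^sup>2 = real p powi (i * 2)" for i
      by (simp only: power2_eq_square power_int_add[OF disjI1[OF p0]] mult_2_right)
    have "(real p powi j)\<^sup>2 = real p powi (- 1) * (real p powi k)\<^sup>2"
      using eq assms by (simp add: N_mult N_p N_power j k power_int_minus)
    then show ?thesis by (simp only: sq power_int_add[OF disjI1[OF p0]])
  qed
  then have "j * 2 = - 1 + k * 2" by (rule powi_p_inject)
  then show False by presburger
qed

text \<open>An integral element is close to a rational number with denominator prime to \<open>p\<close>; this denominator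
  is invertible modulo every power of \<open>p\<close>.\<close>

lemma approx_int:
  assumes "N x \<le> 1"
  shows "\<exists>m :: int. N (x - of_int m) < real p powi (- int k)"
proof -
  let ?e = "real p powi (- int (Suc k))"
  have e: "0 < ?e" "?e \<le> 1" using p_gt_1 power_int_increasing[of "- int (Suc k)" 0 "real p"] by auto
  then obtain q where q: "N (x - of_rat q) < ?e" using dense by blast
  obtain a b where ab: "quotient_of q = (a, b)" by (cases "quotient_of q")
  have b: "b > 0" "coprime a b" "q = of_int a / of_int b"
    using ab quotient_of_denom_pos quotient_of_coprime quotient_of_div by blast+
  have Nq: "N (of_int a) / N (of_int b) \<le> 1"
  proof -
    have "N (of_rat q) \<le> 1" using N_ultra_diff[of x "x - of_rat q"] assms q e by simp
    then show ?thesis by (simp add: b(3) of_rat_divide N_divide)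
  qed
  have pb: "\<not> int p dvd b"
  proof
    assume "int p dvd b"
    then have "\<not> int p dvd a" using b(2) prime_p by (metis coprime_common_divisor not_prime_unit prime_nat_int_transfer)
    then have "N (of_int a) = 1" "N (of_int b) < 1" "0 < N (of_int b)"
      using N_of_int_unit N_of_int_lt_1_iff \<open>int p dvd b\<close> b(1) by (auto intro: N_pos)
    then show False using Nq by (simp add: field_simps)
  qed
  then have "coprime b (int p ^ Suc k)" using prime_p by (metis coprime_commute coprime_power_right_iff prime_imp_coprime prime_nat_int_transfer)
  then obtain b' where "[b * b' = 1] (mod int p ^ Suc k)" using cong_solve_coprime_int by blast
  then have "int p ^ Suc k dvd a * (1 - b * b')" by (metis cong_iff_dvd_diff cong_sym dvd_mult)
  then have 1: "N (of_int (a * (1 - b * b'))) \<le> ?e" by (rule N_of_int_dvd)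
  have "of_rat q - of_int (a * b') = (of_int (a * (1 - b * b')) / of_int b :: 'k)"
    using b(1) by (simp add: b(3) of_rat_divide field_simps)
  then have "N (of_rat q - of_int (a * b')) \<le> ?e" using 1 by (simp only: N_divide N_of_int_unit[OF pb])
  then have "N (x - of_int (a * b')) \<le> ?e" using N_ultra[of "x - of_rat q" "of_rat q - of_int (a * b')"] q by simp
  also have "?e < real p powi (- int k)" using p_gt_1 by (intro power_int_strict_increasing) auto
  finally show ?thesis by blast
qed

text \<open>Square classes are open, so each contains a rational number and therefore an integer.\<close>

lemma int_square_class:
  fixes x :: 'k
  assumes "x \<noteq> 0"
  shows "\<exists>m w. m \<noteq> 0 \<and> w \<noteq> 0 \<and> x = of_int m * w\<^sup>2"
proof -
  have "0 < N (4 * x)" using assms by (intro N_pos) simp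
  then obtain q where q: "N (x - of_rat q) < N (4 * x)" using dense by blast
  have "N 4 \<le> 1" using N_of_int_le_1[of 4] by simp
  then have "N (4 * x) \<le> N x" by (simp add: N_mult mult_left_le_one_le N_nonneg)
  then have Nq: "N (of_rat q) = N x" using q by (intro N_eq_of_close) simp
  then have q0: "of_rat q \<noteq> (0 :: 'k)" using assms N_0_iff by metis
  have "N (x - of_rat q) < N (4 * of_rat q)" using q Nq by (simp add: N_mult)
  then obtain w where w: "x = of_rat q * w\<^sup>2" using square_class_open[OF q0] by blast
  obtain a b where ab: "quotient_of q = (a, b)" by (cases "quotient_of q")
  have b: "b > 0" "q = of_int a / of_int b"
    using ab quotient_of_denom_pos quotient_of_div by blast+
  have "x = of_int (a * b) * (w / of_int b)\<^sup>2"
    using b(1) by (simp add: w b(2) of_rat_divide power2_eq_square field_simps)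
  moreover have "a * b \<noteq> 0" "w / of_int b \<noteq> 0" using b q0 assms w by auto
  ultimately show ?thesis by blast
qed

lemma unit_square_class:
  fixes x :: 'k
  assumes "x \<noteq> 0"
  obtains u w where "\<not> int p dvd u" "w \<noteq> 0" "x = of_int u * w\<^sup>2"
        | u w where "\<not> int p dvd u" "w \<noteq> 0" "x = of_int (int p) * of_int u * w\<^sup>2"
proof -
  obtain m v where m: "m \<noteq> 0" "v \<noteq> 0" "x = of_int m * v\<^sup>2" using int_square_class[OF assms] by blast
  have "\<not> is_unit (int p)" using p_gt_1 by simp
  then obtain u where u: "m = int p ^ multiplicity (int p) m * u" "\<not> int p dvd u"
    using multiplicity_decompose'[of m "int p"] m(1) by metis
  define k where "k = multiplicity (int p) m"
  have x: "x = of_int (int p) ^ k * of_int u * v\<^sup>2" using arg_cong[OF u(1), of "of_int :: int \<Rightarrow> 'k"] unfolding m(3) k_def by simp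
  have p0: "of_nat p \<noteq> (0 :: 'k)" using p_gt_1 by simp
  show ?thesis
  proof (cases "even k")
    case True
    then obtain j where "k = 2 * j" by (elim evenE)
    then have "x = of_int u * (of_nat p ^ j * v)\<^sup>2" by (simp add: x power_mult_distrib power_mult[symmetric] mult.commute)
    then show ?thesis by (rule that(1)[rotated 2]) (use u(2) m(2) p0 in auto)
  next
    case False
    then obtain j where "k = 2 * j + 1" by (elim oddE)
    then have "x = of_int (int p) * of_int u * (of_nat p ^ j * v)\<^sup>2" by (simp add: x power_mult_distrib power_mult[symmetric] mult.commute)
    then show ?thesis by (rule that(2)[rotated 2]) (use u(2) m(2) p0 in auto)
  qed
qed

lemma p_not_square: "of_int (int p) \<noteq> (w :: 'k)\<^sup>2"
  using N_sq_neq_odd[of 1 w 1] by auto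

text \<open>Take the least positive integer that is not a square; the one before it is a square. Such an
  integer exists since \<open>p\<close> is not a square.\<close>

lemma one_plus_square_nonsquare: "\<exists>u :: 'k. 1 + u\<^sup>2 \<noteq> 0 \<and> (\<nexists>w. 1 + u\<^sup>2 = w\<^sup>2)"
proof -
  let ?P = "\<lambda>n. 1 \<le> n \<and> (\<nexists>w :: 'k. of_nat n = w\<^sup>2)"
  have "?P p" using p_not_square p_gt_1 by auto
  then have P: "?P (LEAST n. ?P n)" by (rule LeastI)
  define n where "n = (LEAST n. ?P n)"
  have n1: "n \<noteq> 1" using P unfolding n_def[symmetric] by (metis of_nat_1 one_power2)
  have "\<not> ?P (n - 1)" using P n1 not_less_Least[of "n - 1" ?P] unfolding n_def[symmetric] by auto
  then obtain u :: 'k where u: "of_nat (n - 1) = u\<^sup>2" using P n1 unfolding n_def[symmetric] by auto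
  have "of_nat n = 1 + u\<^sup>2" unfolding u[symmetric] using P unfolding n_def[symmetric] by (simp add: of_nat_diff)
  moreover have "of_nat n \<noteq> (0 :: 'k)" using P unfolding n_def[symmetric] by simp
  ultimately show ?thesis using P unfolding n_def[symmetric] by metis
qed

lemma N_diff_eq_max: "N x \<noteq> N y \<Longrightarrow> N (x - y) = max (N x) (N y)"
  using N_ultra_eq[of "- y" x] N_ultra_eq[of x "- y"] by (cases "N x < N y") (auto simp: max_def)

context
  assumes odd_p: "2 < p"
begin

lemma N_4_odd: "N 4 = 1"
proof -
  have "\<not> int p dvd 2 ^ 2"
  proof
    assume "int p dvd 2 ^ 2"
    then have "int p dvd 2" using prime_p by (metis prime_dvd_power prime_nat_int_transfer)
    then show False using odd_p zdvd_imp_le[of "int p" 2] by simp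
  qed
  then show ?thesis using N_of_int_unit[of 4] by simp
qed

text \<open>For odd \<open>p\<close>, Hensel's lemma reduces square classes of units to residues modulo \<open>p\<close>.\<close>

lemma unit_square_mod:
  assumes "\<not> int p dvd u" "int p dvd u - v * s\<^sup>2"
  shows "\<exists>w :: 'k. of_int u = of_int v * w\<^sup>2"
proof -
  have "\<not> int p dvd v * s\<^sup>2" using assms dvd_add[of "int p" "u - v * s\<^sup>2" "v * s\<^sup>2"] by auto
  then have "N (of_int (v * s\<^sup>2)) = 1" by (rule N_of_int_unit)
  then have 1: "N (4 * of_int (v * s\<^sup>2)) = 1" "of_int (v * s\<^sup>2) \<noteq> (0::'k)" by (auto simp: N_mult N_4_odd simp del: of_int_mult)
  have "N (of_int u - of_int (v * s\<^sup>2)) < 1" using assms(2) N_of_int_lt_1_iff[of "u - v * s\<^sup>2"] by simp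
  then obtain w where "of_int u = (of_int (v * s\<^sup>2) :: 'k) * w\<^sup>2" using square_class_open[of "of_int (v * s\<^sup>2)" "of_int u"] 1 by auto
  then have "of_int u = (of_int v :: 'k) * (of_int s * w)\<^sup>2" by (simp add: power_mult_distrib mult.assoc)
  then show ?thesis by blast
qed

lemma nonsquare_unit_not_QuadRes:
  assumes "\<not> int p dvd u" "\<nexists>w :: 'k. of_int u = w\<^sup>2"
  shows "\<not> QuadRes (int p) u"
proof
  assume "QuadRes (int p) u"
  then obtain s where "[s\<^sup>2 = u] (mod int p)" by (auto simp: QuadRes_def)
  then have "int p dvd u - 1 * s\<^sup>2" by (simp add: cong_iff_dvd_diff dvd_diff_commute)
  then show False using unit_square_mod[OF assms(1), of 1 s] assms(2) by auto
qed

lemma nonsquare_units_mult: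
  assumes u: "\<not> int p dvd u" "\<nexists>w :: 'k. of_int u = w\<^sup>2" and v: "\<not> int p dvd v" "\<nexists>w :: 'k. of_int v = w\<^sup>2"
  shows "\<exists>w :: 'k. of_int (u * v) = w\<^sup>2"
proof (rule ccontr)
  assume nsq: "\<nexists>w :: 'k. of_int (u * v) = w\<^sup>2"
  have uv: "\<not> int p dvd u * v" using u v prime_p by (simp add: prime_dvd_mult_iff)
  have L: "Legendre m (int p) = - 1" if "\<not> int p dvd m" "\<not> QuadRes (int p) m" for m
    using that by (auto simp: Legendre_def cong_0_iff)
  have e: "[- 1 = m ^ ((p - 1) div 2)] (mod int p)" if "\<not> int p dvd m" "\<nexists>w :: 'k. of_int m = w\<^sup>2" for m
    using euler_criterion[OF prime_p odd_p, of m] L[OF that(1) nonsquare_unit_not_QuadRes[OF that]] by simp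
  have "[(- 1) * (- 1) = u ^ ((p - 1) div 2) * v ^ ((p - 1) div 2)] (mod int p)"
    using e[OF u] e[OF v] by (rule cong_mult)
  moreover have "[- 1 = u ^ ((p - 1) div 2) * v ^ ((p - 1) div 2)] (mod int p)"
    using e[OF uv nsq] by (simp add: power_mult_distrib)
  ultimately have "[(- 1) * (- 1) = - 1] (mod int p)" by (meson cong_sym cong_trans)
  then have "int p dvd 2" by (simp add: cong_iff_dvd_diff)
  then show False using odd_p zdvd_imp_le[of "int p" 2] by simp
qed

text \<open>Squaring is not injective modulo \<open>p\<close>, because \<open>1\<close> and \<open>p - 1\<close> have the same square, so it is not
  surjective either. A residue that is missed stays a nonsquare in the completion.\<close>

lemma ex_nonsquare_unit: "\<exists>v. \<not> int p dvd v \<and> (\<nexists>w :: 'k. of_int v = w\<^sup>2)"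
proof -
  let ?f = "\<lambda>s :: int. s\<^sup>2 mod int p"
  have "\<not> inj_on ?f {0..<int p}"
  proof
    assume inj: "inj_on ?f {0..<int p}"
    have "?f 1 = ?f (int p - 1)"
      by (simp add: mod_eq_dvd_iff power2_eq_square algebra_simps)
    then have "1 = int p - 1" using odd_p inj_onD[OF inj, of 1 "int p - 1"] by auto
    then show False using odd_p by simp
  qed
  then have "?f ` {0..<int p} \<noteq> {0..<int p}" by (metis eq_card_imp_inj_on finite_atLeastLessThan_int)
  moreover have "?f ` {0..<int p} \<subseteq> {0..<int p}" using p_gt_1 by auto
  ultimately obtain v where v: "v \<in> {0..<int p}" "v \<notin> ?f ` {0..<int p}" by blast
  have nr: "\<not> int p dvd v - m\<^sup>2" for m
  proof
    assume "int p dvd v - m\<^sup>2"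
    then have "v mod int p = m\<^sup>2 mod int p" by (simp add: mod_eq_dvd_iff)
    then have "v = ?f (m mod int p)" using v(1) by (simp add: power_mod)
    then show False using v(2) p_gt_1 by auto
  qed
  then have "\<not> int p dvd v" using nr[of 0] by simp
  moreover have "of_int v \<noteq> w\<^sup>2" for w :: 'k
  proof
    assume w: "of_int v = w\<^sup>2"
    then have "N w ^ 2 = 1" using N_of_int_unit[OF \<open>\<not> int p dvd v\<close>] by (simp flip: N_power)
    then have w1: "N w = 1" using N_nonneg[of w] by (simp add: power2_eq_1_iff)
    then obtain m :: int where m: "N (w - of_int m) < 1" using approx_int[of w 0] by auto
    have "N (w + of_int m) \<le> 1" using N_ultra[of w "of_int m"] N_of_int_le_1[of m] w1 by simp
    then have "N (w - of_int m) * N (w + of_int m) < 1"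
      using m N_nonneg by (metis le_less_trans mult_left_le)
    also have "N (w - of_int m) * N (w + of_int m) = N (of_int (v - m\<^sup>2))"
      by (simp add: w power2_eq_square algebra_simps flip: N_mult)
    finally show False using nr N_of_int_lt_1_iff by blast
  qed
  ultimately show ?thesis by blast
qed

lemma unit_norms_odd:
  assumes u: "\<not> int p dvd u" and v: "\<not> int p dvd v"
  shows "norm_of (of_int u :: 'k) (of_int v)"
proof -
  have p: "prime (int p)" "2 < int p" using prime_p odd_p by auto
  obtain s t where "int p dvd 1 * s\<^sup>2 + (- u) * t\<^sup>2 - v"
    using binary_form_universal_mod[OF p, of 1 "- u" v] u p_gt_1 by auto
  then have "int p dvd v - (s\<^sup>2 - u * t\<^sup>2) * 1\<^sup>2" by (subst dvd_diff_commute) (simp add: algebra_simps)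
  then obtain w :: 'k where "of_int v = of_int (s\<^sup>2 - u * t\<^sup>2) * w\<^sup>2" using unit_square_mod[OF v] by blast
  moreover have "norm_of (of_int u :: 'k) (of_int (s\<^sup>2 - u * t\<^sup>2))"
    unfolding norm_of_def by (intro exI[of _ "of_int s"] exI[of _ "of_int t"]) simp
  ultimately show ?thesis using norm_of_mult norm_of_square by metis
qed

text \<open>For a unit \<open>x\<close> all norms have even valuation, so \<open>p\<close> is not a norm. For \<open>x\<close> of odd valuation a unit can
  be a norm only if it is a square.\<close>

lemma norm_group_proper_odd:
  assumes x: "x \<noteq> 0" "\<nexists>w :: 'k. x = w\<^sup>2"
  shows "\<exists>y. y \<noteq> 0 \<and> \<not> norm_of x y"
  using x(1)
proof (cases rule: unit_square_class)
  case (1 u w)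
  have "\<not> norm_of (of_int u) (of_int (int p) :: 'k)"
  proof
    assume "norm_of (of_int u) (of_int (int p) :: 'k)"
    then obtain s t :: 'k where st: "of_int (int p) = s\<^sup>2 - of_int u * t\<^sup>2" unfolding norm_of_def by blast
    have Nu: "N (of_int u * t\<^sup>2) = N (t\<^sup>2)" using N_of_int_unit[OF 1(1)] by (simp add: N_mult)
    have ne: "N (r\<^sup>2) \<noteq> N (of_int (int p))" for r using N_sq_neq_odd[of 1 r 1] by auto
    have "N (s\<^sup>2) = N (t\<^sup>2)"
    proof (rule ccontr)
      assume "N (s\<^sup>2) \<noteq> N (t\<^sup>2)"
      then have "N (of_int (int p)) = max (N (s\<^sup>2)) (N (t\<^sup>2))"
        using N_diff_eq_max[of "s\<^sup>2" "of_int u * t\<^sup>2"] Nu unfolding st[symmetric] by simp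
      then show False using ne[of s] ne[of t] by (auto simp: max_def split: if_splits)
    qed
    then have "N (of_int (int p)) < N (t\<^sup>2)"
      using N_ultra_diff[of "s\<^sup>2" "of_int u * t\<^sup>2"] ne[of t] Nu unfolding st[symmetric] by auto
    then have lt: "N (s\<^sup>2 - of_int u * t\<^sup>2) < N (4 * (of_int u * t\<^sup>2))" using Nu unfolding st[symmetric] by (simp only: N_mult[of 4] N_4_odd mult_1)
    have t0: "t \<noteq> 0" using \<open>N (of_int (int p)) < N (t\<^sup>2)\<close> N_nonneg[of "of_int (int p)"] by auto
    have "of_int u * t\<^sup>2 \<noteq> 0" using t0 1 x by auto
    then obtain v where "s\<^sup>2 = of_int u * t\<^sup>2 * v\<^sup>2" using square_class_open[OF _ lt] by blast
    moreover have "v \<noteq> 0" using \<open>N (s\<^sup>2) = N (t\<^sup>2)\<close> t0 N_pos[of "t\<^sup>2"] calculation by auto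
    ultimately have u: "of_int u = (s / (t * v))\<^sup>2" using t0 by (simp add: power_divide power_mult_distrib field_simps)
    have "x = (s / (t * v) * w)\<^sup>2" unfolding power_mult_distrib u[symmetric] by (rule 1(3))
    then show False using x(2) by blast
  qed
  then show ?thesis using 1 p_gt_1 norm_of_times_square_iff(2)[OF 1(2)] by (intro exI[of _ "of_int (int p)"]) auto
next
  case (2 u w)
  obtain v where v: "\<not> int p dvd v" "\<nexists>w :: 'k. of_int v = w\<^sup>2" using ex_nonsquare_unit by blast
  have "\<not> norm_of (of_int (int p) * of_int u :: 'k) (of_int v)"
  proof
    assume "norm_of (of_int (int p) * of_int u :: 'k) (of_int v)"
    then obtain s t :: 'k where st: "of_int v = s\<^sup>2 - of_int (int p) * of_int u * t\<^sup>2" unfolding norm_of_def by blast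
    have v1: "N (of_int v) = 1" and u1: "N (of_int u) = 1" using v 2 by (simp_all add: N_of_int_unit)
    have "\<not> (s = 0 \<and> t = 0)" using st v1 by auto
    then have ne: "N (s\<^sup>2) \<noteq> N (of_int (int p) * of_int u * t\<^sup>2)" using N_sq_neq_odd[OF u1] by blast
    have ne1: "N (of_int (int p) * of_int u * t\<^sup>2) \<noteq> 1" using N_sq_neq_odd[OF u1, of 1 t] by auto
    have "max (N (s\<^sup>2)) (N (of_int (int p) * of_int u * t\<^sup>2)) = 1" using N_diff_eq_max[OF ne] v1 unfolding st[symmetric] by simp
    then have s1: "N (s\<^sup>2) = 1" "N (of_int (int p) * of_int u * t\<^sup>2) < 1" using ne1 ne by (auto simp: max_def split: if_splits)
    then have "N (of_int v - s\<^sup>2) < N (4 * s\<^sup>2)" by (simp add: st N_mult[of 4] N_4_odd)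
    moreover have "s\<^sup>2 \<noteq> 0" using s1 by auto
    ultimately obtain r where "of_int v = s\<^sup>2 * r\<^sup>2" using square_class_open by blast
    then show False using v(2) by (metis power_mult_distrib)
  qed
  then show ?thesis using v(1) norm_of_times_square_iff(2)[OF 2(2)] 2(3) by (intro exI[of _ "of_int v"]) auto
qed

text \<open>For a unit \<open>x\<close> the norm group contains all units, so two elements outside it both have odd
  valuation. For \<open>x\<close> of odd valuation, multiplication with the norm \<open>-x\<close> reduces to units, and the
  product of two nonsquare units is a square.\<close>

lemma norm_group_index_odd:
  assumes x: "x \<noteq> 0" "\<nexists>w :: 'k. x = w\<^sup>2" and y: "y \<noteq> 0" "\<not> norm_of x y" and z: "z \<noteq> 0" "\<not> norm_of x z"
  shows "norm_of x (y * z)"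
  using x(1)
proof (cases rule: unit_square_class)
  case (1 u w)
  have nx: "norm_of x a \<longleftrightarrow> norm_of (of_int u) a" for a using norm_of_times_square_iff(2)[OF 1(2)] 1(3) by simp
  have form: "\<exists>v r. \<not> int p dvd v \<and> r \<noteq> 0 \<and> a = of_int (int p) * of_int v * r\<^sup>2" if "a \<noteq> 0" "\<not> norm_of x a" for a
    using that(1)
  proof (cases rule: unit_square_class)
    case (1 v r)
    then show ?thesis using that(2) nx norm_of_times_square_iff(1) unit_norms_odd[OF \<open>\<not> int p dvd u\<close>] by metis
  qed blast
  obtain v r v' r' where v: "\<not> int p dvd v" "r \<noteq> 0" "y = of_int (int p) * of_int v * r\<^sup>2"
     "\<not> int p dvd v'" "r' \<noteq> 0" "z = of_int (int p) * of_int v' * r'\<^sup>2"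
    using form[OF y] form[OF z] by blast
  have "\<not> int p dvd v * v'" using v prime_p by (simp add: prime_dvd_mult_iff)
  then have "norm_of x (of_int (v * v') * (of_int (int p) * r * r')\<^sup>2)"
    unfolding nx using unit_norms_odd[OF 1(1)] by (intro norm_of_mult norm_of_square)
  also have "of_int (v * v') * (of_int (int p) * r * r')\<^sup>2 = y * z" by (simp add: v power2_eq_square algebra_simps)
  finally show ?thesis .
next
  case (2 u w)
  have nx: "norm_of x a \<longleftrightarrow> norm_of (of_int (int p) * of_int u) a" for a using norm_of_times_square_iff(2)[OF 2(2)] 2(3) by simp
  let ?x = "of_int (int p) * of_int u :: 'k"
  have x0: "?x \<noteq> 0" using 2 x by auto
  have form: "\<exists>v r n. \<not> int p dvd v \<and> r \<noteq> 0 \<and> n \<noteq> 0 \<and> norm_of ?x n \<and> a * n = of_int v * r\<^sup>2" if "a \<noteq> 0" for a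
    using that
  proof (cases rule: unit_square_class)
    case (1 v r)
    then show ?thesis by (intro exI[of _ v] exI[of _ r] exI[of _ 1]) (use norm_of_square[of ?x 1] in auto)
  next
    case (2 v r)
    then have "a * - ?x = of_int (- u * v) * (of_int (int p) * r)\<^sup>2" by (simp add: power2_eq_square algebra_simps)
    moreover have "\<not> int p dvd - u * v" using 2 \<open>\<not> int p dvd u\<close> prime_p by (simp add: prime_dvd_mult_iff)
    moreover have "of_int (int p) * r \<noteq> 0" using 2 p_gt_1 by simp
    ultimately show ?thesis using norm_of_neg[of ?x] x0 by (metis neg_equal_0_iff_equal)
  qed
  obtain v r n where v: "\<not> int p dvd v" "r \<noteq> 0" "n \<noteq> 0" "norm_of ?x n" "y * n = of_int v * r\<^sup>2" using form[OF y(1)] by blast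
  obtain v' r' n' where v': "\<not> int p dvd v'" "r' \<noteq> 0" "n' \<noteq> 0" "norm_of ?x n'" "z * n' = of_int v' * r'\<^sup>2" using form[OF z(1)] by blast
  have nsq: "\<nexists>q :: 'k. of_int m = q\<^sup>2" if "a * k = of_int m * q\<^sup>2" "norm_of ?x k" "k \<noteq> 0" "\<not> norm_of x a" for a k m q
  proof
    assume "\<exists>q :: 'k. of_int m = q\<^sup>2"
    then have "norm_of ?x (k * a)" using that(1) norm_of_square norm_of_mult by (metis mult.commute)
    then show False using norm_of_cancel that nx by blast
  qed
  obtain q :: 'k where q: "of_int (v * v') = q\<^sup>2"
    using nonsquare_units_mult[OF v(1) nsq[OF v(5,4,3) y(2)] v'(1) nsq[OF v'(5,4,3) z(2)]] by blast
  have "(n * n') * (y * z) = (q * r * r')\<^sup>2"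
    using v(5) v'(5) q by (simp add: power_mult_distrib) (metis (no_types, lifting) mult.assoc mult.commute mult.left_commute)
  then have "norm_of ?x ((n * n') * (y * z))" using norm_of_square by metis
  then have "norm_of ?x (y * z)" using norm_of_cancel norm_of_mult[OF v(4) v'(4)] v(3) v'(3) by (metis mult_eq_0_iff)
  then show ?thesis using nx by blast
qed

end

context
  assumes p_2: "p = 2"
begin

lemma N_powers_2: "N 2 = 1 / 2" "N 4 = 1 / 4"
proof -
  show 2: "N 2 = 1 / 2" using N_p p_2 by simp
  show "N 4 = 1 / 4" using N_mult[of 2 2] 2 by simp
qed

lemma N_of_int_dvd_8: "8 dvd m \<Longrightarrow> N (of_int m) \<le> 1 / 8"
  using N_of_int_dvd[of 3 m] p_2 by (simp add: power_int_minus)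

lemma N_odd: "odd m \<Longrightarrow> N (of_int m) = 1"
  using N_of_int_unit[of m] p_2 by simp

lemma odd_int_square_mod_8: "odd m \<Longrightarrow> 8 dvd m\<^sup>2 - (1::int)"
proof -
  assume "odd m"
  then obtain k where k: "m = 2 * k + 1" by (elim oddE)
  have "even (k * (k + 1))" by simp
  then obtain l where "k * (k + 1) = 2 * l" by (elim evenE)
  then have "m\<^sup>2 - 1 = 8 * l" by (simp add: k power2_eq_square algebra_simps)
  then show ?thesis by simp
qed

lemma unit_square_mod_8:
  assumes "odd v" "8 dvd u - v"
  shows "\<exists>w :: 'k. of_int u = of_int v * w\<^sup>2"
proof (rule square_class_open)
  show "of_int v \<noteq> (0 :: 'k)" using assms(1) by auto
  have "N (of_int (u - v)) \<le> 1 / 8" using assms(2) by (rule N_of_int_dvd_8)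
  then show "N (of_int u - of_int v) < N (4 * of_int v)" by (simp add: N_mult N_powers_2 N_odd[OF assms(1)])
qed

text \<open>The square of an odd integer is \<open>1\<close> modulo \<open>8\<close>; units are limits of odd integers.\<close>

lemma N_unit_square_minus_1:
  assumes "N x = 1" shows "N (x\<^sup>2 - 1) \<le> 1 / 8"
proof -
  obtain m :: int where m: "N (x - of_int m) < 1 / 8"
    using approx_int[of x 3] assms p_2 by (auto simp: power_int_minus)
  then have "N (of_int m) = 1" using N_eq_of_close[of x "of_int m"] assms by simp
  then have "odd m" using N_of_int_lt_1_iff[of m] p_2 by auto
  then have 1: "N (of_int (m\<^sup>2 - 1)) \<le> 1 / 8" by (intro N_of_int_dvd_8 odd_int_square_mod_8)
  have "N (x + of_int m) \<le> 1" using N_ultra[of x "of_int m"] assms \<open>N (of_int m) = 1\<close> by simp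
  then have 2: "N ((x - of_int m) * (x + of_int m)) \<le> 1 / 8"
    using m N_nonneg[of "x - of_int m"] mult_left_le[of "N (x + of_int m)" "N (x - of_int m)"] by (simp add: N_mult)
  have "x\<^sup>2 - 1 = (x - of_int m) * (x + of_int m) + of_int (m\<^sup>2 - 1)" by (simp add: power2_eq_square algebra_simps)
  then show ?thesis using N_ultra[of "(x - of_int m) * (x + of_int m)" "of_int (m\<^sup>2 - 1)"] 1 2 by (simp only:)
qed

lemma N_square_neq:
  assumes "odd j" shows "(N s)\<^sup>2 \<noteq> 2 powi j"
proof
  assume eq: "(N s)\<^sup>2 = 2 powi j"
  then have "s \<noteq> 0" by auto
  then obtain k where k: "N s = 2 powi k" using value_group p_2 by auto
  have "real p powi (k + k) = real p powi j" using eq p_gt_1 by (subst power_int_add) (simp_all add: k p_2 power2_eq_square)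
  then have "k + k = j" by (rule powi_p_inject)
  then show False using assms by auto
qed

text \<open>For units \<open>s\<close> and \<open>t\<close> the number \<open>s\<^sup>2 - 5 t\<^sup>2\<close> is \<open>-4\<close> modulo \<open>8\<close>, so norms from the field of \<open>\<surd>5\<close> have
  even valuation.\<close>

lemma not_norm_5_2: "\<not> norm_of 5 (2 :: 'k)"
proof
  assume "norm_of 5 (2 :: 'k)"
  then obtain s t :: 'k where st: "2 = s\<^sup>2 - 5 * t\<^sup>2" unfolding norm_of_def by blast
  have N5: "N 5 = 1" using N_odd[of 5] by simp
  have ne: "(N r)\<^sup>2 \<noteq> 1 / 2" for r using N_square_neq[of "- 1" r] by (simp add: power_int_minus)
  show False
  proof (cases "N (s\<^sup>2) = N (5 * t\<^sup>2)")
    case False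
    then have "1 / 2 = max ((N s)\<^sup>2) ((N t)\<^sup>2)"
      using N_diff_eq_max[of "s\<^sup>2" "5 * t\<^sup>2"] unfolding st[symmetric] by (simp add: N_powers_2 N_mult N5 N_power)
    then show False using ne[of s] ne[of t] by (auto simp: max_def split: if_splits)
  next
    case True
    then have eq: "N s = N t" using N_nonneg by (simp add: N_mult N5 N_power)
    have t0: "t \<noteq> 0" using st eq N_0_iff[of s] N_0_iff[of t] by auto
    have "N (s / t) = 1" using eq t0 N_pos[of t] by (simp add: N_divide)
    then have "N ((s / t)\<^sup>2 - 1) \<le> 1 / 8" by (rule N_unit_square_minus_1)
    then have "N (- 4 + ((s / t)\<^sup>2 - 1)) = 1 / 4" using N_ultra_eq[of "(s / t)\<^sup>2 - 1" "- 4"] by (simp add: N_powers_2)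
    moreover have "2 = t\<^sup>2 * (- 4 + ((s / t)\<^sup>2 - 1))" unfolding st using t0 by (simp add: power_divide algebra_simps)
    ultimately have "1 / 2 = (N t)\<^sup>2 * (1 / 4)" by (metis N_mult N_power N_powers_2(1))
    then have "(N t)\<^sup>2 = 2" by simp
    then show False using N_square_neq[of 1 t] by simp
  qed
qed

text \<open>If \<open>s\<close> and \<open>t\<close> have the same valuation, then \<open>s\<^sup>2 + t\<^sup>2\<close> has odd valuation; otherwise a sum of two
  squares that is a unit is \<open>1\<close> modulo \<open>4\<close>.\<close>

lemma not_sum_two_squares:
  fixes m :: int
  assumes "4 dvd m - 3" shows "\<not> norm_of (- 1) (of_int m :: 'k)"
proof
  assume "norm_of (- 1) (of_int m :: 'k)"
  then obtain s t :: 'k where st: "of_int m = s\<^sup>2 + t\<^sup>2" unfolding norm_of_def by auto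
  have "odd m" using assms by presburger
  then have Nm: "N (of_int m) = 1" by (rule N_odd)
  have no: False if st: "of_int m = s\<^sup>2 + t\<^sup>2" and lt: "N t < N s" for s t :: 'k
  proof -
    have "N (t\<^sup>2) < N (s\<^sup>2)" using lt N_nonneg by (simp add: N_power power_strict_mono)
    then have "N (s\<^sup>2) = 1" using N_ultra_eq[of "t\<^sup>2" "s\<^sup>2"] Nm st by simp
    then have s1: "N s = 1" using N_nonneg[of s] by (simp add: N_power power2_eq_1_iff)
    have t2: "N t \<le> 1 / 2"
    proof (cases "t = 0")
      case False
      then obtain k where k: "N t = 2 powi k" using value_group p_2 by auto
      have "k < 0"
      proof (rule ccontr)
        assume "\<not> k < 0"
        then have "(2::real) powi 0 \<le> 2 powi k" by (intro power_int_increasing) auto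
        then show False using lt s1 k by simp
      qed
      then have "2 powi k \<le> (2 powi (- 1) :: real)" by (intro power_int_increasing) auto
      then show ?thesis by (simp add: k power_int_minus)
    qed simp
    have "N (t\<^sup>2) \<le> (1 / 2)\<^sup>2" unfolding N_power using t2 N_nonneg by (intro power_mono)
    moreover have "N (s\<^sup>2 - 1) \<le> 1 / 8" using s1 by (rule N_unit_square_minus_1)
    ultimately have "N ((s\<^sup>2 - 1) + t\<^sup>2) \<le> 1 / 4" using N_ultra[of "s\<^sup>2 - 1" "t\<^sup>2"] by (simp add: power2_eq_square)
    also have "(s\<^sup>2 - 1) + t\<^sup>2 = of_int (m - 1)" using st by simp
    finally have small: "N (of_int (m - 1)) \<le> 1 / 4" .
    have "odd ((m - 1) div 2)" "m - 1 = 2 * ((m - 1) div 2)" using assms by presburger+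
    then have "N (of_int (m - 1)) = 1 / 2" using N_mult[of 2 "of_int ((m - 1) div 2)"] N_odd[of "(m - 1) div 2"] N_powers_2
      by (metis mult.right_neutral of_int_mult of_int_numeral)
    then show False using small by simp
  qed
  consider "N t < N s" | "N s < N t" | "N s = N t" by linarith
  then show False
  proof cases
    case 1
    then show False using no st by blast
  next
    case 2
    then show False using no[of t s] st by (simp add: add.commute)
  next
    case 3
    have t0: "t \<noteq> 0" using st 3 N_0_iff[of s] N_0_iff[of t] Nm by auto
    have "N (s / t) = 1" using 3 t0 N_pos[of t] by (simp add: N_divide)
    then have "N ((s / t)\<^sup>2 - 1) \<le> 1 / 8" by (rule N_unit_square_minus_1)
    then have "N (2 + ((s / t)\<^sup>2 - 1)) = 1 / 2" using N_ultra_eq[of "(s / t)\<^sup>2 - 1" 2] by (simp add: N_powers_2)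
    moreover have "of_int m = t\<^sup>2 * (2 + ((s / t)\<^sup>2 - 1))" unfolding st using t0 by (simp add: power_divide algebra_simps)
    ultimately have "1 = (N t)\<^sup>2 * (1 / 2)" by (metis N_mult N_power Nm)
    then have "(N t)\<^sup>2 = 2" by simp
    then show False using N_square_neq[of 1 t] by simp
  qed
qed

text \<open>The arithmetic test used for the table below: \<open>n\<close> is a norm, and \<open>y n\<close> is a square because \<open>m\<close> is
  \<open>1\<close> modulo \<open>8\<close>.\<close>

lemma norm_of_int_dyadic:
  fixes x y :: int
  assumes n: "n = s\<^sup>2 - x * t\<^sup>2" "n \<noteq> 0" and m: "y * n = q\<^sup>2 * m" "8 dvd m - 1"
  shows "norm_of (of_int x :: 'k) (of_int y)"
proof -
  obtain w :: 'k where w: "of_int m = of_int 1 * w\<^sup>2" using unit_square_mod_8[of 1 m] m(2) by auto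
  have "of_int n * of_int y = ((of_int q * w)\<^sup>2 :: 'k)"
    using arg_cong[OF m(1), of "of_int :: int \<Rightarrow> 'k"] w by (simp add: power_mult_distrib mult.commute)
  then have "norm_of (of_int x :: 'k) (of_int n * of_int y)" using norm_of_square by metis
  moreover have "norm_of (of_int x :: 'k) (of_int n)" unfolding norm_of_def n(1) by (intro exI[of _ "of_int s"] exI[of _ "of_int t"]) simp
  moreover have "(of_int n :: 'k) \<noteq> 0" using n(2) by simp
  ultimately show ?thesis by (rule norm_of_cancel)
qed

text \<open>Odd integers are classified by their residue modulo \<open>8\<close>.\<close>

lemma dyadic_square_class:
  fixes x :: 'k
  assumes "x \<noteq> 0"
  obtains r w where "r \<in> {1, -1, 5, -5, 2, -2, 10, -10 :: int}" "w \<noteq> 0" "x = of_int r * w\<^sup>2"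
proof -
  have unit: "\<exists>r w. r \<in> {1, -1, 5, -5 :: int} \<and> w \<noteq> 0 \<and> of_int u = (of_int r * w\<^sup>2 :: 'k)" if "odd u" for u
  proof -
    have "8 dvd u - 1 \<or> 8 dvd u - (-1) \<or> 8 dvd u - 5 \<or> 8 dvd u - (-5)" using that by presburger
    then obtain r where r: "r \<in> {1, -1, 5, -5 :: int}" "8 dvd u - r" by blast
    then have "odd r" by auto
    then obtain w :: 'k where "of_int u = of_int r * w\<^sup>2" using unit_square_mod_8 r(2) by blast
    moreover have "w \<noteq> 0" using calculation that by auto
    ultimately show ?thesis using r(1) by blast
  qed
  show ?thesis
    using assms
  proof (cases rule: unit_square_class)
    case (1 u w)
    then obtain r v where "r \<in> {1, -1, 5, -5 :: int}" "v \<noteq> 0" "of_int u = (of_int r * v\<^sup>2 :: 'k)" using unit[of u] p_2 by auto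
    then show ?thesis using 1 by (intro that[of r "v * w"]) (auto simp: power_mult_distrib)
  next
    case (2 u w)
    then obtain r v where r: "r \<in> {1, -1, 5, -5 :: int}" "v \<noteq> 0" "of_int u = (of_int r * v\<^sup>2 :: 'k)" using unit[of u] p_2 by auto
    show ?thesis
    proof (rule that[of "2 * r" "v * w"])
      show "2 * r \<in> {1, -1, 5, -5, 2, -2, 10, -10}" using r(1) by auto
      show "x = of_int (2 * r) * (v * w)\<^sup>2" using 2(3) r(3) p_2 by (simp add: power_mult_distrib)
    qed (use 2 r in auto)
  qed
qed

text \<open>The classes of \<open>-1\<close>, \<open>2\<close> and \<open>5\<close> generate the group of square classes, so it suffices to find one
  \<open>c\<close> such that each generator is a norm up to a factor \<open>1\<close> or \<open>c\<close>.\<close>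

lemma norm_index_dyadic_int:
  fixes x :: int
  assumes "x \<in> {-1, 5, -5, 2, -2, 10, -10}"
  shows "\<exists>c. c \<noteq> 0 \<and> (\<forall>g\<in>{-1, 2, 5 :: int}. norm_of (of_int x :: 'k) (of_int g) \<or> norm_of (of_int x :: 'k) (of_int (g * c)))"
proof -
  note I = norm_of_int_dyadic
  from assms show ?thesis
  proof (elim insertE emptyE)
    assume "x = -1"
    then show ?thesis
      using I[of 1 1 "-1" 0 1 1 1] I[of 2 1 "-1" 1 2 2 1] I[of 5 2 "-1" 1 5 5 1] by (intro exI[of _ "-1"]) simp
  next
    assume "x = 5"
    then show ?thesis
      using I[of "-1" 2 5 1 "-1" 1 1] I[of 4 2 5 0 4 4 1] I[of 5 5 5 2 5 5 1] by (intro exI[of _ 2]) simp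
  next
    assume "x = -5"
    then show ?thesis
      using I[of 1 1 "-5" 0 1 1 1] I[of 14 3 "-5" 1 "-2" 2 "-7"] I[of 5 0 "-5" 1 5 5 1] by (intro exI[of _ "-1"]) simp
  next
    assume "x = 2"
    then show ?thesis
      using I[of "-1" 1 2 1 "-1" 1 1] I[of 2 2 2 1 2 2 1] I[of 1 1 2 0 25 5 1] by (intro exI[of _ 5]) simp
  next
    assume "x = -2"
    then show ?thesis
      using I[of 1 1 "-2" 0 1 1 1] I[of 2 0 "-2" 1 2 2 1] I[of 3 1 "-2" 1 "-5" 1 "-15"] by (intro exI[of _ "-1"]) simp
  next
    assume "x = 10"
    then show ?thesis
      using I[of "-1" 3 10 1 "-1" 1 1] I[of 10 10 10 3 10 10 1] I[of 1 1 10 0 25 5 1] by (intro exI[of _ 5]) simp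
  next
    assume "x = -10"
    then show ?thesis
      using I[of 1 1 "-10" 0 1 1 1] I[of 14 2 "-10" 1 "-2" 2 "-7"] I[of 11 1 "-10" 1 "-5" 1 "-55"] by (intro exI[of _ "-1"]) simp
  qed
qed

lemma norm_group_index_dyadic:
  assumes x: "x \<noteq> 0" "\<nexists>w :: 'k. x = w\<^sup>2" and y: "y \<noteq> 0" "\<not> norm_of x y" and z: "z \<noteq> 0" "\<not> norm_of x z"
  shows "norm_of x (y * z)"
proof -
  obtain r w where r: "r \<in> {1, -1, 5, -5, 2, -2, 10, -10 :: int}" "w \<noteq> 0" "x = of_int r * w\<^sup>2"
    using dyadic_square_class[OF x(1)] .
  have "r \<noteq> 1" using r(3) x(2) by auto
  then have "r \<in> {-1, 5, -5, 2, -2, 10, -10}" using r(1) by blast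
  from norm_index_dyadic_int[OF this] obtain c where c: "c \<noteq> 0"
     "\<forall>g\<in>{-1, 2, 5 :: int}. norm_of (of_int r :: 'k) (of_int g) \<or> norm_of (of_int r :: 'k) (of_int (g * c))"
    by (elim exE conjE)
  \<comment> \<open>the union of the norm group and its coset of \<open>c\<close> is a group that contains all generators\<close>
  define M :: "'k \<Rightarrow> bool" where "M y \<longleftrightarrow> norm_of (of_int r) y \<or> norm_of (of_int r) (y * of_int c)" for y
  have c0: "(of_int c :: 'k) \<noteq> 0" using c(1) by simp
  have Mmult: "M (u * v)" if "M u" "M v" for u v
  proof -
    have cc: "norm_of (of_int r :: 'k) (u * v)" if "norm_of (of_int r) (u * v * (of_int c)\<^sup>2)"
      using that norm_of_times_square_iff(1)[OF c0] by blast
    show ?thesis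
      using that norm_of_mult[of "of_int r" u v] norm_of_mult[of "of_int r" u "v * of_int c"]
        norm_of_mult[of "of_int r" "u * of_int c" v] norm_of_mult[of "of_int r" "u * of_int c" "v * of_int c"] cc
      unfolding M_def by (auto simp: mult_ac power2_eq_square)
  qed
  have gen: "M (- 1)" "M 2" "M 5" using c(2) by (simp_all add: M_def)
  have M1: "M (v\<^sup>2)" for v using norm_of_square by (auto simp: M_def)
  have M10: "M 10" using Mmult[OF gen(2,3)] by simp
  have "M 1" "M (- 5)" "M (- 2)" "M (- 10)"
    using M1[of 1] Mmult[OF gen(1) gen(3)] Mmult[OF gen(1) gen(2)] Mmult[OF gen(1) M10] by simp_all
  then have Mr: "M (of_int q)" if "q \<in> {1, -1, 5, -5, 2, -2, 10, -10 :: int}" for q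
    using that gen M10 by (elim insertE emptyE) simp_all
  have Mall: "M v" if "v \<noteq> 0" for v
    by (rule dyadic_square_class[OF that]) (simp only: Mr Mmult M1)
  have nx: "norm_of x a \<longleftrightarrow> norm_of (of_int r) a" for a using norm_of_times_square_iff(2)[OF r(2)] r(3) by simp
  have "norm_of (of_int r :: 'k) (y * of_int c)" "norm_of (of_int r :: 'k) (z * of_int c)"
    using Mall[OF y(1)] Mall[OF z(1)] y(2) z(2) by (auto simp: M_def nx)
  then have "norm_of (of_int r :: 'k) ((y * of_int c) * (z * of_int c))" by (rule norm_of_mult)
  also have "(y * of_int c) * (z * of_int c) = y * z * (of_int c)\<^sup>2" by (simp add: power2_eq_square mult_ac)
  finally show ?thesis using norm_of_times_square_iff(1)[OF c0] nx by blast
qed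

text \<open>Two symbols are computed directly, \<open>(5, 2)\<close> and \<open>(-1, 3)\<close>. Units are norms from the field of \<open>\<surd>5\<close>, so
  \<open>(5, 2)\<close> handles all \<open>x\<close> of odd valuation by symmetry.\<close>

lemma norm_group_proper_dyadic:
  assumes x: "x \<noteq> 0" "\<nexists>w :: 'k. x = w\<^sup>2"
  shows "\<exists>y. y \<noteq> 0 \<and> \<not> norm_of x y"
proof -
  obtain r w where r: "r \<in> {1, -1, 5, -5, 2, -2, 10, -10 :: int}" "w \<noteq> 0" "x = of_int r * w\<^sup>2"
    using dyadic_square_class[OF x(1)] .
  have "r \<noteq> 1" using r(3) x(2) by auto
  then have rr: "r \<in> {-1, 5, -5, 2, -2, 10, -10}" using r(1) by blast
  have nx: "norm_of x a \<longleftrightarrow> norm_of (of_int r) a" for a using norm_of_times_square_iff(2)[OF r(2)] r(3) by simp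
  have sym: "norm_of a b" if "norm_of b a" "a \<noteq> 0" "b \<noteq> 0" for a b :: 'k using norm_of_sym[of b a] that by simp
  have unit5: "norm_of (5 :: 'k) (of_int u)" if "u \<in> {-1, 5, -5 :: int}" for u
    using that norm_of_int_dyadic[of "-1" 2 5 1 "-1" 1 1] norm_of_int_dyadic[of 5 5 5 2 5 5 1] norm_of_neg[of "5 :: 'k"] by auto
  have even5: "\<not> norm_of (5 :: 'k) (of_int m)" if "m \<in> {2, -2, 10, -10}" for m
  proof
    assume 1: "norm_of (5 :: 'k) (of_int m)"
    have "of_int m = of_int (m div 2) * (2 :: 'k)" "m div 2 \<in> {1, -1, 5, -5}" using that by auto
    moreover have "norm_of (5 :: 'k) (of_int (m div 2))" using calculation(2) unit5 norm_of_square[of "5 :: 'k" 1] by auto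
    ultimately have "norm_of (5 :: 'k) 2" using norm_of_cancel[of "5 :: 'k" "of_int (m div 2)" 2] 1 by auto
    then show False using not_norm_5_2 by blast
  qed
  from rr consider "r \<in> {2, -2, 10, -10}" | "r = 5" | "r = -1" | "r = -5" by blast
  then show ?thesis
  proof cases
    case 1
    have "(of_int r :: 'k) \<noteq> 0" using 1 by auto
    then have "\<not> norm_of (of_int r) (5 :: 'k)" using even5[OF 1] sym[of "of_int r" 5] by fastforce
    then show ?thesis using nx by (intro exI[of _ 5]) simp
  next
    case 2
    then show ?thesis using not_norm_5_2 nx by (intro exI[of _ 2]) simp
  next
    case 3
    then show ?thesis using not_sum_two_squares[of 3] nx by (intro exI[of _ 3]) simp
  next
    case 4
    then have "\<not> norm_of (of_int r) (- 1 :: 'k)" using not_sum_two_squares[of "-5"] sym[of "of_int r" "- 1"] by fastforce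
    then show ?thesis using nx by (intro exI[of _ "- 1"]) simp
  qed
qed

end

lemma two_classes: "card (gt_involution_classes TYPE('k)) = 2"
proof -
  obtain u :: 'k where u: "1 + u\<^sup>2 \<noteq> 0" "\<nexists>w. 1 + u\<^sup>2 = w\<^sup>2" using one_plus_square_nonsquare by blast
  show ?thesis
  proof (rule two_classes_if_norm_index_two[OF _ _ _ u refl])
    have "p = 2 \<or> 2 < p" using p_gt_1 by linarith
    then show "\<exists>y. y \<noteq> 0 \<and> \<not> norm_of x y" if "x \<noteq> 0" "\<nexists>w. x = w\<^sup>2" for x :: 'k
      using norm_group_proper_odd norm_group_proper_dyadic that by blast
    show "norm_of x (y * z)" if "x \<noteq> 0" "y \<noteq> 0" "z \<noteq> 0" "\<nexists>w. x = w\<^sup>2" "\<not> norm_of x y" "\<not> norm_of x z" for x y z :: 'k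
      using \<open>p = 2 \<or> 2 < p\<close> norm_group_index_odd norm_group_index_dyadic that by blast
  qed simp
qed

end

lemma two_classes_padic:
  assumes "prime p" "is_padic_field p TYPE('q::field_char_0)"
  shows "card (gt_involution_classes TYPE('q)) = 2"
proof -
  obtain N :: "'q \<Rightarrow> real" where N: "\<forall>x. 0 \<le> N x" "\<forall>x. N x = 0 \<longleftrightarrow> x = 0" "\<forall>x y. N (x * y) = N x * N y"
    "\<forall>x y. N (x + y) \<le> N x + N y" "\<forall>q. N (of_rat q) = padic_abs p q" "\<forall>x. \<forall>e>0. \<exists>q. N (x - of_rat q) < e"
    "\<forall>X :: nat \<Rightarrow> 'q. (\<forall>e>0. \<exists>M. \<forall>m\<ge>M. \<forall>n\<ge>M. N (X m - X n) < e) \<longrightarrow> (\<exists>L. (\<lambda>n. N (X n - L)) \<longlonglongrightarrow> 0)"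
    using assms(2) unfolding is_padic_field_def by (elim exE conjE)
  interpret padic_abs_value p N
  proof
    show "prime p" by fact
    show "0 \<le> N x" "N x = 0 \<longleftrightarrow> x = 0" "N (x * y) = N x * N y" "N (x + y) \<le> N x + N y" "N (of_rat q) = padic_abs p q" for x y q
      using N(1-5) by simp_all
    show "\<exists>q. N (x - of_rat q) < e" if "0 < e" for x e using N(6) that by simp
    show "\<exists>L. (\<lambda>n. N (X n - L)) \<longlonglongrightarrow> 0" if "\<forall>e>0. \<exists>M. \<forall>m\<ge>M. \<forall>n\<ge>M. N (X m - X n) < e" for X
      using N(7)[THEN spec, of X] that by (rule mp)
  qed
  show ?thesis by (rule two_classes)
qed

theorem theorem4p4p8:
  shows "(CHAR('a::alg_closed_field) \<noteq> 2 \<longrightarrow> card (gt_involution_classes TYPE('a)) = 1)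
    \<and> (CARD('p::prime_card) > 2 \<longrightarrow> card (gt_involution_classes TYPE('p mod_ring)) = 1)
    \<and> card (gt_involution_classes TYPE(real)) = 3
    \<and> (\<forall>p. prime p \<and> is_padic_field p TYPE('q::field_char_0) \<longrightarrow>
          card (gt_involution_classes TYPE('q)) = 2)
    \<and> infinite (gt_involution_classes TYPE(rat))"
  using one_class_alg_closed one_class_prime_field real_three_classes two_classes_padic infinite_classes_rat
  by blast

end
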